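(* Let $K:\mathbb R\to\mathbb R_+$ be a kernel (integrable, $\int_{\mathbb R}K=1$, and square integrable), and let the bandwidth maps $(h_k)_{k\geqslant1}$ and the finite sets $(\Gamma_n)_{n\geqslant1}$ be as in the context, satisfying conditions (A$_n$) for the integers $n$ considered, and the following condition: for every $c>0$ and $r\in\{1/2,1\}$, $$\sup_{n\in\mathbb N^*}\sum_{\gamma'\in\Gamma_n}\exp\big(-c/\mathfrak h_n(\gamma')^r\big)<\infty.$$ Let $X_1,\dots,X_n$ be independent random variables with common density $f$. If $f$ is bounded and $\widehat\gamma_n$ is a solution of the minimization problem $$\min_{\gamma\in\Gamma_n}\big(A_n(\gamma)+V_n(\gamma)\big),$$ then there exists a constant $\upsilon_0$ such that, for $\upsilon\geqslant\upsilon_0$ (where $\upsilon$, not depending on $n$, is the constant in the definition of $V_n$), $$\mathbb E\big(\|\widehat f_{n,\mathbf h_n(\widehat\gamma_n)}-f\|_2^2\big)\leqslant c_0\inf_{\gamma\in\Gamma_n}\left(V_n(\gamma)+\frac1{n^2}\left|\sum_{k=1}^n\|f-K_{h_k(\gamma)}\ast f\|_2\right|^2\right)+\frac{c_1}n,$$ where $c_0$ is a numerical constant ($c_0=18$ suits) and $c_1$ is a constant depending on $K$ and $\|f\|_\infty$ (but not on $n$). If in addition, for some $\beta>0$, $L>0$ and $l:=\lfloor\beta\rfloor$: $y\mapsto y^iK(y)$ is integrable for every $i\in\{0,\dots,l\}$, $\int_{\mathbb R}|z|^\beta|K(z)|\,dz<\infty$, $\int_{\mathbb R}y^iK(y)\,dy=0$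 for every $i\in\{1,\dots,l\}$, and $f$ belongs to the Nikol'ski class $\mathcal H(\beta,L)$, then there is a constant $c>0$ not depending on $n$ such that $$\mathbb E\big(\|\widehat f_{n,\mathbf h_n(\widehat\gamma_n)}-f\|_2^2\big)\leqslant c\left\{\inf_{\gamma\in\Gamma_n}\big(\mathbb B_n(\gamma)+\mathbb V_n(\gamma)\big)+\frac1n\right\},$$ where $$\mathbb B_n(\gamma):=\frac1{n^2}\left|\sum_{k=1}^nh_k(\gamma)^\beta\right|^2\quad\text{and}\quad\mathbb V_n(\gamma):=\frac1{n^2}\sum_{k=1}^n\frac1{h_k(\gamma)}.$$
   Context: $\mathbb N^*$ is the set of positive integers; $\lfloor\beta\rfloor$ is the greatest integer less than or equal to $\beta$; $\|\cdot\|_p$ is the $L^p(\mathbb R,dx)$ norm; $\ast$ is convolution on $\mathbb R$; $K_\varepsilon:=(1/\varepsilon)K(\cdot/\varepsilon)$ for $\varepsilon>0$; $x_+=\max(x,0)$. Bandwidths: $h_k:[0,1]\to(0,\infty)$, $k\geqslant1$, are maps, and $\mathbf h_n(\gamma):=(h_1(\gamma),\dots,h_n(\gamma))$. Each $\Gamma_n=\{\gamma_1,\dots,\gamma_{N(n)}\}\subset[0,1]$ is finite. Conditions (A$_n$): for every $\gamma'\in[0,1]$, $0<h_n(\gamma')<\dots<h_1(\gamma')$; the map $h_n(\cdot)$ is decreasing and one-to-one from $[0,1]$ into $(0,1]$; and $\Gamma_n=\{\gamma_1,\dots,\gamma_{N(n)}\}$ with $N(n)\in\{1,\dots,n\}$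 and $0<\gamma_1<\dots<\gamma_{N(n)}\leqslant h_n^{-1}(1/n)$, where $h_n^{-1}$ is the inverse of $h_n(\cdot)$. For $\gamma\in[0,1]$, $\mathfrak h_n(\gamma)$ is defined by $\dfrac1{\mathfrak h_n(\gamma)}:=\dfrac1n\displaystyle\sum_{k=1}^n\frac1{h_k(\gamma)}$. Estimators: for $x\in\mathbb R$ and $\gamma,\gamma'\in[0,1]$, $$\widehat f_{n,\mathbf h_n(\gamma)}(x):=\frac1n\sum_{k=1}^n\frac1{h_k(\gamma)}K\left(\frac{X_k-x}{h_k(\gamma)}\right),\qquad\widehat f_{n,\gamma,\gamma'}(x):=\frac1n\sum_{k=1}^n(K_{h_k(\gamma')}\ast K_{h_k(\gamma)})(X_k-x).$$ Criterion: for $\upsilon>0$ not depending on $n$, $$V_n(\gamma'):=\upsilon\frac{\|K\|_2^2\|K\|_1^2}{n\,\mathfrak h_n(\gamma')},\qquad A_n(\gamma):=\sup_{\gamma'\in\Gamma_n}\big(\|\widehat f_{n,\mathbf h_n(\gamma')}-\widehat f_{n,\gamma,\gamma'}\|_2^2-V_n(\gamma')\big)_+.$$ Nikol'ski class: $\mathcal H(\beta,L)$ is the set of functions $\varphi:\mathbb R\to\mathbb R$ such that, with $l=\lfloor\beta\rfloor$, the derivative $\varphi^{(l)}$ exists and $\left[\int_{-\infty}^\infty(\varphi^{(l)}(x+t)-\varphi^{(l)}(x))^2dx\right]^{1/2}\leqslant L|t|^{\beta-l}$ for all $t\in\mathbb R$. For the particular choice $h_k(\gamma)=k^{-\gamma}$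 with $\gamma\in(0,1)$: $\mathbb B_n(\gamma)=O(n^{-2})$ if $\gamma\beta>1$, $\mathbb B_n(\gamma)=O(n^{-2\gamma\beta})$ if $\gamma\beta<1$, and $\mathbb V_n(\gamma)=O(n^{\gamma-1})$. *)

theory Defs
  imports "HOL-Probability.Probability"
begin

text \<open>The integral below is \<open>0\<close> when \<open>\<bar>g\<bar> powr p\<close> is not integrable, so this is the usual norm
  only on \<open>L\<^sup>p\<close>; below it is applied to functions in \<open>L\<^sup>p\<close> only.\<close>

definition Lp_norm :: "real \<Rightarrow> (real \<Rightarrow> real) \<Rightarrow> real" where
  "Lp_norm p g = (LINT x|lborel. \<bar>g x\<bar> powr p) powr (1 / p)"

definition Linf_norm :: "(real \<Rightarrow> real) \<Rightarrow> real" where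
  "Linf_norm g = real_of_ereal (esssup lborel (\<lambda>x. ereal \<bar>g x\<bar>))"

definition conv :: "(real \<Rightarrow> real) \<Rightarrow> (real \<Rightarrow> real) \<Rightarrow> real \<Rightarrow> real" where
  "conv g1 g2 x = (LINT y|lborel. g1 (x - y) * g2 y)"

definition dilate :: "(real \<Rightarrow> real) \<Rightarrow> real \<Rightarrow> real \<Rightarrow> real" where
  "dilate K \<epsilon> = (\<lambda>x. (1 / \<epsilon>) * K (x / \<epsilon>))"

definition kernel :: "(real \<Rightarrow> real) \<Rightarrow> bool" where
  "kernel K \<longleftrightarrow> (\<forall>x. 0 \<le> K x) \<and> integrable lborel K \<and> (LINT x|lborel. K x) = 1
     \<and> integrable lborel (\<lambda>x. (K x)\<^sup>2)"

text \<open>The value \<open>h k \<gamma>\<close> is meaningful for \<open>k \<ge> 1\<close> and \<open>\<gamma> \<in> {0..1}\<close>, and \<open>\<Gamma> n\<close> for \<open>n \<ge> 1\<close>.\<close>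

definition bandwidths :: "(nat \<Rightarrow> real \<Rightarrow> real) \<Rightarrow> bool" where
  "bandwidths h \<longleftrightarrow> (\<forall>k\<ge>1. \<forall>\<gamma>\<in>{0..1}. 0 < h k \<gamma>)"

definition grids :: "(nat \<Rightarrow> real set) \<Rightarrow> bool" where
  "grids \<Gamma> \<longleftrightarrow> (\<forall>n\<ge>1. finite (\<Gamma> n) \<and> \<Gamma> n \<subseteq> {0..1})"

text \<open>That \<open>1 / n\<close> lies in the range of \<open>h n\<close> is implicit in writing \<open>h\<^sub>n\<^sup>-\<^sup>1(1/n)\<close>.\<close>

definition cond_A :: "(nat \<Rightarrow> real \<Rightarrow> real) \<Rightarrow> (nat \<Rightarrow> real set) \<Rightarrow> nat \<Rightarrow> bool" where
  "cond_A h \<Gamma> n \<longleftrightarrow>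
     (\<forall>\<gamma>'\<in>{0..1}. 0 < h n \<gamma>' \<and> (\<forall>k\<in>{1..<n}. h (Suc k) \<gamma>' < h k \<gamma>'))
     \<and> antimono_on {0..1} (h n) \<and> inj_on (h n) {0..1} \<and> h n ` {0..1} \<subseteq> {0<..1}
     \<and> finite (\<Gamma> n) \<and> card (\<Gamma> n) \<in> {1..n} \<and> 1 / real n \<in> h n ` {0..1}
     \<and> (\<forall>\<gamma>\<in>\<Gamma> n. 0 < \<gamma> \<and> \<gamma> \<le> the_inv_into {0..1} (h n) (1 / real n))"

definition mean_bw :: "(nat \<Rightarrow> real \<Rightarrow> real) \<Rightarrow> nat \<Rightarrow> real \<Rightarrow> real" where
  "mean_bw h n \<gamma> = 1 / ((1 / real n) * (\<Sum>k=1..n. 1 / h k \<gamma>))"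

definition grid_summability :: "(nat \<Rightarrow> real \<Rightarrow> real) \<Rightarrow> (nat \<Rightarrow> real set) \<Rightarrow> bool" where
  "grid_summability h \<Gamma> \<longleftrightarrow> (\<forall>c>0. \<forall>r\<in>{1/2, 1::real}.
     bdd_above ((\<lambda>n. \<Sum>\<gamma>'\<in>\<Gamma> n. exp (- c / mean_bw h n \<gamma>' powr r)) ` {1..}))"

text \<open>In the estimators, \<open>xs k\<close> stands for the observed value of \<open>X\<^sub>k\<close>.\<close>

definition fhat :: "(real \<Rightarrow> real) \<Rightarrow> (nat \<Rightarrow> real \<Rightarrow> real) \<Rightarrow> nat \<Rightarrow> (nat \<Rightarrow> real) \<Rightarrow> real \<Rightarrow> real \<Rightarrow> real"
  where "fhat K h n xs \<gamma> x = (1 / real n) * (\<Sum>k=1..n. (1 / h k \<gamma>) * K ((xs k - x) / h k \<gamma>))"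

definition fhat2 ::
  "(real \<Rightarrow> real) \<Rightarrow> (nat \<Rightarrow> real \<Rightarrow> real) \<Rightarrow> nat \<Rightarrow> (nat \<Rightarrow> real) \<Rightarrow> real \<Rightarrow> real \<Rightarrow> real \<Rightarrow> real"
  where "fhat2 K h n xs \<gamma> \<gamma>' x =
    (1 / real n) * (\<Sum>k=1..n. conv (dilate K (h k \<gamma>')) (dilate K (h k \<gamma>)) (xs k - x))"

definition V_crit :: "(real \<Rightarrow> real) \<Rightarrow> (nat \<Rightarrow> real \<Rightarrow> real) \<Rightarrow> real \<Rightarrow> nat \<Rightarrow> real \<Rightarrow> real" where
  "V_crit K h \<upsilon> n \<gamma>' = \<upsilon> * ((Lp_norm 2 K)\<^sup>2 * (Lp_norm 1 K)\<^sup>2 / (real n * mean_bw h n \<gamma>'))"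

definition A_crit :: "(real \<Rightarrow> real) \<Rightarrow> (nat \<Rightarrow> real \<Rightarrow> real) \<Rightarrow> (nat \<Rightarrow> real set) \<Rightarrow> real \<Rightarrow> nat \<Rightarrow>
    (nat \<Rightarrow> real) \<Rightarrow> real \<Rightarrow> real" where
  "A_crit K h \<Gamma> \<upsilon> n xs \<gamma> = (SUP \<gamma>'\<in>\<Gamma> n.
     max ((Lp_norm 2 (\<lambda>x. fhat K h n xs \<gamma>' x - fhat2 K h n xs \<gamma> \<gamma>' x))\<^sup>2 - V_crit K h \<upsilon> n \<gamma>') 0)"

definition sample_density ::
  "'a measure \<Rightarrow> (nat \<Rightarrow> 'a \<Rightarrow> real) \<Rightarrow> nat \<Rightarrow> (real \<Rightarrow> real) \<Rightarrow> bool" where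
  "sample_density M X n f \<longleftrightarrow> prob_space M \<and> (\<forall>x. 0 \<le> f x)
     \<and> prob_space.indep_vars M (\<lambda>_. borel) X {1..n}
     \<and> (\<forall>k\<in>{1..n}. distributed M lborel (X k) (\<lambda>x. ennreal (f x)))"

definition selected :: "'a measure \<Rightarrow> (nat \<Rightarrow> 'a \<Rightarrow> real) \<Rightarrow> (real \<Rightarrow> real) \<Rightarrow> (nat \<Rightarrow> real \<Rightarrow> real) \<Rightarrow>
    (nat \<Rightarrow> real set) \<Rightarrow> real \<Rightarrow> nat \<Rightarrow> ('a \<Rightarrow> real) \<Rightarrow> bool" where
  "selected M X K h \<Gamma> \<upsilon> n g \<longleftrightarrow> g \<in> borel_measurable M
     \<and> (\<forall>\<omega>\<in>space M. is_arg_min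
          (\<lambda>\<gamma>. A_crit K h \<Gamma> \<upsilon> n (\<lambda>k. X k \<omega>) \<gamma> + V_crit K h \<upsilon> n \<gamma>) (\<lambda>\<gamma>. \<gamma> \<in> \<Gamma> n) (g \<omega>))"

definition risk :: "'a measure \<Rightarrow> (nat \<Rightarrow> 'a \<Rightarrow> real) \<Rightarrow> (real \<Rightarrow> real) \<Rightarrow> (nat \<Rightarrow> real \<Rightarrow> real) \<Rightarrow>
    nat \<Rightarrow> ('a \<Rightarrow> real) \<Rightarrow> (real \<Rightarrow> real) \<Rightarrow> ennreal" where
  "risk M X K h n g f =
     (\<integral>\<^sup>+ \<omega>. ennreal ((Lp_norm 2 (\<lambda>x. fhat K h n (\<lambda>k. X k \<omega>) (g \<omega>) x - f x))\<^sup>2) \<partial>M)"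

text \<open>Integrability is stated separately because the Bochner integral of a non-integrable function
  is \<open>0\<close>.\<close>

definition nikolski :: "real \<Rightarrow> real \<Rightarrow> (real \<Rightarrow> real) set" where
  "nikolski \<beta> L = {\<phi>. let l = nat \<lfloor>\<beta>\<rfloor>; \<phi>l = (deriv ^^ l) \<phi> in
     (\<forall>j<l. \<forall>x. (deriv ^^ j) \<phi> field_differentiable (at x))
     \<and> (\<forall>t. integrable lborel (\<lambda>x. (\<phi>l (x + t) - \<phi>l x)\<^sup>2)
          \<and> sqrt (LINT x|lborel. (\<phi>l (x + t) - \<phi>l x)\<^sup>2) \<le> L * \<bar>t\<bar> powr (\<beta> - real l))}"

definition moment_cond :: "real \<Rightarrow> (real \<Rightarrow> real) \<Rightarrow> bool" where
  "moment_cond \<beta> K \<longleftrightarrow> (let l = nat \<lfloor>\<beta>\<rfloor> in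
     (\<forall>i\<in>{0..l}. integrable lborel (\<lambda>y. y ^ i * K y))
     \<and> integrable lborel (\<lambda>z. \<bar>z\<bar> powr \<beta> * \<bar>K z\<bar>)
     \<and> (\<forall>i\<in>{1..l}. (LINT y|lborel. y ^ i * K y) = 0))"

definition BB :: "(nat \<Rightarrow> real \<Rightarrow> real) \<Rightarrow> real \<Rightarrow> nat \<Rightarrow> real \<Rightarrow> real" where
  "BB h \<beta> n \<gamma> = (1 / (real n)\<^sup>2) * \<bar>\<Sum>k=1..n. h k \<gamma> powr \<beta>\<bar>\<^sup>2"

definition VV :: "(nat \<Rightarrow> real \<Rightarrow> real) \<Rightarrow> nat \<Rightarrow> real \<Rightarrow> real" where
  "VV h n \<gamma> = (1 / (real n)\<^sup>2) * (\<Sum>k=1..n. 1 / h k \<gamma>)"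

end

theory Submission
  imports Defs
begin

text \<open>
  The rule that selects the bandwidth compares every estimator with doubly smoothed ones, and the
  argument rests on the symmetry \<open>fhat2 \<gamma> \<gamma>' = fhat2 \<gamma>' \<gamma>\<close> together with the minimality of the selected
  parameter: for any competitor \<open>\<gamma>\<close> in the grid the loss of the selected estimator is at most
  \<open>6 (A \<gamma> + V \<gamma>)\<close> plus three times the loss of the estimator at \<open>\<gamma>\<close> (lemma \<open>selection_loss\<close>). Both
  \<open>A \<gamma>\<close> and the loss at \<open>\<gamma>\<close> split into a squared bias and a squared noise \<open>\<parallel>N\<parallel>\<^sup>2\<close>, where \<open>N\<close> is a
  normalised sum of independent centred elements of \<open>L\<^sup>2\<close>. With weight 2 on either part the bias
  is counted \<open>6 \<cdot> 2 + 3 \<cdot> 2 = 18\<close> times, and what remains random are the excesses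
  \<open>(\<parallel>N\<parallel>\<^sup>2 - V/2)\<^sub>+\<close>, one for each grid point and one for the estimator at \<open>\<gamma>\<close>.

  The expected excess must be \<open>O(1/n)\<close> with a factor that is summable over the grid, namely
  \<open>exp (- c / sqrt (mean_bw h n \<gamma>'))\<close>. This needs a concentration inequality for norms of sums in
  \<open>L\<^sup>2\<close> whose fluctuations are governed by the weak variance \<open>sup\<^sub>g E \<langle>g, \<phi>\<rangle>\<^sup>2\<close> over unit vectors \<open>g\<close>, which stays bounded by
  a multiple of \<open>\<parallel>f\<parallel>\<^sub>\<infinity>\<close>, and not by \<open>E \<parallel>\<phi>\<parallel>\<^sup>2\<close>, which grows like the inverse bandwidth. A supermartingale
  argument in the manner of Pinelis gives it. For the smooth substitute
  \<open>sqrt (a\<^sup>2 + \<parallel>S\<parallel>\<^sup>2)\<close> of the norm, adding one more centred \<open>\<phi>\<close> changes the value by at most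
  \<open>(\<langle>S, \<phi>\<rangle> + \<parallel>\<phi>\<parallel>\<^sup>2/2) / sqrt (a\<^sup>2 + \<parallel>S\<parallel>\<^sup>2)\<close>. The linear part has mean zero and a second moment below the weak
  variance; the quadratic part is at most \<open>d/(2a)\<close> if \<open>\<parallel>\<phi>\<parallel>\<^sup>2 \<le> d\<close>. If \<open>a\<^sup>2\<close> is the sum of the \<open>d\<close>, the quadratic parts
  add up to \<open>a/2\<close>, so that \<open>\<parallel>S\<parallel>\<close> exceeds \<open>3a/2\<close> only with exponentially small probability, on a scale
  \<open>1/\<lambda>\<close> that is of order \<open>sqrt n\<close> because the bandwidths are at least \<open>1/n\<close> (lemmas
  \<open>exp_moment_step\<close>, \<open>exp_moment_sum\<close>, \<open>excess_sum\<close>, \<open>grid_noise_excess\<close>).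

  The estimator averages \<open>K\<^sub>h(X\<^sub>k - x)\<close>, so its mean is a convolution of \<open>f\<close> with the reflected kernel
  \<open>t \<mapsto> K\<^sub>h(-t)\<close>, whereas the bias in the theorem uses \<open>K\<^sub>h\<close> itself and \<open>K\<close> may be asymmetric. For a real \<open>f\<close>
  both biases have the same norm (lemma \<open>normsq_bias_reflect\<close>), as the Fourier transforms of the two
  kernels are complex conjugates; the proof below moves convolutions across the inner product instead.

  On a Nikol'ski class, Taylor's formula with integral remainder and the vanishing moments reduce
  \<open>f - K\<^sub>h \<star> f\<close> to an average of Taylor remainders, whose \<open>L\<^sup>2\<close> norms are at most \<open>L \<bar>t\<bar>\<^sup>\<beta>\<close>
  (lemmas \<open>taylor_rem_L2\<close>, \<open>kernel_bias_bound\<close>). The bias term is then a multiple of \<open>BB\<close>, while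
  the penalty is a multiple of \<open>VV\<close> by definition.
\<close>


section \<open>Square-integrable functions\<close>

definition L2 :: "(real \<Rightarrow> real) \<Rightarrow> bool" where
  "L2 g \<longleftrightarrow> g \<in> borel_measurable borel \<and> integrable lborel (\<lambda>x. (g x)\<^sup>2)"

definition inner2 :: "(real \<Rightarrow> real) \<Rightarrow> (real \<Rightarrow> real) \<Rightarrow> real" where
  "inner2 g h = (LINT x|lborel. g x * h x)"

definition normsq :: "(real \<Rightarrow> real) \<Rightarrow> real" where
  "normsq g = (LINT x|lborel. (g x)\<^sup>2)"

lemma L2_measurable: "L2 g \<Longrightarrow> g \<in> borel_measurable borel"
  by (simp add: L2_def)

lemma L2_integrable: "L2 g \<Longrightarrow> integrable lborel (\<lambda>x. (g x)\<^sup>2)"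
  by (simp add: L2_def)

lemma normsq_nonneg [simp]: "0 \<le> normsq g"
  by (simp add: normsq_def)

lemma nn_integral_normsq: "L2 g \<Longrightarrow> (\<integral>\<^sup>+x. ennreal ((g x)\<^sup>2) \<partial>lborel) = ennreal (normsq g)"
  unfolding L2_def normsq_def by (intro nn_integral_eq_integral) auto

text \<open>
  Bounds on norms are obtained through nonnegative integrals, where Tonelli's theorem and the
  Cauchy-Schwarz inequality hold without integrability side conditions; this converts them back.
\<close>
lemma normsq_le_of_nn:
  assumes [measurable]: "g \<in> borel_measurable borel"
    and le: "(\<integral>\<^sup>+x. ennreal ((g x)\<^sup>2) \<partial>lborel) \<le> ennreal c" and "0 \<le> c"
  shows "L2 g" "normsq g \<le> c"
proof -
  have i: "integrable lborel (\<lambda>x. (g x)\<^sup>2)"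
    using le by (intro integrableI_nonneg) (auto simp: le_less_trans[OF _ ennreal_less_top])
  then show "L2 g" by (simp add: L2_def)
  then have "ennreal (normsq g) \<le> ennreal c" using le nn_integral_normsq by simp
  then show "normsq g \<le> c" using \<open>0 \<le> c\<close> by simp
qed

lemma L2_mult_integrable:
  assumes "L2 g" "L2 h"
  shows "integrable lborel (\<lambda>x. g x * h x)"
proof (rule Bochner_Integration.integrable_bound[where f = "\<lambda>x. (g x)\<^sup>2 + (h x)\<^sup>2"])
  have [measurable]: "g \<in> borel_measurable borel" "h \<in> borel_measurable borel"
    using assms L2_measurable by auto
  show "integrable lborel (\<lambda>x. (g x)\<^sup>2 + (h x)\<^sup>2)"
    using assms by (simp add: L2_def)
  show "(\<lambda>x. g x * h x) \<in> borel_measurable lborel" by simp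
  have "\<bar>g x * h x\<bar> \<le> \<bar>(g x)\<^sup>2 + (h x)\<^sup>2\<bar>" for x
    using sum_squares_bound[of "\<bar>g x\<bar>" "\<bar>h x\<bar>"] abs_ge_zero[of "g x * h x"]
    unfolding abs_mult power2_abs by linarith
  then show "AE x in lborel. norm (g x * h x) \<le> norm ((g x)\<^sup>2 + (h x)\<^sup>2)"
    by simp
qed

lemma L2_scale: "L2 g \<Longrightarrow> L2 (\<lambda>x. c * g x)"
  by (auto simp: L2_def power_mult_distrib)

lemma L2_add:
  assumes "L2 g" "L2 h"
  shows "L2 (\<lambda>x. g x + h x)"
  using assms L2_mult_integrable[OF assms]
  by (auto simp: L2_def power2_sum mult.assoc)

lemma L2_diff: "L2 g \<Longrightarrow> L2 h \<Longrightarrow> L2 (\<lambda>x. g x - h x)"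
  using L2_add[of g "\<lambda>x. (-1) * h x"] L2_scale[of h "-1"] by simp

lemma L2_zero: "L2 (\<lambda>x. 0)"
  by (simp add: L2_def)

lemma L2_sum: "(\<And>i. i \<in> I \<Longrightarrow> L2 (g i)) \<Longrightarrow> L2 (\<lambda>x. \<Sum>i\<in>I. g i x)"
  by (induction I rule: infinite_finite_induct) (auto simp: L2_zero L2_add)

lemma normsq_scale: "normsq (\<lambda>x. c * g x) = c\<^sup>2 * normsq g"
  by (simp add: normsq_def power_mult_distrib)

lemma normsq_add:
  assumes "L2 g" "L2 h"
  shows "normsq (\<lambda>x. g x + h x) = normsq g + 2 * inner2 g h + normsq h"
  using assms L2_mult_integrable[OF assms]
  by (simp add: L2_def normsq_def inner2_def power2_sum mult.assoc)

lemma inner2_le_normsq: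
  assumes "L2 g" "L2 h"
  shows "2 * \<bar>inner2 g h\<bar> \<le> normsq g + normsq h"
proof -
  have "0 \<le> normsq g + 2 * inner2 g h + normsq h"
    using normsq_add[OF assms] normsq_nonneg by metis
  moreover have "0 \<le> normsq g - 2 * inner2 g h + normsq h"
    using normsq_add[OF assms(1) L2_scale[OF assms(2), of "-1"]] normsq_nonneg[of "\<lambda>x. g x + - 1 * h x"]
      normsq_scale[of "-1" h]
    by (simp add: inner2_def)
  ultimately show ?thesis by linarith
qed

lemma normsq_add_le:
  assumes "L2 g" "L2 h"
  shows "normsq (\<lambda>x. g x + h x) \<le> 2 * normsq g + 2 * normsq h"
  using normsq_add[OF assms] inner2_le_normsq[OF assms] by linarith

lemma normsq_diff_le:
  assumes "L2 g" "L2 h"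
  shows "normsq (\<lambda>x. g x - h x) \<le> 2 * normsq g + 2 * normsq h"
  using normsq_add_le[OF assms(1) L2_scale[OF assms(2), of "-1"]] normsq_scale[of "-1" h] by simp

lemma normsq_minus_commute: "normsq (\<lambda>x. g x - h x) = normsq (\<lambda>x. h x - g x)"
  by (simp add: normsq_def power2_commute)

lemma normsq_diff3_le:
  assumes "L2 a" "L2 b" "L2 c" "L2 d"
  shows "normsq (\<lambda>x. a x - d x) \<le> 3 * (normsq (\<lambda>x. a x - b x) + normsq (\<lambda>x. b x - c x) + normsq (\<lambda>x. c x - d x))"
proof -
  have i: "integrable lborel (\<lambda>x. (a x - b x)\<^sup>2)" "integrable lborel (\<lambda>x. (b x - c x)\<^sup>2)"
    "integrable lborel (\<lambda>x. (c x - d x)\<^sup>2)" "integrable lborel (\<lambda>x. (a x - d x)\<^sup>2)"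
    using assms by (auto intro!: L2_integrable L2_diff)
  have "normsq (\<lambda>x. a x - d x) \<le> (LINT x|lborel. 3 * ((a x - b x)\<^sup>2 + (b x - c x)\<^sup>2 + (c x - d x)\<^sup>2))"
    unfolding normsq_def
  proof (rule integral_mono)
    fix x
    have "0 \<le> ((a x - b x) - (b x - c x))\<^sup>2 + ((b x - c x) - (c x - d x))\<^sup>2 + ((a x - b x) - (c x - d x))\<^sup>2"
      by simp
    then show "(a x - d x)\<^sup>2 \<le> 3 * ((a x - b x)\<^sup>2 + (b x - c x)\<^sup>2 + (c x - d x)\<^sup>2)"
      by (simp add: power2_eq_square algebra_simps)
  qed (use i in auto)
  also have "\<dots> = 3 * (normsq (\<lambda>x. a x - b x) + normsq (\<lambda>x. b x - c x) + normsq (\<lambda>x. c x - d x))"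
    using i by (simp add: normsq_def)
  finally show ?thesis .
qed

lemma inner2_Cauchy_Schwarz:
  assumes "L2 g" "L2 h"
  shows "(inner2 g h)\<^sup>2 \<le> normsq g * normsq h"
proof -
  have [measurable]: "g \<in> borel_measurable borel" "h \<in> borel_measurable borel"
    using assms L2_measurable by auto
  have "ennreal ((inner2 g h)\<^sup>2) \<le> ennreal ((LINT x|lborel. \<bar>g x\<bar> * \<bar>h x\<bar>)\<^sup>2)"
    unfolding inner2_def
    by (intro ennreal_leI)
       (metis (no_types, lifting) abs_mult abs_le_square_iff abs_of_nonneg integral_abs_bound
          Bochner_Integration.integral_cong Bochner_Integration.integral_nonneg abs_ge_zero)
  also have "\<dots> = (\<integral>\<^sup>+x. ennreal \<bar>g x\<bar> * ennreal \<bar>h x\<bar> \<partial>lborel)\<^sup>2"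
    using integrable_abs[OF L2_mult_integrable[OF assms]]
    by (subst ennreal_mult[symmetric])
       (simp_all add: nn_integral_eq_integral abs_mult ennreal_power)
  also have "\<dots> \<le> (\<integral>\<^sup>+x. (ennreal \<bar>g x\<bar>)\<^sup>2 \<partial>lborel) * (\<integral>\<^sup>+x. (ennreal \<bar>h x\<bar>)\<^sup>2 \<partial>lborel)"
    by (intro Cauchy_Schwarz_nn_integral) auto
  also have "\<dots> = ennreal (normsq g * normsq h)"
    using assms by (simp add: ennreal_power nn_integral_normsq ennreal_mult)
  finally show ?thesis by simp
qed

lemma inner2_abs_le:
  assumes "L2 g" "L2 h"
  shows "\<bar>inner2 g h\<bar> \<le> sqrt (normsq g) * sqrt (normsq h)"
  using real_sqrt_le_mono[OF inner2_Cauchy_Schwarz[OF assms]] by (simp add: real_sqrt_mult)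

lemma L2_triangle:
  assumes "L2 g" "L2 h"
  shows "sqrt (normsq (\<lambda>x. g x + h x)) \<le> sqrt (normsq g) + sqrt (normsq h)"
proof (rule real_le_lsqrt)
  show "normsq (\<lambda>x. g x + h x) \<le> (sqrt (normsq g) + sqrt (normsq h))\<^sup>2"
    using normsq_add[OF assms] inner2_abs_le[OF assms] by (simp add: power2_sum)
qed auto

lemma L2_triangle_sum:
  assumes "finite I" "\<And>i. i \<in> I \<Longrightarrow> L2 (g i)"
  shows "sqrt (normsq (\<lambda>x. \<Sum>i\<in>I. g i x)) \<le> (\<Sum>i\<in>I. sqrt (normsq (g i)))"
  using assms
proof (induction I rule: finite_induct)
  case empty
  then show ?case by (simp add: normsq_def)
next
  case (insert i I)
  then have "sqrt (normsq (\<lambda>x. g i x + (\<Sum>i\<in>I. g i x))) \<le> sqrt (normsq (g i)) + sqrt (normsq (\<lambda>x. \<Sum>i\<in>I. g i x))"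
    by (intro L2_triangle L2_sum) auto
  with insert show ?case by simp
qed

section \<open>Concentration of norms of independent sums\<close>

lemma exp_le_quadratic:
  fixes x :: real
  assumes "\<bar>x\<bar> \<le> 1"
  shows "exp x \<le> 1 + x + x\<^sup>2"
proof (cases "0 \<le> x")
  case True
  then show ?thesis using assms exp_bound by simp
next
  case False
  define y where "y = -x"
  have y: "0 < y" "y \<le> 1" using False assms by (auto simp: y_def)
  have "1 \<le> (1 + y) * (1 - y + y\<^sup>2)"
    using y by (simp add: algebra_simps power2_eq_square)
  also have "\<dots> \<le> exp y * (1 - y + y\<^sup>2)"
    using y by (intro mult_right_mono) (auto simp: add_nonneg_nonneg)
  finally have "exp (- y) \<le> 1 - y + y\<^sup>2"
    by (simp add: exp_minus field_simps)
  then show ?thesis by (simp add: y_def)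
qed

text \<open>
  Write \<open>p\<close> for \<open>sqrt (a\<^sup>2 + \<parallel>S\<parallel>\<^sup>2)\<close>. Concavity of the square root bounds the increment by
  \<open>T = (\<langle>S, \<phi>\<rangle> + \<parallel>\<phi>\<parallel>\<^sup>2/2) / p\<close>, and \<open>\<bar>\<lambda> T\<bar> \<le> 1\<close>, so \<open>exp (\<lambda> T)\<close> is at most \<open>1 + \<lambda> T + (\<lambda> T)\<^sup>2\<close>. Because
  \<open>S\<close> is fixed, only \<open>\<langle>S, \<phi>\<rangle>\<close> matters to first order: it has mean zero and second moment at most
  \<open>v \<parallel>S\<parallel>\<^sup>2 \<le> v p\<^sup>2\<close>. The strong norm of \<open>\<phi>\<close> enters through the curvature term only, divided by \<open>a\<close>.
\<close>
lemma exp_moment_step: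
  fixes \<phi> :: "real \<Rightarrow> real \<Rightarrow> real"
  assumes "prob_space \<mu>" and [measurable_cong]: "sets \<mu> = sets borel"
    and [measurable]: "(\<lambda>(y, x). \<phi> y x) \<in> borel_measurable (borel \<Otimes>\<^sub>M borel)"
    and \<phi>: "\<And>y. L2 (\<phi> y)" "\<And>y. normsq (\<phi> y) \<le> d"
    and centred: "(\<integral>y. inner2 S (\<phi> y) \<partial>\<mu>) = 0"
    and weak: "(\<integral>y. (inner2 S (\<phi> y))\<^sup>2 \<partial>\<mu>) \<le> v * normsq S"
    and S: "L2 S" and a: "0 < a" "d \<le> a\<^sup>2" and l: "0 \<le> l" "4 * l\<^sup>2 * d \<le> 1" and v: "0 \<le> v"
  shows "(\<integral>\<^sup>+y. ennreal (exp (l * sqrt (a\<^sup>2 + normsq (\<lambda>x. S x + \<phi> y x)))) \<partial>\<mu>)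
     \<le> ennreal (exp (l * sqrt (a\<^sup>2 + normsq S) + (l * d / (2 * a) + 2 * l\<^sup>2 * v + l\<^sup>2 * d\<^sup>2 / (2 * a\<^sup>2))))"
proof -
  interpret prob_space \<mu> by fact
  have [measurable]: "S \<in> borel_measurable borel" using S L2_measurable by auto
  have d0: "0 \<le> d" using \<phi>(2)[of 0] normsq_nonneg[of "\<phi> 0"] by linarith
  define p where "p = sqrt (a\<^sup>2 + normsq S)"
  have p: "0 < p" "p\<^sup>2 = a\<^sup>2 + normsq S" "a \<le> p" 
    using a by (auto simp: p_def add_pos_nonneg intro!: real_le_rsqrt)
  define I where "I = (\<lambda>y. inner2 S (\<phi> y))"
  define N where "N = (\<lambda>y. normsq (\<phi> y))"
  define T where "T = (\<lambda>y. (I y + N y / 2) / p)"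
  have [measurable]: "I \<in> borel_measurable borel" "N \<in> borel_measurable borel"
    unfolding I_def inner2_def N_def normsq_def by measurable
  have [measurable]: "T \<in> borel_measurable borel" unfolding T_def by measurable
  have N: "0 \<le> N y" "N y \<le> d" for y using \<phi> by (auto simp: N_def)
  have sS: "sqrt (normsq S) \<le> p" unfolding p_def by simp
  have Ib: "\<bar>I y\<bar> \<le> p * sqrt d" for y
  proof -
    have "\<bar>I y\<bar> \<le> sqrt (normsq S) * sqrt (normsq (\<phi> y))"
      unfolding I_def using inner2_abs_le[OF S \<phi>(1)] .
    also have "\<dots> \<le> p * sqrt d"
      using sS \<phi>(2) p by (intro mult_mono) auto
    finally show ?thesis .
  qed
  have Npd: "N y / 2 / p \<le> sqrt d" for y
  proof -
    have "d = sqrt d * sqrt d" using d0 by simp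
    also have "\<dots> \<le> sqrt d * p" 
      using a p d0 order_trans[OF real_le_lsqrt[of a d] p(3)] by (intro mult_left_mono) auto
    finally have "d / 2 \<le> sqrt d * p" using d0 by linarith
    then show ?thesis using N[of y] p by (simp add: field_simps)
  qed
  (* Both parts of T are at most sqrt d, the second one because sqrt d \<le> a \<le> p. *)
  have Tb: "\<bar>T y\<bar> \<le> 2 * sqrt d" for y
  proof -
    have "\<bar>T y\<bar> \<le> \<bar>I y\<bar> / p + N y / 2 / p"
      using abs_triangle_ineq[of "I y / p" "N y / 2 / p"] p N[of y]
      by (simp add: T_def abs_divide add_divide_distrib)
    also have "\<bar>I y\<bar> / p \<le> sqrt d" using Ib[of y] p by (simp add: field_simps)
    finally show ?thesis using Npd[of y] by linarith
  qed
  have lT: "\<bar>l * T y\<bar> \<le> 1" for y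
  proof -
    have "\<bar>l * T y\<bar> \<le> l * (2 * sqrt d)"
      using Tb[of y] l by (simp add: abs_mult mult_left_mono)
    also have "\<dots> \<le> 1"
    proof (rule power2_le_imp_le)
      show "(l * (2 * sqrt d))\<^sup>2 \<le> 1\<^sup>2" using l d0 by (simp add: power_mult_distrib mult_ac)
    qed simp
    finally show ?thesis .
  qed
  have up: "exp (l * sqrt (a\<^sup>2 + normsq (\<lambda>x. S x + \<phi> y x))) \<le> exp (l * p) * (1 + l * T y + (l * T y)\<^sup>2)" for y
  proof -
    have "sqrt (a\<^sup>2 + normsq (\<lambda>x. S x + \<phi> y x)) \<le> p + T y"
    proof (rule real_le_lsqrt)
      have "a\<^sup>2 + normsq (\<lambda>x. S x + \<phi> y x) = p\<^sup>2 + 2 * p * T y"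
        using normsq_add[OF S \<phi>(1)] p by (simp add: T_def I_def N_def)
      also have "\<dots> \<le> (p + T y)\<^sup>2" by (simp add: power2_sum)
      finally show "a\<^sup>2 + normsq (\<lambda>x. S x + \<phi> y x) \<le> (p + T y)\<^sup>2" .
      have "0 \<le> p\<^sup>2 + 2 * p * T y"
        using \<open>a\<^sup>2 + normsq (\<lambda>x. S x + \<phi> y x) = p\<^sup>2 + 2 * p * T y\<close>[symmetric] by simp
      then have "0 \<le> p * (p + 2 * T y)" by (simp add: power2_eq_square algebra_simps)
      then have "0 \<le> p + 2 * T y" using p by (simp add: zero_le_mult_iff)
      then show "0 \<le> p + T y" using p by linarith
    qed
    then have "exp (l * sqrt (a\<^sup>2 + normsq (\<lambda>x. S x + \<phi> y x))) \<le> exp (l * p + l * T y)"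
      using l by (simp add: mult_left_mono flip: distrib_left)
    also have "\<dots> \<le> exp (l * p) * (1 + l * T y + (l * T y)\<^sup>2)"
      unfolding exp_add by (intro mult_left_mono exp_le_quadratic lT) simp
    finally show ?thesis .
  qed
  have Ii: "integrable \<mu> I" 
    by (intro integrable_const_bound[where B = "p * sqrt d"]) (use Ib in auto)
  have Ni: "integrable \<mu> N" 
    by (intro integrable_const_bound[where B = d]) (use N in auto)
  have I2i: "integrable \<mu> (\<lambda>y. (I y)\<^sup>2)"
    by (intro integrable_const_bound[where B = "(p * sqrt d)\<^sup>2"])
       (use Ib p d0 in \<open>auto intro!: abs_le_square_iff[THEN iffD1]\<close>)
  have Ti: "integrable \<mu> T" unfolding T_def using Ii Ni by auto
  have T2b: "(T y)\<^sup>2 \<le> (2 * sqrt d)\<^sup>2" for y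
    using Tb[of y] d0 by (intro abs_le_square_iff[THEN iffD1]) auto
  have T2i: "integrable \<mu> (\<lambda>y. (T y)\<^sup>2)"
    by (intro integrable_const_bound[where B = "(2 * sqrt d)\<^sup>2"]) (use T2b in auto)
  have ET: "(\<integral>y. T y \<partial>\<mu>) \<le> d / (2 * a)"
  proof -
    have "(\<integral>y. T y \<partial>\<mu>) = (\<integral>y. N y \<partial>\<mu>) / 2 / p"
      unfolding T_def using Ii Ni centred by (simp add: I_def)
    also have "\<dots> \<le> d / 2 / a"
      using integral_mono[OF Ni, of "\<lambda>_. d"] N prob_space p a d0 by (intro frac_le) auto
    finally show ?thesis by simp
  qed
  have ET2: "(\<integral>y. (T y)\<^sup>2 \<partial>\<mu>) \<le> 2 * v + d\<^sup>2 / (2 * a\<^sup>2)"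
  proof -
    have "(\<integral>y. (T y)\<^sup>2 \<partial>\<mu>) \<le> (\<integral>y. 2 / p\<^sup>2 * (I y)\<^sup>2 + d\<^sup>2 / (2 * a\<^sup>2) \<partial>\<mu>)"
    proof (rule integral_mono)
      fix y
      have "(T y)\<^sup>2 = (I y + N y / 2)\<^sup>2 / p\<^sup>2" by (simp add: T_def power_divide)
      also have "(I y + N y / 2)\<^sup>2 \<le> 2 * (I y)\<^sup>2 + 2 * (N y / 2)\<^sup>2"
        using sum_squares_bound[of "I y" "N y / 2"] by (simp add: power2_sum)
      also have "2 * (N y / 2)\<^sup>2 \<le> d\<^sup>2 / 2" using N[of y] by (simp add: power_divide power_mono)
      finally have "(T y)\<^sup>2 \<le> (2 * (I y)\<^sup>2 + d\<^sup>2 / 2) / p\<^sup>2" using p by (simp add: divide_right_mono)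
      also have "\<dots> = 2 / p\<^sup>2 * (I y)\<^sup>2 + (d\<^sup>2 / 2) / p\<^sup>2" by (simp add: add_divide_distrib)
      also have "(d\<^sup>2 / 2) / p\<^sup>2 \<le> (d\<^sup>2 / 2) / a\<^sup>2"
        using p(1,3) a(1) by (intro divide_left_mono) (auto intro!: power_mono mult_pos_pos)
      finally show "(T y)\<^sup>2 \<le> 2 / p\<^sup>2 * (I y)\<^sup>2 + d\<^sup>2 / (2 * a\<^sup>2)" by simp
    qed (use T2i I2i in auto)
    also have "\<dots> = 2 / p\<^sup>2 * (\<integral>y. (I y)\<^sup>2 \<partial>\<mu>) + d\<^sup>2 / (2 * a\<^sup>2)"
      using I2i prob_space by simp
    also have "2 / p\<^sup>2 * (\<integral>y. (I y)\<^sup>2 \<partial>\<mu>) \<le> 2 / p\<^sup>2 * (v * p\<^sup>2)"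
    proof (intro mult_left_mono)
      have "(\<integral>y. (I y)\<^sup>2 \<partial>\<mu>) \<le> v * normsq S" using weak by (simp add: I_def)
      also have "\<dots> \<le> v * p\<^sup>2" using v p by (intro mult_left_mono) auto
      finally show "(\<integral>y. (I y)\<^sup>2 \<partial>\<mu>) \<le> v * p\<^sup>2" .
    qed simp
    finally show ?thesis using p(1) by simp
  qed
  have "(\<integral>\<^sup>+y. ennreal (exp (l * sqrt (a\<^sup>2 + normsq (\<lambda>x. S x + \<phi> y x)))) \<partial>\<mu>)
     \<le> (\<integral>\<^sup>+y. ennreal (exp (l * p) * (1 + l * T y + (l * T y)\<^sup>2)) \<partial>\<mu>)"
    using up by (intro nn_integral_mono ennreal_leI) auto
  also have "\<dots> = ennreal (\<integral>y. exp (l * p) * (1 + l * T y + (l * T y)\<^sup>2) \<partial>\<mu>)"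
  proof (rule nn_integral_eq_integral)
    show "integrable \<mu> (\<lambda>y. exp (l * p) * (1 + l * T y + (l * T y)\<^sup>2))"
      using Ti T2i by (simp add: power_mult_distrib)
    show "AE y in \<mu>. 0 \<le> exp (l * p) * (1 + l * T y + (l * T y)\<^sup>2)"
      using order_trans[OF exp_ge_zero up] by (intro AE_I2) blast
  qed
  also have "(\<integral>y. exp (l * p) * (1 + l * T y + (l * T y)\<^sup>2) \<partial>\<mu>)
     = exp (l * p) * (1 + l * (\<integral>y. T y \<partial>\<mu>) + l\<^sup>2 * (\<integral>y. (T y)\<^sup>2 \<partial>\<mu>))"
    using Ti T2i prob_space by (simp add: power_mult_distrib)
  also have "\<dots> \<le> exp (l * p) * (1 + (l * d / (2 * a) + 2 * l\<^sup>2 * v + l\<^sup>2 * d\<^sup>2 / (2 * a\<^sup>2)))"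
  proof (rule mult_left_mono)
    have "l * (\<integral>y. T y \<partial>\<mu>) \<le> l * (d / (2 * a))" using ET l by (intro mult_left_mono) auto
    moreover have "l\<^sup>2 * (\<integral>y. (T y)\<^sup>2 \<partial>\<mu>) \<le> l\<^sup>2 * (2 * v + d\<^sup>2 / (2 * a\<^sup>2))"
      using ET2 by (intro mult_left_mono) auto
    ultimately show "1 + l * (\<integral>y. T y \<partial>\<mu>) + l\<^sup>2 * (\<integral>y. (T y)\<^sup>2 \<partial>\<mu>) \<le>
       1 + (l * d / (2 * a) + 2 * l\<^sup>2 * v + l\<^sup>2 * d\<^sup>2 / (2 * a\<^sup>2))"
      by (simp add: algebra_simps)
  qed simp
  also have "\<dots> \<le> exp (l * p) * exp (l * d / (2 * a) + 2 * l\<^sup>2 * v + l\<^sup>2 * d\<^sup>2 / (2 * a\<^sup>2))"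
    by (intro mult_left_mono exp_ge_add_one_self) simp
  also have "\<dots> = exp (l * p + (l * d / (2 * a) + 2 * l\<^sup>2 * v + l\<^sup>2 * d\<^sup>2 / (2 * a\<^sup>2)))"
    by (simp add: exp_add)
  finally show ?thesis by (simp add: p_def ennreal_leI)
qed


lemma measurable_uncurry2:
  assumes "(\<lambda>(y, x). \<phi> y x) \<in> borel_measurable (M1 \<Otimes>\<^sub>M M2)"
    and "f \<in> N \<rightarrow>\<^sub>M M1" and "g \<in> N \<rightarrow>\<^sub>M M2"
  shows "(\<lambda>p. \<phi> (f p) (g p)) \<in> borel_measurable N"
  using measurable_compose[OF measurable_Pair[OF assms(2,3)] assms(1)] by simp

lemma normsq_sum_measurable:
  assumes "finite I" and [measurable_cong]: "sets \<mu> = sets borel"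
    and m: "\<And>k. k \<in> I \<Longrightarrow> (\<lambda>(y, x). \<phi> k y x) \<in> borel_measurable (borel \<Otimes>\<^sub>M borel)"
  shows "(\<lambda>w. normsq (\<lambda>x. \<Sum>k\<in>I. \<phi> k (w k) x)) \<in> borel_measurable (Pi\<^sub>M I (\<lambda>_. \<mu>))"
proof -
  have [measurable]: "(\<lambda>p. \<phi> k (fst p k) (snd p)) \<in> borel_measurable (Pi\<^sub>M I (\<lambda>_. \<mu>) \<Otimes>\<^sub>M lborel)" 
    if "k \<in> I" for k
    using that by (intro measurable_uncurry2[OF m]) measurable
  have "(\<lambda>(w, x). (\<Sum>k\<in>I. \<phi> k (w k) x)\<^sup>2) \<in> borel_measurable (Pi\<^sub>M I (\<lambda>_. \<mu>) \<Otimes>\<^sub>M lborel)"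
    unfolding split_def by measurable
  then show ?thesis unfolding normsq_def
    by (rule lborel.borel_measurable_lebesgue_integral)
qed

text \<open>
  The one-step bound is uniform in the partial sum, so integrating out one coordinate of the product
  measure after the other multiplies the factors.
\<close>
lemma exp_moment_sum:
  fixes \<phi> :: "'i \<Rightarrow> real \<Rightarrow> real \<Rightarrow> real"
  assumes \<mu>: "prob_space \<mu>" and sets[measurable_cong]: "sets \<mu> = sets borel" and "finite I"
    and m: "\<And>k. k \<in> I \<Longrightarrow> (\<lambda>(y, x). \<phi> k y x) \<in> borel_measurable (borel \<Otimes>\<^sub>M borel)"
    and \<phi>: "\<And>k y. k \<in> I \<Longrightarrow> L2 (\<phi> k y)" "\<And>k y. k \<in> I \<Longrightarrow> normsq (\<phi> k y) \<le> d k"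
    and centred: "\<And>k S. k \<in> I \<Longrightarrow> L2 S \<Longrightarrow> (\<integral>y. inner2 S (\<phi> k y) \<partial>\<mu>) = 0"
    and weak: "\<And>k S. k \<in> I \<Longrightarrow> L2 S \<Longrightarrow> (\<integral>y. (inner2 S (\<phi> k y))\<^sup>2 \<partial>\<mu>) \<le> v * normsq S"
    and a: "0 < a" "\<And>k. k \<in> I \<Longrightarrow> d k \<le> a\<^sup>2" and l: "0 \<le> l" "\<And>k. k \<in> I \<Longrightarrow> 4 * l\<^sup>2 * d k \<le> 1"
    and v: "0 \<le> v"
  shows "(\<integral>\<^sup>+w. ennreal (exp (l * sqrt (a\<^sup>2 + normsq (\<lambda>x. \<Sum>k\<in>I. \<phi> k (w k) x)))) \<partial>(Pi\<^sub>M I (\<lambda>_. \<mu>)))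
     \<le> ennreal (exp (l * a + (\<Sum>k\<in>I. l * d k / (2 * a) + 2 * l\<^sup>2 * v + l\<^sup>2 * (d k)\<^sup>2 / (2 * a\<^sup>2))))"
  using \<open>finite I\<close> m \<phi> centred weak a(2) l(2)
proof (induction I rule: finite_induct)
  case empty
  show ?case using a by (simp add: normsq_def space_PiM_empty PiM_empty)
next
  case (insert i I)
  interpret prob_space \<mu> by fact
  interpret product_sigma_finite "\<lambda>_. \<mu>" by standard
  define c where "c k = l * d k / (2 * a) + 2 * l\<^sup>2 * v + l\<^sup>2 * (d k)\<^sup>2 / (2 * a\<^sup>2)" for k
  define F where "F J w = normsq (\<lambda>x. \<Sum>k\<in>J. \<phi> k (w k) x)" for J w
  have [measurable]: "F (insert i I) \<in> borel_measurable (Pi\<^sub>M (insert i I) (\<lambda>_. \<mu>))"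
    "F I \<in> borel_measurable (Pi\<^sub>M I (\<lambda>_. \<mu>))"
    unfolding F_def using insert.hyps
    by (auto intro!: normsq_sum_measurable[OF _ sets] intro: insert.prems simp del: sum.insert)
  have IH: "(\<integral>\<^sup>+w. ennreal (exp (l * sqrt (a\<^sup>2 + F I w))) \<partial>(Pi\<^sub>M I (\<lambda>_. \<mu>))) \<le> ennreal (exp (l * a + sum c I))"
    unfolding F_def c_def by (rule insert.IH) (auto intro: insert.prems)
  have "(\<integral>\<^sup>+w. ennreal (exp (l * sqrt (a\<^sup>2 + F (insert i I) w))) \<partial>(Pi\<^sub>M (insert i I) (\<lambda>_. \<mu>)))
    = (\<integral>\<^sup>+w. (\<integral>\<^sup>+y. ennreal (exp (l * sqrt (a\<^sup>2 + F (insert i I) (w(i := y))))) \<partial>\<mu>) \<partial>(Pi\<^sub>M I (\<lambda>_. \<mu>)))"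
    using insert.hyps by (intro product_nn_integral_insert) auto
  also have "\<dots> \<le> (\<integral>\<^sup>+w. ennreal (exp (l * sqrt (a\<^sup>2 + F I w))) * ennreal (exp (c i)) \<partial>(Pi\<^sub>M I (\<lambda>_. \<mu>)))"
  proof (rule nn_integral_mono)
    fix w
    have F: "F (insert i I) (w(i := y)) = normsq (\<lambda>x. (\<Sum>k\<in>I. \<phi> k (w k) x) + \<phi> i y x)" for y
    proof -
      have "(\<Sum>k\<in>insert i I. \<phi> k ((w(i := y)) k) x) = (\<Sum>k\<in>I. \<phi> k (w k) x) + \<phi> i y x" for x
        using insert.hyps by (auto intro!: sum.cong simp: add.commute)
      then show ?thesis by (simp add: F_def)
    qed
    have "L2 (\<lambda>x. \<Sum>k\<in>I. \<phi> k (w k) x)"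
      by (intro L2_sum insert.prems(2)) auto
    then have "(\<integral>\<^sup>+y. ennreal (exp (l * sqrt (a\<^sup>2 + F (insert i I) (w(i := y))))) \<partial>\<mu>)
      \<le> ennreal (exp (l * sqrt (a\<^sup>2 + F I w) + c i))"
      unfolding F c_def unfolding F_def
      by (intro exp_moment_step \<mu> sets insert.prems a l v) auto
    then show "(\<integral>\<^sup>+y. ennreal (exp (l * sqrt (a\<^sup>2 + F (insert i I) (w(i := y))))) \<partial>\<mu>)
      \<le> ennreal (exp (l * sqrt (a\<^sup>2 + F I w))) * ennreal (exp (c i))"
      by (simp add: exp_add ennreal_mult)
  qed
  also have "\<dots> = (\<integral>\<^sup>+w. ennreal (exp (l * sqrt (a\<^sup>2 + F I w))) \<partial>(Pi\<^sub>M I (\<lambda>_. \<mu>))) * ennreal (exp (c i))"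
    by (intro nn_integral_multc) measurable
  also have "\<dots> \<le> ennreal (exp (l * a + sum c I)) * ennreal (exp (c i))"
    by (intro mult_right_mono IH) auto
  also have "\<dots> = ennreal (exp (l * a + sum c (insert i I)))"
    using insert.hyps by (simp add: ennreal_mult[symmetric] exp_add mult_ac)
  finally show ?case unfolding F_def c_def .
qed

text \<open>
  The constant 18 is \<open>2 \<cdot> 3\<^sup>2\<close>: from \<open>x\<^sup>2 \<le> 2 (x - 3a)\<^sup>2 + 18 a\<^sup>2\<close> the excess is at most twice the square of
  \<open>x - 3a\<close>, which the exponential dominates. Starting at \<open>3a\<close>, twice the typical size \<open>3a/2\<close> of the norm,
  leaves the factor \<open>exp (- 3 \<lambda> a / 2)\<close>.
\<close>
lemma excess_le_exp:
  fixes a l s :: real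
  assumes "0 < a" "0 < l" "0 \<le> s"
  shows "max (s - 18 * a\<^sup>2) 0 \<le> 4 / l\<^sup>2 * exp (l * (sqrt (a\<^sup>2 + s) - 3 * a))"
proof (cases "s \<le> 18 * a\<^sup>2")
  case True
  then show ?thesis by simp
next
  case False
  define x where "x = sqrt s"
  have x: "x\<^sup>2 = s" "0 \<le> x" using assms by (auto simp: x_def)
  have "3 * a \<le> x" unfolding x_def
    using False by (intro real_le_rsqrt) (simp add: power_mult_distrib, smt (verit) zero_le_power2)
  then have y: "0 \<le> l * (x - 3 * a)" using assms by simp
  have "s - 18 * a\<^sup>2 \<le> 2 * (x - 3 * a)\<^sup>2"
    using x zero_le_power2[of "x - 6 * a"] by (simp add: power2_diff power_mult_distrib)
  also have "\<dots> = 4 / l\<^sup>2 * ((l * (x - 3 * a))\<^sup>2 / 2)"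
    using assms by (simp add: power_mult_distrib)
  also have "\<dots> \<le> 4 / l\<^sup>2 * exp (l * (x - 3 * a))"
    using exp_lower_Taylor_quadratic[OF y] y by (intro mult_left_mono) auto
  also have "\<dots> \<le> 4 / l\<^sup>2 * exp (l * (sqrt (a\<^sup>2 + s) - 3 * a))"
    using assms by (intro mult_left_mono) (auto simp: x_def)
  finally show ?thesis using False by simp
qed

lemma excess_sum:
  fixes \<phi> :: "'i \<Rightarrow> real \<Rightarrow> real \<Rightarrow> real"
  assumes \<mu>: "prob_space \<mu>" and sets[measurable_cong]: "sets \<mu> = sets borel" and "finite I"
    and m: "\<And>k. k \<in> I \<Longrightarrow> (\<lambda>(y, x). \<phi> k y x) \<in> borel_measurable (borel \<Otimes>\<^sub>M borel)"
    and \<phi>: "\<And>k y. k \<in> I \<Longrightarrow> L2 (\<phi> k y)" "\<And>k y. k \<in> I \<Longrightarrow> normsq (\<phi> k y) \<le> d k"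
    and centred: "\<And>k S. k \<in> I \<Longrightarrow> L2 S \<Longrightarrow> (\<integral>y. inner2 S (\<phi> k y) \<partial>\<mu>) = 0"
    and weak: "\<And>k S. k \<in> I \<Longrightarrow> L2 S \<Longrightarrow> (\<integral>y. (inner2 S (\<phi> k y))\<^sup>2 \<partial>\<mu>) \<le> v * normsq S"
    and a: "0 < a" "sum d I = a\<^sup>2" and l: "0 < l" "\<And>k. k \<in> I \<Longrightarrow> 4 * l\<^sup>2 * d k \<le> 1"
    and v: "0 \<le> v" "2 * l\<^sup>2 * v * card I \<le> 1"
  shows "(\<integral>\<^sup>+w. ennreal (max (normsq (\<lambda>x. \<Sum>k\<in>I. \<phi> k (w k) x) - 18 * a\<^sup>2) 0) \<partial>(Pi\<^sub>M I (\<lambda>_. \<mu>)))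
     \<le> ennreal (4 / l\<^sup>2 * exp (2 - 3 / 2 * l * a))"
proof -
  define F where "F w = normsq (\<lambda>x. \<Sum>k\<in>I. \<phi> k (w k) x)" for w
  have [measurable]: "F \<in> borel_measurable (Pi\<^sub>M I (\<lambda>_. \<mu>))"
    unfolding F_def using assms by (intro normsq_sum_measurable) auto
  have d0: "0 \<le> d k" if "k \<in> I" for k
    using \<phi>(2)[OF that, of 0] normsq_nonneg[of "\<phi> k 0"] by linarith
  have da: "d k \<le> a\<^sup>2" if "k \<in> I" for k
    using member_le_sum[of k I d] that d0 \<open>finite I\<close> a by auto
  have "(\<integral>\<^sup>+w. ennreal (max (F w - 18 * a\<^sup>2) 0) \<partial>(Pi\<^sub>M I (\<lambda>_. \<mu>)))
    \<le> (\<integral>\<^sup>+w. ennreal (4 / l\<^sup>2 * exp (- 3 * l * a)) * ennreal (exp (l * sqrt (a\<^sup>2 + F w))) \<partial>(Pi\<^sub>M I (\<lambda>_. \<mu>)))"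
  proof (rule nn_integral_mono)
    fix w
    have "max (F w - 18 * a\<^sup>2) 0 \<le> 4 / l\<^sup>2 * exp (l * (sqrt (a\<^sup>2 + F w) - 3 * a))"
      using a l by (intro excess_le_exp) (auto simp: F_def)
    also have "\<dots> = 4 / l\<^sup>2 * exp (- 3 * l * a) * exp (l * sqrt (a\<^sup>2 + F w))"
      by (simp add: mult_exp_exp algebra_simps)
    finally show "ennreal (max (F w - 18 * a\<^sup>2) 0)
       \<le> ennreal (4 / l\<^sup>2 * exp (- 3 * l * a)) * ennreal (exp (l * sqrt (a\<^sup>2 + F w)))"
      by (subst ennreal_mult[symmetric]) (auto intro!: ennreal_leI)
  qed
  also have "\<dots> = ennreal (4 / l\<^sup>2 * exp (- 3 * l * a)) *
      (\<integral>\<^sup>+w. ennreal (exp (l * sqrt (a\<^sup>2 + F w))) \<partial>(Pi\<^sub>M I (\<lambda>_. \<mu>)))"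
    by (intro nn_integral_cmult) measurable
  also have "\<dots> \<le> ennreal (4 / l\<^sup>2 * exp (- 3 * l * a)) *
     ennreal (exp (l * a + (\<Sum>k\<in>I. l * d k / (2 * a) + 2 * l\<^sup>2 * v + l\<^sup>2 * (d k)\<^sup>2 / (2 * a\<^sup>2))))"
    unfolding F_def using l by (intro mult_left_mono exp_moment_sum assms da) auto
  also have "\<dots> \<le> ennreal (4 / l\<^sup>2 * exp (- 3 * l * a)) * ennreal (exp (l * a + (l * a / 2 + 1 + 1 / 8)))"
  proof (intro mult_left_mono ennreal_leI exp_mono add_left_mono)
    have "(\<Sum>k\<in>I. l * d k / (2 * a) + 2 * l\<^sup>2 * v + l\<^sup>2 * (d k)\<^sup>2 / (2 * a\<^sup>2))
      \<le> (\<Sum>k\<in>I. l * d k / (2 * a) + 2 * l\<^sup>2 * v + d k / (8 * a\<^sup>2))"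
    proof (intro sum_mono add_left_mono)
      fix k assume k: "k \<in> I"
      (* One factor d k is absorbed by the condition on l, so the sum over k is at most 1/8. *)
      have "l\<^sup>2 * (d k)\<^sup>2 / (2 * a\<^sup>2) = (4 * l\<^sup>2 * d k) * (d k / (8 * a\<^sup>2))"
        by (simp add: power2_eq_square)
      also have "\<dots> \<le> 1 * (d k / (8 * a\<^sup>2))"
        using l k d0 by (intro mult_right_mono) auto
      finally show "l\<^sup>2 * (d k)\<^sup>2 / (2 * a\<^sup>2) \<le> d k / (8 * a\<^sup>2)" by simp
    qed
    also have "\<dots> = l * sum d I / (2 * a) + 2 * l\<^sup>2 * v * card I + sum d I / (8 * a\<^sup>2)"
      by (simp add: sum.distrib sum_distrib_left sum_divide_distrib)
    also have "\<dots> \<le> l * a / 2 + 1 + 1 / 8"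
      using v a by (simp add: power2_eq_square)
    finally show "(\<Sum>k\<in>I. l * d k / (2 * a) + 2 * l\<^sup>2 * v + l\<^sup>2 * (d k)\<^sup>2 / (2 * a\<^sup>2)) \<le> l * a / 2 + 1 + 1 / 8" .
  qed auto
  also have "\<dots> = ennreal (4 / l\<^sup>2 * exp (- 3 * l * a + (l * a + (l * a / 2 + 1 + 1 / 8))))"
    unfolding exp_add[of "- 3 * l * a"] by (subst ennreal_mult[symmetric]) (simp_all add: mult.assoc)
  also have "\<dots> \<le> ennreal (4 / l\<^sup>2 * exp (2 - 3 / 2 * l * a))"
    by (intro ennreal_leI mult_left_mono) (auto simp: mult.commute)
  finally show ?thesis unfolding F_def .
qed


lemma ennreal_abs_integral_le:
  fixes f :: "'a \<Rightarrow> real"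
  shows "ennreal \<bar>\<integral>x. f x \<partial>M\<bar> \<le> (\<integral>\<^sup>+x. ennreal \<bar>f x\<bar> \<partial>M)"
  using integral_norm_bound_ennreal[of M f] by (cases "integrable M f") (auto simp: not_integrable_integral_eq)

section \<open>Centring a random element\<close>

context
  fixes \<mu> :: "real measure" and \<Xi> :: "real \<Rightarrow> real \<Rightarrow> real" and c :: real
  assumes \<mu>: "prob_space \<mu>" and sets\<mu>[measurable_cong]: "sets \<mu> = sets borel"
    and \<Xi>m[measurable]: "(\<lambda>(y, x). \<Xi> y x) \<in> borel_measurable (borel \<Otimes>\<^sub>M borel)"
    and \<Xi>: "\<And>y. L2 (\<Xi> y)" "\<And>y. normsq (\<Xi> y) \<le> c"
begin

lemma mean_L2:
  shows "L2 (\<lambda>x. \<integral>y. \<Xi> y x \<partial>\<mu>)" "normsq (\<lambda>x. \<integral>y. \<Xi> y x \<partial>\<mu>) \<le> c"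
proof -
  interpret prob_space \<mu> by (rule \<mu>)
  interpret pair_sigma_finite lborel \<mu> by standard
  have c0: "0 \<le> c" using \<Xi>(2)[of 0] normsq_nonneg[of "\<Xi> 0"] by linarith
  have "ennreal ((\<integral>y. \<Xi> y x \<partial>\<mu>)\<^sup>2) \<le> (\<integral>\<^sup>+y. ennreal ((\<Xi> y x)\<^sup>2) \<partial>\<mu>)" for x
  proof -
    have "ennreal ((\<integral>y. \<Xi> y x \<partial>\<mu>)\<^sup>2) = (ennreal \<bar>\<integral>y. \<Xi> y x \<partial>\<mu>\<bar>)\<^sup>2"
      by (simp add: ennreal_power)
    also have "\<dots> \<le> (\<integral>\<^sup>+y. ennreal \<bar>\<Xi> y x\<bar> * 1 \<partial>\<mu>)\<^sup>2"
      by (intro power_mono_ennreal) (simp add: ennreal_abs_integral_le)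
    also have "\<dots> \<le> (\<integral>\<^sup>+y. (ennreal \<bar>\<Xi> y x\<bar>)\<^sup>2 \<partial>\<mu>) * (\<integral>\<^sup>+y. 1\<^sup>2 \<partial>\<mu>)"
      by (intro Cauchy_Schwarz_nn_integral) measurable
    finally show ?thesis by (simp add: ennreal_power emeasure_space_1)
  qed
  then have "(\<integral>\<^sup>+x. ennreal ((\<integral>y. \<Xi> y x \<partial>\<mu>)\<^sup>2) \<partial>lborel)
      \<le> (\<integral>\<^sup>+x. (\<integral>\<^sup>+y. ennreal ((\<Xi> y x)\<^sup>2) \<partial>\<mu>) \<partial>lborel)"
    by (intro nn_integral_mono)
  also have "\<dots> = (\<integral>\<^sup>+y. (\<integral>\<^sup>+x. ennreal ((\<Xi> y x)\<^sup>2) \<partial>lborel) \<partial>\<mu>)"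
    by (rule Fubini'[symmetric]) measurable
  also have "\<dots> \<le> (\<integral>\<^sup>+y. ennreal c \<partial>\<mu>)"
    using \<Xi> by (intro nn_integral_mono) (simp add: nn_integral_normsq ennreal_leI)
  also have "\<dots> = ennreal c" by (simp add: emeasure_space_1)
  finally have *: "(\<integral>\<^sup>+x. ennreal ((\<integral>y. \<Xi> y x \<partial>\<mu>)\<^sup>2) \<partial>lborel) \<le> ennreal c" .
  show "L2 (\<lambda>x. \<integral>y. \<Xi> y x \<partial>\<mu>)" "normsq (\<lambda>x. \<integral>y. \<Xi> y x \<partial>\<mu>) \<le> c"
    by (rule normsq_le_of_nn[OF _ * c0]; measurable)+
qed

lemma inner2_bounded:
  assumes "L2 g"
  shows "\<bar>inner2 g (\<Xi> y)\<bar> \<le> sqrt (normsq g) * sqrt c"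
  by (rule order_trans[OF inner2_abs_le[OF assms \<Xi>(1)]]) (auto intro!: mult_left_mono simp: \<Xi>(2))

lemma inner2_mean:
  assumes g: "L2 g"
  shows "(\<integral>y. inner2 g (\<Xi> y) \<partial>\<mu>) = inner2 g (\<lambda>x. \<integral>y. \<Xi> y x \<partial>\<mu>)"
proof -
  interpret prob_space \<mu> by (rule \<mu>)
  interpret P: pair_sigma_finite \<mu> lborel by standard
  have [measurable]: "g \<in> borel_measurable borel" using g L2_measurable by auto
  have nn: "normsq (\<lambda>x. \<bar>h x\<bar>) = normsq h" for h by (simp add: normsq_def)
  have L2abs: "L2 (\<lambda>x. \<bar>h x\<bar>)" if "L2 h" for h using that by (auto simp: L2_def)
  have "integrable (\<mu> \<Otimes>\<^sub>M lborel) (\<lambda>(y, x). g x * \<Xi> y x)"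
  proof (rule P.Fubini_integrable)
    show "(\<lambda>(y, x). g x * \<Xi> y x) \<in> borel_measurable (\<mu> \<Otimes>\<^sub>M lborel)" by measurable
    show "AE y in \<mu>. integrable lborel (\<lambda>x. case (y, x) of (y, x) \<Rightarrow> g x * \<Xi> y x)"
      using L2_mult_integrable[OF g \<Xi>(1)] by simp
    have "\<bar>inner2 (\<lambda>x. \<bar>g x\<bar>) (\<lambda>x. \<bar>\<Xi> y x\<bar>)\<bar> \<le> sqrt (normsq g) * sqrt c" for y
      by (rule order_trans[OF inner2_abs_le[OF L2abs[OF g] L2abs[OF \<Xi>(1)]]])
         (auto intro!: mult_left_mono simp: nn \<Xi>(2))
    then have "integrable \<mu> (\<lambda>y. inner2 (\<lambda>x. \<bar>g x\<bar>) (\<lambda>x. \<bar>\<Xi> y x\<bar>))"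
      by (intro integrable_const_bound[where B = "sqrt (normsq g) * sqrt c"]) (auto simp: inner2_def)
    then show "integrable \<mu> (\<lambda>y. \<integral>x. norm (case (y, x) of (y, x) \<Rightarrow> g x * \<Xi> y x) \<partial>lborel)"
      by (simp add: inner2_def abs_mult)
  qed
  from P.Fubini_integral[OF this] show ?thesis by (simp add: inner2_def)
qed

lemma centred_L2:
  shows "L2 (\<lambda>x. \<Xi> y x - (\<integral>y. \<Xi> y x \<partial>\<mu>))" "normsq (\<lambda>x. \<Xi> y x - (\<integral>y. \<Xi> y x \<partial>\<mu>)) \<le> 4 * c"
  using L2_diff[OF \<Xi>(1) mean_L2(1)] normsq_diff_le[OF \<Xi>(1)[of y] mean_L2(1)] \<Xi>(2)[of y] mean_L2(2)
  by auto

lemma inner2_centred: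
  assumes g: "L2 g"
  shows "inner2 g (\<lambda>x. \<Xi> y x - (\<integral>y. \<Xi> y x \<partial>\<mu>)) = inner2 g (\<Xi> y) - (\<integral>y. inner2 g (\<Xi> y) \<partial>\<mu>)"
  unfolding inner2_mean[OF g] unfolding inner2_def
  using L2_mult_integrable[OF g \<Xi>(1)] L2_mult_integrable[OF g mean_L2(1)]
  by (simp add: right_diff_distrib)

text \<open>
  For translates of a kernel the weak second moment is the norm of a convolution, and centring does
  not increase it.
\<close>
lemma inner2_centred_moments:
  assumes g: "L2 g"
  shows "(\<integral>y. inner2 g (\<lambda>x. \<Xi> y x - (\<integral>y. \<Xi> y x \<partial>\<mu>)) \<partial>\<mu>) = 0"
    "(\<integral>y. (inner2 g (\<lambda>x. \<Xi> y x - (\<integral>y. \<Xi> y x \<partial>\<mu>)))\<^sup>2 \<partial>\<mu>) \<le> (\<integral>y. (inner2 g (\<Xi> y))\<^sup>2 \<partial>\<mu>)"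
proof -
  interpret prob_space \<mu> by (rule \<mu>)
  have [measurable]: "g \<in> borel_measurable borel" using g L2_measurable by auto
  have [measurable]: "(\<lambda>y. inner2 g (\<Xi> y)) \<in> borel_measurable borel" unfolding inner2_def by measurable
  have c0: "0 \<le> c" using \<Xi>(2)[of 0] normsq_nonneg[of "\<Xi> 0"] by linarith
  have i: "integrable \<mu> (\<lambda>y. inner2 g (\<Xi> y))"
    by (intro integrable_const_bound[where B = "sqrt (normsq g) * sqrt c"]) (use inner2_bounded[OF g] in auto)
  have b2: "(inner2 g (\<Xi> y))\<^sup>2 \<le> (sqrt (normsq g) * sqrt c)\<^sup>2" for y
    using inner2_bounded[OF g, of y] c0 by (intro abs_le_square_iff[THEN iffD1]) auto
  have i2: "integrable \<mu> (\<lambda>y. (inner2 g (\<Xi> y))\<^sup>2)"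
    by (intro integrable_const_bound[where B = "(sqrt (normsq g) * sqrt c)\<^sup>2"]) (use b2 in auto)
  show "(\<integral>y. inner2 g (\<lambda>x. \<Xi> y x - (\<integral>y. \<Xi> y x \<partial>\<mu>)) \<partial>\<mu>) = 0"
    using i prob_space by (simp add: inner2_centred[OF g])
  show "(\<integral>y. (inner2 g (\<lambda>x. \<Xi> y x - (\<integral>y. \<Xi> y x \<partial>\<mu>)))\<^sup>2 \<partial>\<mu>) \<le> (\<integral>y. (inner2 g (\<Xi> y))\<^sup>2 \<partial>\<mu>)"
    using variance_eq[OF i i2] by (simp add: inner2_centred[OF g])
qed

end

section \<open>Convolution\<close>

definition reflect :: "(real \<Rightarrow> real) \<Rightarrow> real \<Rightarrow> real" where "reflect K t = K (- t)"

lemma integral_reflect_translate: "(LINT y|lborel. F (x - y)) = (LINT y|lborel. F y)"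
  for F :: "real \<Rightarrow> real"
  using lborel_integral_real_affine[of "-1" F x] by simp

lemma nn_integral_reflect_translate:
  "F \<in> borel_measurable borel \<Longrightarrow> (\<integral>\<^sup>+y. F (x - y) \<partial>lborel) = (\<integral>\<^sup>+y. F y \<partial>lborel)"
  for F :: "real \<Rightarrow> ennreal"
  using nn_integral_real_affine[of F "-1" x] by simp

lemma nn_integral_translate:
  "F \<in> borel_measurable borel \<Longrightarrow> (\<integral>\<^sup>+y. F (y - x) \<partial>lborel) = (\<integral>\<^sup>+y. F y \<partial>lborel)"
  for F :: "real \<Rightarrow> ennreal"
  using nn_integral_real_affine[of F "1" "-x"] by simp

lemma integrable_reflect_translate_iff:
  "integrable lborel (\<lambda>y. F (x - y)) \<longleftrightarrow> integrable lborel F" for F :: "real \<Rightarrow> real"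
  using lborel_integrable_real_affine_iff[of "-1" F x] by simp

lemma conv_commute: "conv A C = conv C A"
proof
  fix x
  show "conv A C x = conv C A x"
    using integral_reflect_translate[of "\<lambda>y. C (x - y) * A y" x]
    by (simp add: conv_def mult.commute)
qed

lemma conv_measurable [measurable]:
  assumes [measurable]: "A \<in> borel_measurable borel" "C \<in> borel_measurable borel"
  shows "conv A C \<in> borel_measurable borel"
  unfolding conv_def[abs_def] by measurable

lemma reflect_measurable [measurable]:
  assumes [measurable]: "A \<in> borel_measurable borel"
  shows "reflect A \<in> borel_measurable borel"
  unfolding reflect_def[abs_def] by measurable

lemma reflect_integrable: "integrable lborel A \<Longrightarrow> integrable lborel (reflect A)"
  using integrable_reflect_translate_iff[of A 0] by (simp add: reflect_def[abs_def])

lemma reflect_abs_integral: "(LINT x|lborel. \<bar>reflect A x\<bar>) = (LINT x|lborel. \<bar>A x\<bar>)"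
  using integral_reflect_translate[of "\<lambda>x. \<bar>A x\<bar>" 0] by (simp add: reflect_def)

lemma reflect_conv: "reflect (conv A C) = conv (reflect A) (reflect C)"
proof
  fix x
  show "reflect (conv A C) x = conv (reflect A) (reflect C) x"
    using integral_reflect_translate[of "\<lambda>y. A (- x - y) * C y" 0]
    by (simp add: conv_def reflect_def)
qed

lemma integrable_borel: "integrable lborel A \<Longrightarrow> A \<in> borel_measurable borel"
  using borel_measurable_integrable[of lborel A] by simp

lemma nn_integral_abs:
  "integrable lborel A \<Longrightarrow> (\<integral>\<^sup>+x. ennreal \<bar>A x\<bar> \<partial>lborel) = ennreal (LINT x|lborel. \<bar>A x\<bar>)"
  by (intro nn_integral_eq_integral) auto

text \<open>
  Split \<open>\<bar>A\<bar>\<close> into two square roots and apply the Cauchy-Schwarz inequality to \<open>sqrt \<bar>A\<bar>\<close> and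
  \<open>sqrt \<bar>A\<bar> \<bar>g\<bar>\<close>; Tonelli's theorem and translation invariance give the second factor \<open>\<parallel>A\<parallel>\<^sub>1\<close>.
\<close>
lemma Young_L2:
  assumes A: "integrable lborel A" and g: "L2 g"
  shows "L2 (conv A g)" "normsq (conv A g) \<le> (LINT x|lborel. \<bar>A x\<bar>)\<^sup>2 * normsq g"
proof -
  have [measurable]: "A \<in> borel_measurable borel" "g \<in> borel_measurable borel"
    using A g L2_measurable integrable_borel by auto
  define k where "k = (LINT x|lborel. \<bar>A x\<bar>)"
  have k0: "0 \<le> k" by (simp add: k_def)
  have kA: "(\<integral>\<^sup>+y. ennreal \<bar>A (x - y)\<bar> \<partial>lborel) = ennreal k" for x
    using nn_integral_abs[OF A] by (subst nn_integral_reflect_translate[of "\<lambda>y. ennreal \<bar>A y\<bar>"]) (auto simp: k_def)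
  have kA': "(\<integral>\<^sup>+x. ennreal \<bar>A (x - y)\<bar> \<partial>lborel) = ennreal k" for y
    using nn_integral_abs[OF A] by (subst nn_integral_translate[of "\<lambda>y. ennreal \<bar>A y\<bar>"]) (auto simp: k_def)
  have pt: "ennreal ((conv A g x)\<^sup>2) \<le> ennreal k * (\<integral>\<^sup>+y. ennreal (\<bar>A (x - y)\<bar> * (g y)\<^sup>2) \<partial>lborel)" for x
  proof -
    have "ennreal ((conv A g x)\<^sup>2) = (ennreal \<bar>conv A g x\<bar>)\<^sup>2"
      by (simp add: ennreal_power)
    also have "\<dots> \<le> (\<integral>\<^sup>+y. ennreal \<bar>A (x - y) * g y\<bar> \<partial>lborel)\<^sup>2"
      unfolding conv_def by (intro power_mono_ennreal) (simp add: ennreal_abs_integral_le)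
    also have "(\<lambda>y. ennreal \<bar>A (x - y) * g y\<bar>) =
        (\<lambda>y. ennreal (sqrt \<bar>A (x - y)\<bar>) * ennreal (sqrt \<bar>A (x - y)\<bar> * \<bar>g y\<bar>))"
      by (auto simp: ennreal_mult[symmetric] abs_mult fun_eq_iff)
    also have "(\<integral>\<^sup>+y. ennreal (sqrt \<bar>A (x - y)\<bar>) * ennreal (sqrt \<bar>A (x - y)\<bar> * \<bar>g y\<bar>) \<partial>lborel)\<^sup>2
      \<le> (\<integral>\<^sup>+y. (ennreal (sqrt \<bar>A (x - y)\<bar>))\<^sup>2 \<partial>lborel) * (\<integral>\<^sup>+y. (ennreal (sqrt \<bar>A (x - y)\<bar> * \<bar>g y\<bar>))\<^sup>2 \<partial>lborel)"
      by (intro Cauchy_Schwarz_nn_integral) measurable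
    finally show ?thesis by (simp add: ennreal_power power_mult_distrib kA)
  qed
  have "(\<integral>\<^sup>+x. ennreal ((conv A g x)\<^sup>2) \<partial>lborel)
    \<le> (\<integral>\<^sup>+x. ennreal k * (\<integral>\<^sup>+y. ennreal (\<bar>A (x - y)\<bar> * (g y)\<^sup>2) \<partial>lborel) \<partial>lborel)"
    by (intro nn_integral_mono pt)
  also have "\<dots> = ennreal k * (\<integral>\<^sup>+x. (\<integral>\<^sup>+y. ennreal (\<bar>A (x - y)\<bar> * (g y)\<^sup>2) \<partial>lborel) \<partial>lborel)"
    by (intro nn_integral_cmult) measurable
  also have "(\<integral>\<^sup>+x. (\<integral>\<^sup>+y. ennreal (\<bar>A (x - y)\<bar> * (g y)\<^sup>2) \<partial>lborel) \<partial>lborel)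
     = (\<integral>\<^sup>+y. (\<integral>\<^sup>+x. ennreal (\<bar>A (x - y)\<bar> * (g y)\<^sup>2) \<partial>lborel) \<partial>lborel)"
    by (rule lborel_pair.Fubini'[symmetric]) measurable
  also have "\<dots> = (\<integral>\<^sup>+y. ennreal k * ennreal ((g y)\<^sup>2) \<partial>lborel)"
    by (simp add: ennreal_mult nn_integral_multc kA')
  also have "\<dots> = ennreal k * ennreal (normsq g)"
    using g by (simp add: nn_integral_cmult nn_integral_normsq)
  also have "ennreal k * (ennreal k * ennreal (normsq g)) = ennreal (k\<^sup>2 * normsq g)"
    using k0 by (simp add: ennreal_mult[symmetric] power2_eq_square mult.assoc)
  finally have *: "(\<integral>\<^sup>+x. ennreal ((conv A g x)\<^sup>2) \<partial>lborel) \<le> ennreal (k\<^sup>2 * normsq g)" .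
  show "L2 (conv A g)" "normsq (conv A g) \<le> (LINT x|lborel. \<bar>A x\<bar>)\<^sup>2 * normsq g"
    unfolding k_def[symmetric] using normsq_le_of_nn[OF _ *] by auto
qed

lemma Young_L1:
  assumes A: "integrable lborel A" and C: "integrable lborel C"
  shows "integrable lborel (conv A C)"
    "(LINT x|lborel. \<bar>conv A C x\<bar>) \<le> (LINT x|lborel. \<bar>A x\<bar>) * (LINT x|lborel. \<bar>C x\<bar>)"
proof -
  have [measurable]: "A \<in> borel_measurable borel" "C \<in> borel_measurable borel"
    using A C integrable_borel by auto
  have "(\<integral>\<^sup>+x. ennreal \<bar>conv A C x\<bar> \<partial>lborel) \<le> (\<integral>\<^sup>+x. (\<integral>\<^sup>+y. ennreal (\<bar>A (x - y)\<bar> * \<bar>C y\<bar>) \<partial>lborel) \<partial>lborel)"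
    unfolding conv_def abs_mult[symmetric] by (intro nn_integral_mono ennreal_abs_integral_le)
  also have "\<dots> = (\<integral>\<^sup>+y. (\<integral>\<^sup>+x. ennreal (\<bar>A (x - y)\<bar> * \<bar>C y\<bar>) \<partial>lborel) \<partial>lborel)"
    by (rule lborel_pair.Fubini'[symmetric]) measurable
  also have "\<dots> = (\<integral>\<^sup>+y. ennreal (LINT x|lborel. \<bar>A x\<bar>) * ennreal \<bar>C y\<bar> \<partial>lborel)"
    using nn_integral_abs[OF A] nn_integral_translate[of "\<lambda>y. ennreal \<bar>A y\<bar>"]
    by (simp add: ennreal_mult nn_integral_multc)
  also have "\<dots> = ennreal ((LINT x|lborel. \<bar>A x\<bar>) * (LINT x|lborel. \<bar>C x\<bar>))"
    using nn_integral_abs[OF C] by (simp add: nn_integral_cmult ennreal_mult)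
  finally have *: "(\<integral>\<^sup>+x. ennreal \<bar>conv A C x\<bar> \<partial>lborel) \<le> ennreal ((LINT x|lborel. \<bar>A x\<bar>) * (LINT x|lborel. \<bar>C x\<bar>))" .
  then show i: "integrable lborel (conv A C)"
    by (intro integrableI_bounded) (auto simp: le_less_trans[OF _ ennreal_less_top])
  show "(LINT x|lborel. \<bar>conv A C x\<bar>) \<le> (LINT x|lborel. \<bar>A x\<bar>) * (LINT x|lborel. \<bar>C x\<bar>)"
    using * unfolding nn_integral_abs[OF i] by simp
qed


lemma conv_translate: "conv A C x = (LINT u|lborel. C (x - u) * A u)"
  using fun_cong[OF conv_commute[of A C], of x] by (simp add: conv_def)

lemma integrable_pair_of_nn:
  fixes F :: "real \<Rightarrow> real \<Rightarrow> real"
  assumes [measurable]: "(\<lambda>(x, y). F x y) \<in> borel_measurable (borel \<Otimes>\<^sub>M borel)"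
    and "(\<integral>\<^sup>+x. (\<integral>\<^sup>+y. ennreal \<bar>F x y\<bar> \<partial>lborel) \<partial>lborel) < \<infinity>"
  shows "integrable (lborel \<Otimes>\<^sub>M lborel) (\<lambda>(x, y). F x y)"
proof (rule integrableI_bounded)
  show "(\<lambda>(x, y). F x y) \<in> borel_measurable (lborel \<Otimes>\<^sub>M lborel)" by measurable
  have "(\<integral>\<^sup>+p. ennreal (norm (case p of (x, y) \<Rightarrow> F x y)) \<partial>(lborel \<Otimes>\<^sub>M lborel))
    = (\<integral>\<^sup>+x. (\<integral>\<^sup>+y. ennreal \<bar>F x y\<bar> \<partial>lborel) \<partial>lborel)"
    by (subst lborel.nn_integral_fst[symmetric]) (auto simp: split_def)
  then show "(\<integral>\<^sup>+p. ennreal (norm (case p of (x, y) \<Rightarrow> F x y)) \<partial>(lborel \<Otimes>\<^sub>M lborel)) < \<infinity>"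
    using assms(2) by simp
qed

lemma nn_integral_conv_abs:
  fixes A C :: "real \<Rightarrow> real"
  assumes A: "integrable lborel A" and C: "integrable lborel C"
  shows "(\<integral>\<^sup>+w. (\<integral>\<^sup>+z. ennreal (\<bar>A (z - w)\<bar> * \<bar>C w\<bar>) \<partial>lborel) \<partial>lborel)
    = ennreal ((LINT x|lborel. \<bar>A x\<bar>) * (LINT x|lborel. \<bar>C x\<bar>))"
proof -
  have [measurable]: "A \<in> borel_measurable borel" "C \<in> borel_measurable borel"
    using A C integrable_borel by auto
  show ?thesis
    using nn_integral_abs[OF A] nn_integral_abs[OF C] nn_integral_translate[of "\<lambda>y. ennreal \<bar>A y\<bar>"]
    by (simp add: ennreal_mult nn_integral_multc nn_integral_cmult)
qed

text \<open>
  Associativity and commutativity hold at every point, not merely almost everywhere, as boundedness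
  of \<open>f\<close> makes the double integral absolutely convergent for each argument.
\<close>
lemma conv_conv_bounded:
  assumes A: "integrable lborel A" and C: "integrable lborel C"
    and [measurable]: "f \<in> borel_measurable borel" and f: "\<And>x. \<bar>f x\<bar> \<le> B"
  shows "conv (conv A C) f = conv C (conv A f)"
proof
  fix x
  have [measurable]: "A \<in> borel_measurable borel" "C \<in> borel_measurable borel"
    using A C integrable_borel by auto
  have B: "0 \<le> B" using f[of 0] by linarith
  define F where "F w z = A (z - w) * C w * f (x - z)" for w z
  have [measurable]: "(\<lambda>(w, z). F w z) \<in> borel_measurable (borel \<Otimes>\<^sub>M borel)"
    unfolding F_def by measurable
  have "(\<integral>\<^sup>+w. (\<integral>\<^sup>+z. ennreal \<bar>F w z\<bar> \<partial>lborel) \<partial>lborel)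
    \<le> (\<integral>\<^sup>+w. (\<integral>\<^sup>+z. ennreal B * ennreal (\<bar>A (z - w)\<bar> * \<bar>C w\<bar>) \<partial>lborel) \<partial>lborel)"
    using f B by (intro nn_integral_mono)
      (auto simp: F_def abs_mult ennreal_mult[symmetric] mult.commute[of B] intro!: ennreal_leI mult_left_mono)
  also have "\<dots> = ennreal B * ennreal ((LINT x|lborel. \<bar>A x\<bar>) * (LINT x|lborel. \<bar>C x\<bar>))"
    unfolding nn_integral_conv_abs[OF A C, symmetric] by (simp add: nn_integral_cmult)
  also have "\<dots> < \<infinity>" by (simp add: ennreal_mult_less_top)
  finally have "integrable (lborel \<Otimes>\<^sub>M lborel) (\<lambda>(w, z). F w z)"
    by (intro integrable_pair_of_nn) simp_all
  from lborel_pair.Fubini_integral[OF this]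
  have "(LINT z|lborel. LINT w|lborel. F w z) = (LINT w|lborel. LINT z|lborel. F w z)" .
  moreover have "(LINT z|lborel. LINT w|lborel. F w z) = conv (conv A C) f x"
    by (simp add: F_def conv_translate[of "conv A C"]) (simp add: conv_def mult.commute)
  moreover have "(LINT w|lborel. LINT z|lborel. F w z) = (LINT w|lborel. conv A f (x - w) * C w)"
  proof (rule Bochner_Integration.integral_cong[OF refl])
    fix w
    have "(LINT z|lborel. F w z) = (LINT u|lborel. F w (w + u))"
      using lborel_integral_real_affine[of 1 "F w" w] by simp
    also have "\<dots> = (LINT u|lborel. f (x - w - u) * A u * C w)"
      by (intro Bochner_Integration.integral_cong) (auto simp: F_def diff_diff_eq)
    finally show "(LINT z|lborel. F w z) = conv A f (x - w) * C w"
      by (simp add: conv_translate)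
  qed
  ultimately show "conv (conv A C) f x = conv C (conv A f) x"
    by (simp add: conv_translate[of C])
qed

lemma conv_conv_swap:
  assumes "integrable lborel A" "integrable lborel C"
    "f \<in> borel_measurable borel" "\<And>x. \<bar>f x\<bar> \<le> B"
  shows "conv A (conv C f) = conv C (conv A f)"
  using conv_conv_bounded[OF assms] conv_conv_bounded[OF assms(2,1,3,4)] conv_commute[of A C] by simp

lemma conv_integrable_bounded:
  fixes A C f g :: "real \<Rightarrow> real"
  assumes A: "integrable lborel A" and [measurable]: "f \<in> borel_measurable borel" and f: "\<And>x. \<bar>f x\<bar> \<le> B"
  shows "integrable lborel (\<lambda>y. A (x - y) * f y)"
proof (rule Bochner_Integration.integrable_bound[where f = "\<lambda>y. B * A (x - y)"])
  have [measurable]: "A \<in> borel_measurable borel" using integrable_borel[OF A] .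
  show "(\<lambda>y. A (x - y) * f y) \<in> borel_measurable lborel" by simp
  show "integrable lborel (\<lambda>y. B * A (x - y))"
    using A by (simp add: integrable_reflect_translate_iff)
  show "AE y in lborel. norm (A (x - y) * f y) \<le> norm (B * A (x - y))"
    using f order_trans[OF abs_ge_zero f] by (auto simp: abs_mult mult.commute[of B] intro!: mult_left_mono)
qed

lemma conv_bounded:
  fixes A C f g :: "real \<Rightarrow> real"
  assumes A: "integrable lborel A" and f: "f \<in> borel_measurable borel" "\<And>x. \<bar>f x\<bar> \<le> B"
  shows "\<bar>conv A f x\<bar> \<le> (LINT x|lborel. \<bar>A x\<bar>) * B"
proof -
  have "\<bar>conv A f x\<bar> \<le> (LINT y|lborel. \<bar>A (x - y) * f y\<bar>)"
    unfolding conv_def by (rule integral_abs_bound)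
  also have "\<dots> \<le> (LINT y|lborel. \<bar>A (x - y)\<bar> * B)"
    using integrable_abs[OF conv_integrable_bounded[OF assms, of x]] A f(2)
    by (intro integral_mono) (auto simp: abs_mult integrable_reflect_translate_iff[of "\<lambda>y. \<bar>A y\<bar>"] intro!: mult_left_mono)
  also have "\<dots> = (LINT x|lborel. \<bar>A x\<bar>) * B"
    using integral_reflect_translate[of "\<lambda>y. \<bar>A y\<bar>" x] by simp
  finally show ?thesis .
qed

lemma conv_diff_right:
  fixes A C f g :: "real \<Rightarrow> real"
  assumes "integrable lborel A" "f \<in> borel_measurable borel" "\<And>x. \<bar>f x\<bar> \<le> B"
    "g \<in> borel_measurable borel" "\<And>x. \<bar>g x\<bar> \<le> B'"
  shows "conv A (\<lambda>x. f x - g x) x = conv A f x - conv A g x"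
  using conv_integrable_bounded[OF assms(1,2,3), of x] conv_integrable_bounded[OF assms(1,4,5), of x]
  by (simp add: conv_def right_diff_distrib)

lemma conv_diff_left:
  fixes A C f g :: "real \<Rightarrow> real"
  assumes "integrable lborel A" "integrable lborel C" "f \<in> borel_measurable borel" "\<And>x. \<bar>f x\<bar> \<le> B"
  shows "conv (\<lambda>x. A x - C x) f x = conv A f x - conv C f x"
  using conv_integrable_bounded[OF assms(1,3,4), of x] conv_integrable_bounded[OF assms(2,3,4), of x]
  by (simp add: conv_def left_diff_distrib)

text \<open>
  The inequality \<open>\<bar>g x h y\<bar> \<le> (g x)\<^sup>2 + (h y)\<^sup>2\<close> makes \<open>g x K(x - y) h y\<close> integrable on the plane, so Fubini's
  theorem applies.
\<close>
lemma inner2_conv_adjoint: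
  assumes K: "integrable lborel K" and g: "L2 g" and h: "L2 h"
  shows "inner2 g (conv K h) = inner2 (conv (reflect K) g) h"
proof -
  have [measurable]: "K \<in> borel_measurable borel" "g \<in> borel_measurable borel" "h \<in> borel_measurable borel"
    using K g h L2_measurable integrable_borel by auto
  define F where "F x y = g x * K (x - y) * h y" for x y
  have [measurable]: "(\<lambda>(x, y). F x y) \<in> borel_measurable (borel \<Otimes>\<^sub>M borel)"
    unfolding F_def by measurable
  have "integrable lborel (\<lambda>x. (g x)\<^sup>2)" "integrable lborel (\<lambda>x. (h x)\<^sup>2)"
    using g h L2_integrable by auto
  note i = nn_integral_conv_abs[OF K this(1)] nn_integral_conv_abs[OF K this(2)]
  have "(\<integral>\<^sup>+x. (\<integral>\<^sup>+y. ennreal \<bar>F x y\<bar> \<partial>lborel) \<partial>lborel)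
    \<le> (\<integral>\<^sup>+x. (\<integral>\<^sup>+y. ennreal (\<bar>reflect K (y - x)\<bar> * \<bar>(g x)\<^sup>2\<bar>) + ennreal (\<bar>K (x - y)\<bar> * \<bar>(h y)\<^sup>2\<bar>) \<partial>lborel) \<partial>lborel)"
  proof (intro nn_integral_mono)
    fix x y
    have "\<bar>g x\<bar> * \<bar>h y\<bar> \<le> (g x)\<^sup>2 + (h y)\<^sup>2"
      using sum_squares_bound[of "\<bar>g x\<bar>" "\<bar>h y\<bar>"] mult_nonneg_nonneg[OF abs_ge_zero abs_ge_zero, of "g x" "h y"]
      unfolding power2_abs by linarith
    then have "\<bar>K (x - y)\<bar> * (\<bar>g x\<bar> * \<bar>h y\<bar>) \<le> \<bar>K (x - y)\<bar> * ((g x)\<^sup>2 + (h y)\<^sup>2)"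
      by (intro mult_left_mono) auto
    then show "ennreal \<bar>F x y\<bar> \<le> ennreal (\<bar>reflect K (y - x)\<bar> * \<bar>(g x)\<^sup>2\<bar>) + ennreal (\<bar>K (x - y)\<bar> * \<bar>(h y)\<^sup>2\<bar>)"
      by (subst ennreal_plus[symmetric])
         (auto intro!: ennreal_leI simp: F_def reflect_def abs_mult algebra_simps simp del: ennreal_plus)
  qed
  also have "\<dots> = (\<integral>\<^sup>+x. (\<integral>\<^sup>+y. ennreal (\<bar>reflect K (y - x)\<bar> * \<bar>(g x)\<^sup>2\<bar>) \<partial>lborel) \<partial>lborel)
      + (\<integral>\<^sup>+x. (\<integral>\<^sup>+y. ennreal (\<bar>K (x - y)\<bar> * \<bar>(h y)\<^sup>2\<bar>) \<partial>lborel) \<partial>lborel)"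
    by (simp add: nn_integral_add)
  also have "(\<integral>\<^sup>+x. (\<integral>\<^sup>+y. ennreal (\<bar>K (x - y)\<bar> * \<bar>(h y)\<^sup>2\<bar>) \<partial>lborel) \<partial>lborel)
    = (\<integral>\<^sup>+y. (\<integral>\<^sup>+x. ennreal (\<bar>K (x - y)\<bar> * \<bar>(h y)\<^sup>2\<bar>) \<partial>lborel) \<partial>lborel)"
    by (rule lborel_pair.Fubini'[symmetric]) measurable
  also note i(2)
  also note nn_integral_conv_abs[OF reflect_integrable[OF K] L2_integrable[OF g]]
  finally have "(\<integral>\<^sup>+x. (\<integral>\<^sup>+y. ennreal \<bar>F x y\<bar> \<partial>lborel) \<partial>lborel) < \<infinity>"
    by (simp add: le_less_trans)
  then have "integrable (lborel \<Otimes>\<^sub>M lborel) (\<lambda>(x, y). F x y)"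
    by (intro integrable_pair_of_nn) simp_all
  from lborel_pair.Fubini_integral[OF this]
  have "(LINT x|lborel. LINT y|lborel. F x y) = (LINT y|lborel. LINT x|lborel. F x y)" by simp
  moreover have "(LINT y|lborel. F x y) = g x * conv K h x" for x
    by (simp add: F_def conv_def mult.assoc)
  moreover have "(LINT x|lborel. F x y) = conv (reflect K) g y * h y" for y
    by (simp add: F_def conv_def reflect_def mult.commute[of "g _"])
  ultimately show ?thesis by (simp add: inner2_def)
qed

lemma normsq_eq_inner2: "normsq g = inner2 g g"
  by (simp add: normsq_def inner2_def power2_eq_square)

lemma inner2_commute: "inner2 g h = inner2 h g"
  by (simp add: inner2_def mult.commute)

lemma reflect_reflect [simp]: "reflect (reflect A) = A"
  by (simp add: reflect_def[abs_def])

text \<open>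
  Expand the square. The cross terms agree because reflection is the adjoint; the norms of the two
  convolutions agree because convolution with \<open>K\<close> commutes with its adjoint.
\<close>
lemma normsq_bias_reflect:
  assumes K: "integrable lborel K" and f: "L2 f" "\<And>x. \<bar>f x\<bar> \<le> B"
  shows "normsq (\<lambda>x. f x - conv (reflect K) f x) = normsq (\<lambda>x. f x - conv K f x)"
proof -
  note K' = reflect_integrable[OF K]
  have expand: "normsq (\<lambda>x. f x - conv A f x) = normsq f - 2 * inner2 f (conv A f) + normsq (conv A f)"
    if "integrable lborel A" for A
    using normsq_add[OF f(1) L2_scale[OF Young_L2(1)[OF that f(1)], of "-1"]] normsq_scale[of "-1" "conv A f"]
    by (simp add: inner2_def)
  have 1: "inner2 f (conv (reflect K) f) = inner2 f (conv K f)"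
    using inner2_conv_adjoint[OF K f(1) f(1)] by (simp add: inner2_commute)
  have "normsq (conv (reflect K) f) = inner2 (conv K (conv (reflect K) f)) f"
    using inner2_conv_adjoint[OF K' Young_L2(1)[OF K' f(1)] f(1)] by (simp add: normsq_eq_inner2)
  also have "\<dots> = inner2 (conv (reflect K) (conv K f)) f"
    using conv_conv_swap[OF K K' L2_measurable[OF f(1)] f(2)] by simp
  also have "\<dots> = normsq (conv K f)"
    using inner2_conv_adjoint[OF K Young_L2(1)[OF K f(1)] f(1)] by (simp add: normsq_eq_inner2)
  finally show ?thesis unfolding expand[OF K] expand[OF K'] 1 by simp
qed

lemma L2_reflect_translate: "L2 g \<Longrightarrow> L2 (\<lambda>x. g (c - x))"
  using integrable_reflect_translate_iff[of "\<lambda>x. (g x)\<^sup>2" c] by (auto simp: L2_def)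

lemma dilate_integrable:
  assumes "0 < h" "integrable lborel K"
  shows "integrable lborel (dilate K h)"
  using lborel_integrable_real_affine[OF assms(2), of "1 / h" 0] assms by (simp add: dilate_def)

lemma dilate_abs_integral:
  assumes "0 < h"
  shows "(LINT x|lborel. \<bar>dilate K h x\<bar>) = (LINT x|lborel. \<bar>K x\<bar>)"
  using lborel_integral_real_affine[of "1 / h" "\<lambda>x. \<bar>K x\<bar>" 0] assms by (simp add: dilate_def abs_mult)

lemma normsq_dilate:
  assumes "0 < h"
  shows "normsq (dilate K h) = normsq K / h"
  using lborel_integral_real_affine[of "1 / h" "\<lambda>x. (K x)\<^sup>2" 0] assms
  by (simp add: normsq_def dilate_def power_divide power2_eq_square)

lemma L2_dilate:
  assumes "0 < h" "L2 K"
  shows "L2 (dilate K h)"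
proof -
  have [measurable]: "K \<in> borel_measurable borel" using assms L2_measurable by auto
  show ?thesis
    using lborel_integrable_real_affine[OF L2_integrable[OF assms(2)], of "1 / h" 0] assms
    by (auto simp: dilate_def L2_def power_divide)
qed

section \<open>Noise of kernel estimators\<close>

text \<open>
  Here \<open>\<phi>\<close> is \<open>x \<mapsto> \<kappa>(y - x)\<close> minus its mean. Its inner product with \<open>S\<close> is \<open>(\<kappa> \<star> S)(y)\<close> up to centring, so
  Young's inequality bounds the weak variance by \<open>B \<parallel>\<kappa>\<parallel>\<^sub>1\<^sup>2 \<le> 4B\<close>, however small the bandwidth. The factor
  4 in \<open>4 * normsq (\<kappa> k) \<le> d k\<close> pays for centring.
\<close>
lemma noise_excess:
  fixes f :: "real \<Rightarrow> real" and \<kappa> :: "'i \<Rightarrow> real \<Rightarrow> real"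
  assumes prob: "prob_space (density lborel (\<lambda>x. ennreal (f x)))"
    and fm[measurable]: "f \<in> borel_measurable borel" and f0: "\<And>x. 0 \<le> f x"
    and fB: "AE x in lborel. f x \<le> B" and B: "0 \<le> B" and "finite I"
    and \<kappa>: "\<And>k. k \<in> I \<Longrightarrow> integrable lborel (\<kappa> k)" "\<And>k. k \<in> I \<Longrightarrow> L2 (\<kappa> k)"
      "\<And>k. k \<in> I \<Longrightarrow> (LINT x|lborel. \<bar>\<kappa> k x\<bar>) \<le> 2" "\<And>k. k \<in> I \<Longrightarrow> 4 * normsq (\<kappa> k) \<le> d k"
    and a: "0 < a" "sum d I = a\<^sup>2" and l: "0 < l" "\<And>k. k \<in> I \<Longrightarrow> 4 * l\<^sup>2 * d k \<le> 1"
    and v: "8 * l\<^sup>2 * B * card I \<le> 1"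
  shows "(\<integral>\<^sup>+w. ennreal (max (normsq (\<lambda>x. \<Sum>k\<in>I. \<kappa> k (w k - x) - conv (reflect (\<kappa> k)) f x) - 18 * a\<^sup>2) 0)
      \<partial>(Pi\<^sub>M I (\<lambda>_. density lborel (\<lambda>x. ennreal (f x)))))
     \<le> ennreal (4 / l\<^sup>2 * exp (2 - 3 / 2 * l * a))"
proof -
  define \<mu> where "\<mu> = density lborel (\<lambda>x. ennreal (f x))"
  have \<mu>: "prob_space \<mu>" and sets: "sets \<mu> = sets borel" using prob by (simp_all add: \<mu>_def)
  define \<Xi> where "\<Xi> k y x = \<kappa> k (y - x)" for k y x
  have m: "(\<lambda>(y, x). \<Xi> k y x) \<in> borel_measurable (borel \<Otimes>\<^sub>M borel)" if "k \<in> I" for k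
  proof -
    have [measurable]: "\<kappa> k \<in> borel_measurable borel" using \<kappa>(2)[OF that] L2_measurable by auto
    show ?thesis unfolding \<Xi>_def by measurable
  qed
  have L2\<Xi>: "L2 (\<Xi> k y)" if "k \<in> I" for k y
    using \<kappa>(2)[OF that] integrable_reflect_translate_iff[of "\<lambda>x. (\<kappa> k x)\<^sup>2" y]
    by (auto simp: L2_def \<Xi>_def[abs_def])
  have normsq\<Xi>: "normsq (\<Xi> k y) \<le> normsq (\<kappa> k)" for k y
    using integral_reflect_translate[of "\<lambda>x. (\<kappa> k x)\<^sup>2" y] by (simp add: normsq_def \<Xi>_def)
  have mean: "(\<integral>y. \<Xi> k y x \<partial>\<mu>) = conv (reflect (\<kappa> k)) f x" if "k \<in> I" for k x
  proof -
    have [measurable]: "\<kappa> k \<in> borel_measurable borel" using \<kappa>(2)[OF that] L2_measurable by auto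
    show ?thesis unfolding \<mu>_def \<Xi>_def
      using f0 by (subst integral_density) (auto simp: conv_def reflect_def mult.commute)
  qed
  define \<phi> where "\<phi> k y x = \<Xi> k y x - (\<integral>y. \<Xi> k y x \<partial>\<mu>)" for k y x
  have "(\<integral>\<^sup>+w. ennreal (max (normsq (\<lambda>x. \<Sum>k\<in>I. \<phi> k (w k) x) - 18 * a\<^sup>2) 0) \<partial>(Pi\<^sub>M I (\<lambda>_. \<mu>)))
     \<le> ennreal (4 / l\<^sup>2 * exp (2 - 3 / 2 * l * a))"
  proof (rule excess_sum[OF \<mu> sets \<open>finite I\<close>, where d = d and v = "4 * B"])
    fix k assume k: "k \<in> I"
    interpret prob_space \<mu> by (rule \<mu>)
    have [measurable]: "\<kappa> k \<in> borel_measurable borel" using \<kappa>(2)[OF k] L2_measurable by auto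
    show "(\<lambda>(y, x). \<phi> k y x) \<in> borel_measurable (borel \<Otimes>\<^sub>M borel)"
      unfolding \<phi>_def mean[OF k] unfolding \<Xi>_def by measurable
    show "L2 (\<phi> k y)" for y
      unfolding \<phi>_def[abs_def] by (rule centred_L2[OF \<mu> sets m[OF k] L2\<Xi>[OF k] normsq\<Xi>])
    show "normsq (\<phi> k y) \<le> d k" for y
      unfolding \<phi>_def[abs_def]
      by (rule order_trans[OF centred_L2(2)[OF \<mu> sets m[OF k] L2\<Xi>[OF k] normsq\<Xi>] \<kappa>(4)[OF k]])
    fix S assume S: "L2 S"
    have [measurable]: "S \<in> borel_measurable borel" using S L2_measurable by auto
    show "(\<integral>y. inner2 S (\<phi> k y) \<partial>\<mu>) = 0"
      unfolding \<phi>_def[abs_def] by (rule inner2_centred_moments[OF \<mu> sets m[OF k] L2\<Xi>[OF k] normsq\<Xi> S])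
    have "(\<integral>y. (inner2 S (\<phi> k y))\<^sup>2 \<partial>\<mu>) \<le> (\<integral>y. (inner2 S (\<Xi> k y))\<^sup>2 \<partial>\<mu>)"
      unfolding \<phi>_def[abs_def] by (rule inner2_centred_moments[OF \<mu> sets m[OF k] L2\<Xi>[OF k] normsq\<Xi> S])
    also have "\<dots> = (\<integral>y. (conv (\<kappa> k) S y)\<^sup>2 \<partial>\<mu>)"
      by (simp add: inner2_def conv_def \<Xi>_def mult.commute)
    also have "\<dots> = (LINT y|lborel. f y * (conv (\<kappa> k) S y)\<^sup>2)"
      unfolding \<mu>_def using f0 by (subst integral_density) auto
    also have "\<dots> \<le> (LINT y|lborel. B * (conv (\<kappa> k) S y)\<^sup>2)"
    proof (rule integral_mono_AE')
      show "integrable lborel (\<lambda>y. B * (conv (\<kappa> k) S y)\<^sup>2)"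
        using L2_integrable[OF Young_L2(1)[OF \<kappa>(1)[OF k] S]] by simp
      show "AE y in lborel. f y * (conv (\<kappa> k) S y)\<^sup>2 \<le> B * (conv (\<kappa> k) S y)\<^sup>2"
        using fB by (auto elim!: eventually_mono intro: mult_right_mono)
    qed (use B in auto)
    also have "\<dots> = B * normsq (conv (\<kappa> k) S)" by (simp add: normsq_def)
    also have "\<dots> \<le> B * (2\<^sup>2 * normsq S)"
      using Young_L2(2)[OF \<kappa>(1)[OF k] S] B \<kappa>(3)[OF k]
      by (intro mult_left_mono order_trans[OF Young_L2(2)[OF \<kappa>(1)[OF k] S]] mult_right_mono power_mono) auto
    finally show "(\<integral>y. (inner2 S (\<phi> k y))\<^sup>2 \<partial>\<mu>) \<le> 4 * B * normsq S" by simp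
  qed (use a l B v in \<open>auto simp: mult_ac\<close>)
  moreover have "(\<Sum>k\<in>I. \<phi> k (w k) x) = (\<Sum>k\<in>I. \<kappa> k (w k - x) - conv (reflect (\<kappa> k)) f x)" for w x
    by (intro sum.cong) (auto simp: \<phi>_def mean, simp add: \<Xi>_def)
  ultimately show ?thesis by (simp add: \<mu>_def)
qed


section \<open>Bias on Nikol'ski classes\<close>

text \<open>
  Taylor's formula yields a gauge integral of a derivative that merely exists everywhere. Admitting an
  infinite bound carries it over to Lebesgue integrals: if the bound is finite, both integrals agree.
\<close>
lemma has_integral_abs_le_nn:
  fixes q p :: "real \<Rightarrow> real"
  assumes I: "(q has_integral I) {0..1}" and [measurable]: "q \<in> borel_measurable borel"
    and le: "\<And>s. s \<in> {0..1} \<Longrightarrow> \<bar>q s\<bar> \<le> p s"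
  shows "ennreal \<bar>I\<bar> \<le> (\<integral>\<^sup>+s. ennreal (p s) * indicator {0..1} s \<partial>lborel)"
proof (cases "(\<integral>\<^sup>+s. ennreal (p s) * indicator {0..1} s \<partial>lborel) = \<infinity>")
  case False
  have nn: "(\<integral>\<^sup>+s. ennreal \<bar>indicator {0..1} s *\<^sub>R q s\<bar> \<partial>lborel) \<le> (\<integral>\<^sup>+s. ennreal (p s) * indicator {0..1} s \<partial>lborel)"
    using le by (intro nn_integral_mono) (auto split: split_indicator intro!: ennreal_leI)
  also have "\<dots> < \<infinity>" using False by (simp add: less_top)
  finally have "set_integrable lborel {0..1} q"
    unfolding set_integrable_def by (intro integrableI_bounded) auto
  from set_borel_integral_eq_integral(2)[OF this] I
  have "I = (LINT s|lborel. indicator {0..1} s *\<^sub>R q s)"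
    by (simp add: set_lebesgue_integral_def integral_unique)
  then have "ennreal \<bar>I\<bar> \<le> (\<integral>\<^sup>+s. ennreal \<bar>indicator {0..1} s *\<^sub>R q s\<bar> \<partial>lborel)"
    by (simp add: ennreal_abs_integral_le)
  from order_trans[OF this nn] show ?thesis .
qed simp

text \<open>
  A derivative that exists everywhere is a pointwise limit of difference quotients.
\<close>
lemma measurable_deriv:
  fixes g :: "real \<Rightarrow> real"
  assumes "\<And>x. g field_differentiable (at x)"
  shows "deriv g \<in> borel_measurable borel"
proof (rule borel_measurable_LIMSEQ_real)
  have "continuous_on UNIV g"
    using assms by (intro continuous_at_imp_continuous_on ballI field_differentiable_imp_continuous_at) auto
  then have [measurable]: "g \<in> borel_measurable borel" by (rule borel_measurable_continuous_onI)
  show "(\<lambda>x. (g (x + inverse (real (Suc n))) - g x) / inverse (real (Suc n))) \<in> borel_measurable borel" for n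
    by measurable
  fix x
  have "(g has_field_derivative deriv g x) (at x)"
    using assms field_differentiable_derivI by blast
  then have "((\<lambda>h. (g (x + h) - g x) / h) \<longlongrightarrow> deriv g x) (at 0)" by (simp add: DERIV_def)
  moreover have "filterlim (\<lambda>n. inverse (real (Suc n))) (at 0) sequentially"
    using LIMSEQ_inverse_real_of_nat by (auto simp: filterlim_at)
  ultimately show "(\<lambda>n. (g (x + inverse (real (Suc n))) - g x) / inverse (real (Suc n))) \<longlonglongrightarrow> deriv g x"
    by (rule filterlim_compose)
qed

definition taylor_rem :: "nat \<Rightarrow> (real \<Rightarrow> real) \<Rightarrow> real \<Rightarrow> real \<Rightarrow> real" where
  "taylor_rem l f x t = f (x + t) - (\<Sum>j\<le>l. t ^ j / fact j * (deriv ^^ j) f x)"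

lemma taylor_rem_zero: "taylor_rem l f x 0 = 0"
  by (simp add: taylor_rem_def sum.atMost_shift power_0_left)

context
  fixes f :: "real \<Rightarrow> real" and \<beta> L :: real and l :: nat
  assumes nik: "f \<in> nikolski \<beta> L" and \<beta>: "0 < \<beta>" and L: "0 < L" and l: "l = nat \<lfloor>\<beta>\<rfloor>"
    and fm: "f \<in> borel_measurable borel"
begin

lemma nikolski_differentiable: "j < l \<Longrightarrow> (deriv ^^ j) f field_differentiable (at x)"
  using nik by (simp add: nikolski_def Let_def l)

lemma nikolski_deriv_measurable: "j \<le> l \<Longrightarrow> (deriv ^^ j) f \<in> borel_measurable borel"
  using measurable_deriv[of "(deriv ^^ (j - 1)) f"] nikolski_differentiable[of "j - 1"] fm
  by (cases j) auto

lemma nikolski_increment: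
  "(\<integral>\<^sup>+x. ennreal (((deriv ^^ l) f (x + t) - (deriv ^^ l) f x)\<^sup>2) \<partial>lborel) \<le> ennreal ((L * \<bar>t\<bar> powr (\<beta> - l))\<^sup>2)"
proof -
  define I where "I = (LINT x|lborel. ((deriv ^^ l) f (x + t) - (deriv ^^ l) f x)\<^sup>2)"
  have i: "integrable lborel (\<lambda>x. ((deriv ^^ l) f (x + t) - (deriv ^^ l) f x)\<^sup>2)"
    and s: "sqrt I \<le> L * \<bar>t\<bar> powr (\<beta> - l)"
    using nik unfolding nikolski_def Let_def l[symmetric] I_def by auto
  have "I = (sqrt I)\<^sup>2" by (simp add: I_def)
  also have "\<dots> \<le> (L * \<bar>t\<bar> powr (\<beta> - l))\<^sup>2" by (intro power_mono s) (simp add: I_def)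
  finally show ?thesis
    using i by (subst nn_integral_eq_integral) (auto simp: I_def intro: ennreal_leI)
qed

lemma taylor_rem_measurable:
  "(\<lambda>(x, t). taylor_rem l f x t) \<in> borel_measurable (borel \<Otimes>\<^sub>M borel)"
proof -
  have [measurable]: "(deriv ^^ j) f \<in> borel_measurable borel" if "j \<in> {..l}" for j
    using nikolski_deriv_measurable that by simp
  note [measurable] = fm
  show ?thesis unfolding taylor_rem_def by measurable
qed

text \<open>
  This is the classical formula of order \<open>l - 1\<close> with its last derivative centred at \<open>x\<close>, which turns
  it into an average of increments of the \<open>l\<close>-th derivative, the quantity that the class controls.
\<close>
lemma taylor_rem_integral:
  assumes "1 \<le> l"
  shows "((\<lambda>s. (1 - s) ^ (l - 1) / fact (l - 1) * (t ^ l * ((deriv ^^ l) f (x + s * t) - (deriv ^^ l) f x)))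
     has_integral taylor_rem l f x t) {0..1}"
proof -
  define D where "D j = (deriv ^^ j) f" for j
  have D: "(D m has_field_derivative D (Suc m) y) (at y)" if "m < l" for m y
    using field_differentiable_derivI[OF nikolski_differentiable[OF that]] by (simp add: D_def)
  have "((\<lambda>s. t ^ m * D m (x + s * t)) has_vector_derivative t ^ Suc m * D (Suc m) (x + s * t)) (at s within {0..1})"
    if "m < l" for m s
  proof -
    have "((\<lambda>s. D m (x + s * t)) has_field_derivative D (Suc m) (x + s * t) * t) (at s)"
      by (rule DERIV_chain2[OF D[OF that]]) (auto intro!: derivative_eq_intros)
    then have "((\<lambda>s. t ^ m * D m (x + s * t)) has_field_derivative t ^ Suc m * D (Suc m) (x + s * t)) (at s)"
      by (auto intro!: derivative_eq_intros)
    then show ?thesis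
      using has_real_derivative_iff_has_vector_derivative has_vector_derivative_at_within by blast
  qed
  from Taylor_has_integral[of l "\<lambda>m s. t ^ m * D m (x + s * t)" "\<lambda>s. t ^ 0 * D 0 (x + s * t)" 0 1, OF _ refl this]
  have 1: "((\<lambda>s. (1 - s) ^ (l - 1) / fact (l - 1) * (t ^ l * D l (x + s * t)))
     has_integral f (x + t) - (\<Sum>i<l. t ^ i / fact i * D i x)) {0..1}"
    using assms by (simp add: D_def)
  have "((\<lambda>s. (1 - s) ^ (l - 1) / fact (l - 1)) has_integral - ((1 - 1) ^ l / fact l) - - ((1 - 0) ^ l / fact l :: real)) {0..1}"
  proof (rule fundamental_theorem_of_calculus)
    fix s :: real
    have "((\<lambda>s. - ((1 - s) ^ l / fact l)) has_field_derivative (1 - s) ^ (l - 1) / fact (l - 1)) (at s)"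
      using assms by (auto intro!: derivative_eq_intros simp: fact_reduce[of l] field_simps)
    then show "((\<lambda>s. - ((1 - s) ^ l / fact l)) has_vector_derivative (1 - s) ^ (l - 1) / fact (l - 1)) (at s within {0..1})"
      using has_real_derivative_iff_has_vector_derivative has_vector_derivative_at_within by blast
  qed simp
  then have 2: "((\<lambda>s. (1 - s) ^ (l - 1) / fact (l - 1) * (t ^ l * D l x)) has_integral 1 / fact l * (t ^ l * D l x)) {0..1}"
    using assms by (intro has_integral_mult_left) (simp add: power_0_left)
  have "taylor_rem l f x t = f (x + t) - (\<Sum>i<l. t ^ i / fact i * D i x) - 1 / fact l * (t ^ l * D l x)"
    by (simp add: taylor_rem_def D_def lessThan_Suc_atMost[symmetric])
  with has_integral_diff[OF 1 2] show ?thesis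
    by (simp add: D_def right_diff_distrib)
qed

text \<open>
  Jensen's inequality on the unit interval and Tonelli's theorem pass the \<open>L\<^sup>2\<close> norm inside the remainder
  integral, where the increment over \<open>s t\<close> is at most the allowed increment over \<open>t\<close>.
\<close>
lemma taylor_rem_L2:
  "(\<integral>\<^sup>+x. ennreal ((taylor_rem l f x t)\<^sup>2) \<partial>lborel) \<le> ennreal ((L * \<bar>t\<bar> powr \<beta>)\<^sup>2)"
proof (cases "l = 0")
  case True
  with nikolski_increment[of t] show ?thesis by (simp add: taylor_rem_def)
next
  case False
  define g where "g = (deriv ^^ l) f"
  have [measurable]: "g \<in> borel_measurable borel" unfolding g_def using nikolski_deriv_measurable by simp
  define u where "u x s = \<bar>g (x + s * t) - g x\<bar>" for x s
  have [measurable]: "(\<lambda>(x, s). u x s) \<in> borel_measurable (borel \<Otimes>\<^sub>M borel)"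
    unfolding u_def by measurable
  (* If \<beta> is an integer the exponent is 0, and 0 powr 0 = 0; monotonicity of powr covers this. *)
  have bl: "0 \<le> \<beta> - l" using \<beta> unfolding l by linarith
  have pt: "ennreal ((taylor_rem l f x t)\<^sup>2)
      \<le> ennreal ((\<bar>t\<bar> ^ l)\<^sup>2) * (\<integral>\<^sup>+s. ennreal ((u x s)\<^sup>2) * indicator {0..1} s \<partial>lborel)" for x
  proof -
    have "ennreal \<bar>taylor_rem l f x t\<bar> \<le> (\<integral>\<^sup>+s. ennreal (\<bar>t\<bar> ^ l * u x s) * indicator {0..1} s \<partial>lborel)"
    proof (rule has_integral_abs_le_nn[OF taylor_rem_integral])
      show "1 \<le> l" using False by simp
      show "(\<lambda>s. (1 - s) ^ (l - 1) / fact (l - 1) * (t ^ l * ((deriv ^^ l) f (x + s * t) - (deriv ^^ l) f x)))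
         \<in> borel_measurable borel"
        unfolding g_def[symmetric] by measurable
      fix s :: real assume s: "s \<in> {0..1}"
      have "(1 - s) ^ (l - 1) / fact (l - 1) \<le> 1 / 1"
        using s by (intro frac_le power_le_one) (auto simp: fact_ge_1)
      then have "(1 - s) ^ (l - 1) / fact (l - 1) * (\<bar>t\<bar> ^ l * u x s) \<le> 1 * (\<bar>t\<bar> ^ l * u x s)"
        by (intro mult_right_mono) (auto simp: u_def)
      then show "\<bar>(1 - s) ^ (l - 1) / fact (l - 1) * (t ^ l * ((deriv ^^ l) f (x + s * t) - (deriv ^^ l) f x))\<bar>
         \<le> \<bar>t\<bar> ^ l * u x s"
        using s by (simp add: abs_mult u_def g_def power_abs)
    qed
    also have "\<dots> = ennreal (\<bar>t\<bar> ^ l) * (\<integral>\<^sup>+s. ennreal (u x s) * indicator {0..1} s \<partial>lborel)"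
      by (subst nn_integral_cmult[symmetric]) (auto simp: ennreal_mult u_def mult.assoc)
    finally have rem: "ennreal \<bar>taylor_rem l f x t\<bar>
      \<le> ennreal (\<bar>t\<bar> ^ l) * (\<integral>\<^sup>+s. ennreal (u x s) * indicator {0..1} s \<partial>lborel)" .
    have "ennreal ((taylor_rem l f x t)\<^sup>2) = (ennreal \<bar>taylor_rem l f x t\<bar>)\<^sup>2"
      by (simp add: ennreal_power)
    also have "\<dots> \<le> (ennreal (\<bar>t\<bar> ^ l) * (\<integral>\<^sup>+s. ennreal (u x s) * indicator {0..1} s \<partial>lborel))\<^sup>2"
      by (intro power_mono_ennreal rem)
    also have "(\<lambda>s. ennreal (u x s) * indicator {0..1} s) =
        (\<lambda>s. (ennreal (u x s) * indicator {0..1} s) * indicator {0..1} s)"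
      by (auto simp: fun_eq_iff split: split_indicator)
    also have "(ennreal (\<bar>t\<bar> ^ l) * (\<integral>\<^sup>+s. (ennreal (u x s) * indicator {0..1} s) * indicator {0..1} s \<partial>lborel))\<^sup>2
      \<le> ennreal ((\<bar>t\<bar> ^ l)\<^sup>2) * ((\<integral>\<^sup>+s. (ennreal (u x s) * indicator {0..1} s)\<^sup>2 \<partial>lborel) *
        (\<integral>\<^sup>+s. (indicator {0..1::real} s)\<^sup>2 \<partial>lborel))"
      unfolding power_mult_distrib ennreal_power[OF zero_le_power[OF abs_ge_zero]]
      unfolding power_mult_distrib[symmetric]
      by (intro mult_left_mono Cauchy_Schwarz_nn_integral) (auto simp: u_def)
    also have "\<dots> = ennreal ((\<bar>t\<bar> ^ l)\<^sup>2) * ((\<integral>\<^sup>+s. ennreal ((u x s)\<^sup>2) * indicator {0..1} s \<partial>lborel) * 1)"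
    proof -
      have "(\<integral>\<^sup>+s. (indicator {0..1::real} s)\<^sup>2 \<partial>lborel) = (\<integral>\<^sup>+s. indicator {0..1::real} s \<partial>lborel)"
        by (intro nn_integral_cong) (auto split: split_indicator)
      also have "\<dots> = 1" by simp
      finally have "(\<integral>\<^sup>+s. (indicator {0..1::real} s)\<^sup>2 \<partial>lborel) = 1" .
      moreover have "(\<integral>\<^sup>+s. (ennreal (u x s) * indicator {0..1} s)\<^sup>2 \<partial>lborel)
        = (\<integral>\<^sup>+s. ennreal ((u x s)\<^sup>2) * indicator {0..1} s \<partial>lborel)"
        by (intro nn_integral_cong) (auto split: split_indicator simp: ennreal_power u_def)
      ultimately show ?thesis by simp
    qed
    finally show ?thesis by simp
  qed
  have inner: "(\<integral>\<^sup>+x. ennreal ((u x s)\<^sup>2) * indicator {0..1} s \<partial>lborel)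
      \<le> ennreal ((L * \<bar>t\<bar> powr (\<beta> - l))\<^sup>2) * indicator {0..1} s" for s
  proof (cases "s \<in> {0..1}")
    case True
    have "(\<integral>\<^sup>+x. ennreal ((u x s)\<^sup>2) \<partial>lborel) \<le> ennreal ((L * \<bar>s * t\<bar> powr (\<beta> - l))\<^sup>2)"
      using nikolski_increment[of "s * t"] by (simp add: u_def g_def)
    also have "\<dots> \<le> ennreal ((L * \<bar>t\<bar> powr (\<beta> - l))\<^sup>2)"
      using True L bl
      by (intro ennreal_leI power_mono mult_left_mono powr_mono2) (auto simp: abs_mult mult_left_le_one_le)
    finally show ?thesis using True by simp
  qed simp
  have "(\<integral>\<^sup>+x. ennreal ((taylor_rem l f x t)\<^sup>2) \<partial>lborel)
    \<le> (\<integral>\<^sup>+x. ennreal ((\<bar>t\<bar> ^ l)\<^sup>2) * (\<integral>\<^sup>+s. ennreal ((u x s)\<^sup>2) * indicator {0..1} s \<partial>lborel) \<partial>lborel)"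
    by (intro nn_integral_mono pt)
  also have "\<dots> = ennreal ((\<bar>t\<bar> ^ l)\<^sup>2) * (\<integral>\<^sup>+x. (\<integral>\<^sup>+s. ennreal ((u x s)\<^sup>2) * indicator {0..1} s \<partial>lborel) \<partial>lborel)"
    by (intro nn_integral_cmult) measurable
  also have "(\<integral>\<^sup>+x. (\<integral>\<^sup>+s. ennreal ((u x s)\<^sup>2) * indicator {0..1} s \<partial>lborel) \<partial>lborel)
     = (\<integral>\<^sup>+s. (\<integral>\<^sup>+x. ennreal ((u x s)\<^sup>2) * indicator {0..1} s \<partial>lborel) \<partial>lborel)"
    by (rule lborel_pair.Fubini'[symmetric]) measurable
  also have "ennreal ((\<bar>t\<bar> ^ l)\<^sup>2) * \<dots>
     \<le> ennreal ((\<bar>t\<bar> ^ l)\<^sup>2) * (\<integral>\<^sup>+s. ennreal ((L * \<bar>t\<bar> powr (\<beta> - l))\<^sup>2) * indicator {0..1::real} s \<partial>lborel)"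
    by (intro mult_left_mono nn_integral_mono inner) simp
  also have "\<dots> = ennreal ((\<bar>t\<bar> ^ l)\<^sup>2 * (L * \<bar>t\<bar> powr (\<beta> - l))\<^sup>2)"
    by (simp add: nn_integral_cmult_indicator ennreal_mult)
  also have "(\<bar>t\<bar> ^ l)\<^sup>2 * (L * \<bar>t\<bar> powr (\<beta> - l))\<^sup>2 = (L * (\<bar>t\<bar> ^ l * \<bar>t\<bar> powr (\<beta> - l)))\<^sup>2"
    by (simp add: power_mult_distrib mult_ac)
  also have "\<bar>t\<bar> ^ l * \<bar>t\<bar> powr (\<beta> - l) = \<bar>t\<bar> powr \<beta>"
  proof (cases "t = 0")
    case True
    then show ?thesis using False by simp
  next
    case t: False
    then have "\<bar>t\<bar> ^ l = \<bar>t\<bar> powr l" by (simp add: powr_realpow)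
    then show ?thesis using t by (simp add: powr_add[symmetric])
  qed
  finally show ?thesis .
qed

text \<open>
  After the substitution \<open>y = x - h u\<close> the bias is \<open>- \<integral> K(u) R(x, - h u) du\<close> with the
  Taylor remainder \<open>R\<close>: the constant term of the Taylor
  polynomial is \<open>f x\<close> and the moment conditions remove the others. As \<open>\<parallel>R(\<cdot>, - h u)\<parallel>\<^sub>2\<close> grows
  like \<open>\<bar>u\<bar>\<^sup>\<beta>\<close>, the Cauchy-Schwarz inequality is applied with the weight \<open>\<bar>u\<bar>\<^sup>\<beta>\<close>; then only the moment of order
  \<open>\<beta>\<close> is used and not that of order \<open>2\<beta>\<close>.
\<close>
lemma kernel_bias_bound:
  assumes K: "kernel K" "moment_cond \<beta> K" and h: "0 < h" and fB: "\<And>x. \<bar>f x\<bar> \<le> B"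
  shows "sqrt (normsq (\<lambda>x. f x - conv (dilate K h) f x)) \<le> (LINT z|lborel. \<bar>z\<bar> powr \<beta> * \<bar>K z\<bar>) * L * h powr \<beta>"
proof -
  define m where "m = (LINT z|lborel. \<bar>z\<bar> powr \<beta> * \<bar>K z\<bar>)"
  have Ki: "integrable lborel K" and K0: "\<And>x. 0 \<le> K x" and K1: "(LINT x|lborel. K x) = 1"
    using K(1) by (auto simp: kernel_def)
  have [measurable]: "K \<in> borel_measurable borel" "f \<in> borel_measurable borel"
    using integrable_borel[OF Ki] fm by auto
  note taylor_rem_measurable[measurable]
  define R where "R x u = taylor_rem l f x (- (h * u))" for x u
  have [measurable]: "(\<lambda>(x, u). R x u) \<in> borel_measurable (borel \<Otimes>\<^sub>M borel)"
    unfolding R_def by measurable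
  have mom: "integrable lborel (\<lambda>y. y ^ i * K y)" if "i \<le> l" for i
    using K(2) that by (auto simp: moment_cond_def Let_def l)
  have mom0: "(LINT y|lborel. y ^ i * K y) = 0" if "i \<in> {1..l}" for i
    using K(2) that by (auto simp: moment_cond_def Let_def l)
  have mi: "integrable lborel (\<lambda>z. \<bar>z\<bar> powr \<beta> * \<bar>K z\<bar>)"
    using K(2) by (auto simp: moment_cond_def Let_def)
  have m0: "0 \<le> m" by (simp add: m_def)
  have bias: "f x - conv (dilate K h) f x = - (LINT u|lborel. K u * R x u)" for x
  proof -
    have c: "conv (dilate K h) f x = (LINT u|lborel. K u * f (x - h * u))"
      unfolding conv_def dilate_def
      using lborel_integral_real_affine[of "- h" "\<lambda>y. 1 / h * K ((x - y) / h) * f y" x] h by simp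
    have fi: "integrable lborel (\<lambda>u. K u * f (x - h * u))"
    proof (rule Bochner_Integration.integrable_bound[where f = "\<lambda>u. B * K u"])
      show "AE u in lborel. norm (K u * f (x - h * u)) \<le> norm (B * K u)"
        using fB K0 order_trans[OF abs_ge_zero fB] by (auto simp: abs_mult mult.commute[of B] intro!: mult_left_mono)
    qed (use Ki in auto)
    define T where "T u = (\<Sum>j\<le>l. (- h) ^ j / fact j * (deriv ^^ j) f x * (u ^ j * K u))" for u
    have Ti: "integrable lborel T" unfolding T_def using mom by auto
    have "(LINT u|lborel. T u) = (\<Sum>j\<le>l. (- h) ^ j / fact j * (deriv ^^ j) f x * (LINT u|lborel. u ^ j * K u))"
      unfolding T_def using mom by (subst Bochner_Integration.integral_sum) auto
    also have "\<dots> = (\<Sum>j\<le>l. if j = 0 then f x else 0)"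
      by (intro sum.cong refl) (auto simp: mom0 K1)
    finally have IT: "(LINT u|lborel. T u) = f x" by simp
    have "K u * R x u = K u * f (x - h * u) - T u" for u
      unfolding R_def taylor_rem_def T_def
      by (simp add: right_diff_distrib sum_distrib_left power_mult_distrib[symmetric] algebra_simps)
         (intro sum.cong refl, simp add: power_mult_distrib[symmetric] mult_ac)
    then have "(LINT u|lborel. K u * R x u) = conv (dilate K h) f x - f x"
      using fi Ti by (simp add: c IT)
    then show ?thesis by simp
  qed
  define w where "w u = \<bar>u\<bar> powr \<beta>" for u :: real
  have [measurable]: "w \<in> borel_measurable borel" unfolding w_def by measurable
  have w0: "0 \<le> w u" for u by (simp add: w_def)
  have Kw: "(\<integral>\<^sup>+u. ennreal (K u * w u) \<partial>lborel) = ennreal m"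
    using mi K0 by (subst nn_integral_eq_integral) (auto simp: m_def w_def mult.commute)
  have pt: "ennreal ((f x - conv (dilate K h) f x)\<^sup>2)
     \<le> ennreal m * (\<integral>\<^sup>+u. ennreal (K u / w u * (R x u)\<^sup>2) \<partial>lborel)" for x
  proof -
    have "ennreal ((f x - conv (dilate K h) f x)\<^sup>2) = (ennreal \<bar>LINT u|lborel. K u * R x u\<bar>)\<^sup>2"
      by (simp add: bias ennreal_power)
    also have "\<dots> \<le> (\<integral>\<^sup>+u. ennreal \<bar>K u * R x u\<bar> \<partial>lborel)\<^sup>2"
      by (intro power_mono_ennreal ennreal_abs_integral_le)
    also have "(\<lambda>u. ennreal \<bar>K u * R x u\<bar>) = (\<lambda>u. ennreal (sqrt (K u * w u)) * ennreal (sqrt (K u / w u) * \<bar>R x u\<bar>))"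
    proof
      fix u
      have "\<bar>K u * R x u\<bar> = sqrt (K u * w u) * (sqrt (K u / w u) * \<bar>R x u\<bar>)"
      (* At u = 0 the weight vanishes and so does the remainder. *)
      proof (cases "u = 0")
        case True
        then show ?thesis by (simp add: R_def taylor_rem_zero)
      next
        case False
        then have "0 < w u" by (simp add: w_def)
        then show ?thesis using K0[of u] by (simp add: abs_mult real_sqrt_mult real_sqrt_divide)
      qed
      then show "ennreal \<bar>K u * R x u\<bar> = ennreal (sqrt (K u * w u)) * ennreal (sqrt (K u / w u) * \<bar>R x u\<bar>)"
        using K0 w0 by (simp add: ennreal_mult)
    qed
    also have "(\<integral>\<^sup>+u. ennreal (sqrt (K u * w u)) * ennreal (sqrt (K u / w u) * \<bar>R x u\<bar>) \<partial>lborel)\<^sup>2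
      \<le> (\<integral>\<^sup>+u. (ennreal (sqrt (K u * w u)))\<^sup>2 \<partial>lborel) * (\<integral>\<^sup>+u. (ennreal (sqrt (K u / w u) * \<bar>R x u\<bar>))\<^sup>2 \<partial>lborel)"
      by (intro Cauchy_Schwarz_nn_integral) measurable
    finally show ?thesis using K0 w0 by (simp add: ennreal_power power_mult_distrib Kw)
  qed
  have inner: "(\<integral>\<^sup>+x. ennreal (K u / w u * (R x u)\<^sup>2) \<partial>lborel) \<le> ennreal ((L * h powr \<beta>)\<^sup>2) * ennreal (K u * w u)" for u
  proof -
    have "(\<integral>\<^sup>+x. ennreal (K u / w u * (R x u)\<^sup>2) \<partial>lborel) = ennreal (K u / w u) * (\<integral>\<^sup>+x. ennreal ((R x u)\<^sup>2) \<partial>lborel)"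
      using K0 w0 by (subst ennreal_mult) (auto intro!: nn_integral_cmult)
    also have "\<dots> \<le> ennreal (K u / w u) * ennreal ((L * \<bar>- (h * u)\<bar> powr \<beta>)\<^sup>2)"
      unfolding R_def by (intro mult_left_mono taylor_rem_L2) simp
    also have "\<bar>- (h * u)\<bar> powr \<beta> = h powr \<beta> * w u"
      using h by (simp add: w_def abs_mult powr_mult)
    also have "ennreal (K u / w u) * ennreal ((L * (h powr \<beta> * w u))\<^sup>2) = ennreal ((L * h powr \<beta>)\<^sup>2 * (K u * w u))"
    proof -
      have "K u / w u * (L * (h powr \<beta> * w u))\<^sup>2 = (L * h powr \<beta>)\<^sup>2 * (K u * w u)"
        by (cases "w u = 0") (auto simp: power2_eq_square)
      then show ?thesis using K0 w0 by (subst ennreal_mult[symmetric]) auto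
    qed
    finally show ?thesis using K0 w0 by (simp add: ennreal_mult)
  qed
  have "(\<integral>\<^sup>+x. ennreal ((f x - conv (dilate K h) f x)\<^sup>2) \<partial>lborel)
    \<le> (\<integral>\<^sup>+x. ennreal m * (\<integral>\<^sup>+u. ennreal (K u / w u * (R x u)\<^sup>2) \<partial>lborel) \<partial>lborel)"
    by (intro nn_integral_mono pt)
  also have "\<dots> = ennreal m * (\<integral>\<^sup>+x. (\<integral>\<^sup>+u. ennreal (K u / w u * (R x u)\<^sup>2) \<partial>lborel) \<partial>lborel)"
    by (intro nn_integral_cmult) measurable
  also have "(\<integral>\<^sup>+x. (\<integral>\<^sup>+u. ennreal (K u / w u * (R x u)\<^sup>2) \<partial>lborel) \<partial>lborel)
     = (\<integral>\<^sup>+u. (\<integral>\<^sup>+x. ennreal (K u / w u * (R x u)\<^sup>2) \<partial>lborel) \<partial>lborel)"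
    by (rule lborel_pair.Fubini'[symmetric]) measurable
  also have "ennreal m * \<dots> \<le> ennreal m * (\<integral>\<^sup>+u. ennreal ((L * h powr \<beta>)\<^sup>2) * ennreal (K u * w u) \<partial>lborel)"
    by (intro mult_left_mono nn_integral_mono inner) simp
  also have "\<dots> = ennreal m * (ennreal ((L * h powr \<beta>)\<^sup>2) * ennreal m)"
    by (subst nn_integral_cmult) (auto simp: Kw)
  also have "\<dots> = ennreal ((m * L * h powr \<beta>)\<^sup>2)"
    using m0 L by (simp add: ennreal_mult[symmetric] power2_eq_square mult_ac)
  finally have *: "(\<integral>\<^sup>+x. ennreal ((f x - conv (dilate K h) f x)\<^sup>2) \<partial>lborel) \<le> ennreal ((m * L * h powr \<beta>)\<^sup>2)" .
  have [measurable]: "dilate K h \<in> borel_measurable borel"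
    using integrable_borel[OF dilate_integrable[OF h Ki]] .
  have "normsq (\<lambda>x. f x - conv (dilate K h) f x) \<le> (m * L * h powr \<beta>)\<^sup>2"
    by (rule normsq_le_of_nn(2)[OF _ *]) auto
  then show ?thesis
    unfolding m_def[symmetric] using m0 L by (intro real_le_lsqrt) auto
qed

end


section \<open>Bandwidths and penalty\<close>

lemma Lp_norm_2: "Lp_norm 2 g = sqrt (normsq g)"
  by (simp add: Lp_norm_def normsq_def powr_half_sqrt)

lemma Lp_norm_2_sq: "(Lp_norm 2 g)\<^sup>2 = normsq g"
  by (simp add: Lp_norm_2)

lemma kernelD:
  assumes "kernel K"
  shows "integrable lborel K" "L2 K" "(LINT x|lborel. \<bar>K x\<bar>) = 1" "0 < normsq K" "\<And>x. 0 \<le> K x"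
proof -
  show i: "integrable lborel K" and K0: "\<And>x. 0 \<le> K x" using assms by (auto simp: kernel_def)
  have [measurable]: "K \<in> borel_measurable borel" using integrable_borel[OF i] .
  show L: "L2 K" using assms by (simp add: kernel_def L2_def)
  show 1: "(LINT x|lborel. \<bar>K x\<bar>) = 1" using assms K0 by (simp add: kernel_def)
  have "normsq K \<noteq> 0"
  proof
    assume "normsq K = 0"
    then have "AE x in lborel. (K x)\<^sup>2 = 0"
      using integral_nonneg_eq_0_iff_AE[OF L2_integrable[OF L]] by (simp add: normsq_def)
    then have "AE x in lborel. \<bar>K x\<bar> = 0" by simp
    then have "(LINT x|lborel. \<bar>K x\<bar>) = (LINT x|lborel. 0)"
      using integral_cong_AE[of "\<lambda>x. \<bar>K x\<bar>" lborel "\<lambda>_. 0"] by simp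
    with 1 show False by simp
  qed
  then show "0 < normsq K" using normsq_nonneg[of K] by linarith
qed

definition inv_sum :: "(nat \<Rightarrow> real \<Rightarrow> real) \<Rightarrow> nat \<Rightarrow> real \<Rightarrow> real" where
  "inv_sum h n \<gamma> = (\<Sum>k=1..n. 1 / h k \<gamma>)"

lemma V_crit_eq:
  assumes "kernel K" "1 \<le> n"
  shows "V_crit K h \<upsilon> n \<gamma> = \<upsilon> * normsq K * inv_sum h n \<gamma> / (real n)\<^sup>2"
proof -
  have "Lp_norm 1 K = 1" using kernelD(3)[OF assms(1)] by (simp add: Lp_norm_def)
  then have "V_crit K h \<upsilon> n \<gamma> = \<upsilon> * (normsq K / (real n * mean_bw h n \<gamma>))"
    by (simp add: V_crit_def Lp_norm_2_sq)
  also have "real n * mean_bw h n \<gamma> = (real n)\<^sup>2 / inv_sum h n \<gamma>"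
    by (simp add: mean_bw_def inv_sum_def power2_eq_square)
  finally show ?thesis by simp
qed

text \<open>
  This rewrites the summands of the grid condition with exponent 1/2 in the form in which the
  concentration inequality produces them.
\<close>
lemma mean_bw_exp:
  assumes "1 \<le> n" "0 < inv_sum h n \<gamma>"
  shows "exp (- c / mean_bw h n \<gamma> powr (1 / 2)) = exp (- c * sqrt (inv_sum h n \<gamma> / real n))"
proof -
  have "mean_bw h n \<gamma> = 1 / (inv_sum h n \<gamma> / real n)"
    by (simp add: mean_bw_def inv_sum_def)
  then have "mean_bw h n \<gamma> powr (1 / 2) = 1 / sqrt (inv_sum h n \<gamma> / real n)"
    using assms by (simp add: powr_half_sqrt real_sqrt_divide)
  then show ?thesis by simp
qed

text \<open>
  The bound \<open>\<gamma> \<le> h\<^sub>n\<^sup>-\<^sup>1(1/n)\<close> on the grid gives \<open>h\<^sub>n(\<gamma>) \<ge> 1/n\<close>, and \<open>h\<^sub>n(\<gamma>)\<close> is the smallest of the bandwidths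
  \<open>h\<^sub>k(\<gamma>)\<close> with \<open>k \<le> n\<close>.
\<close>
lemma cond_A_bandwidth:
  assumes "cond_A h \<Gamma> n" "1 \<le> n" "\<gamma> \<in> \<Gamma> n" "k \<in> {1..n}" "\<Gamma> n \<subseteq> {0..1}"
  shows "1 / real n \<le> h k \<gamma>"
proof -
  have \<gamma>: "\<gamma> \<in> {0..1}" using assms by auto
  have anti: "antimono_on {0..1} (h n)" and inj: "inj_on (h n) {0..1}" and r: "1 / real n \<in> h n ` {0..1}"
    and le: "\<gamma> \<le> the_inv_into {0..1} (h n) (1 / real n)"
    and dec: "\<And>k. k \<in> {1..<n} \<Longrightarrow> h (Suc k) \<gamma> < h k \<gamma>"
    using assms \<gamma> unfolding cond_A_def by auto
  have "the_inv_into {0..1} (h n) (1 / real n) \<in> {0..1}"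
    using the_inv_into_into[OF inj r subset_refl] .
  then have "h n (the_inv_into {0..1} (h n) (1 / real n)) \<le> h n \<gamma>"
    using anti \<gamma> le unfolding monotone_on_def by blast
  then have 1: "1 / real n \<le> h n \<gamma>" using f_the_inv_into_f[OF inj r] by simp
  have "k \<le> n" "1 \<le> k" using assms(4) by auto
  then have "h n \<gamma> \<le> h k \<gamma>"
  proof (induction k rule: inc_induct)
    case (step m)
    then show ?case using dec[of m] by force
  qed simp
  with 1 show ?thesis by simp
qed

text \<open>
  The concentration inequality is used with \<open>\<lambda> = 1 / (sqrt n * tail_rate Q B)\<close>. The two summands are
  what its conditions on \<open>\<lambda>\<close> ask for: the first one concerns the weak variance \<open>4 B\<close>, the second one the
  largest norm of a single summand, where \<open>Q\<close> is the squared norm of the kernel.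
\<close>
definition tail_rate :: "real \<Rightarrow> real \<Rightarrow> real" where
  "tail_rate Q B = sqrt (8 * B) + 8 * sqrt Q"

text \<open>
  With \<open>d k = 16 Q / b k\<close> one gets \<open>a\<^sup>2 = 16 Q s\<close> and \<open>18 a\<^sup>2 = 288 Q s\<close>, which is where the size of the
  penalty comes from. Since \<open>b k \<ge> 1/n\<close>, a single summand has squared norm at most \<open>16 Q n\<close>, so \<open>\<lambda>\<close>
  may be of order \<open>1 / sqrt n\<close>; then \<open>\<lambda> a\<close> is of order \<open>sqrt (s / n)\<close>, the inverse square root of the
  mean bandwidth.
\<close>
lemma grid_noise_excess:
  fixes f :: "real \<Rightarrow> real" and \<kappa> :: "nat \<Rightarrow> real \<Rightarrow> real" and w :: "nat \<Rightarrow> real" and n :: nat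
  defines "\<mu> \<equiv> density lborel (\<lambda>x. ennreal (f x))"
  assumes prob: "prob_space (density lborel (\<lambda>x. ennreal (f x)))"
    and fm: "f \<in> borel_measurable borel" and f0: "\<And>x. 0 \<le> f x"
    and fB: "AE x in lborel. f x \<le> B" and B: "0 \<le> B" and n: "1 \<le> n" and Q: "0 < Q"
    and b: "\<And>k. k \<in> {1..n} \<Longrightarrow> 1 / real n \<le> b k" and s: "s = (\<Sum>k=1..n. 1 / b k)"
    and \<kappa>: "\<And>k. k \<in> {1..n} \<Longrightarrow> integrable lborel (\<kappa> k)" "\<And>k. k \<in> {1..n} \<Longrightarrow> L2 (\<kappa> k)"
      "\<And>k. k \<in> {1..n} \<Longrightarrow> (LINT x|lborel. \<bar>\<kappa> k x\<bar>) \<le> 2" "\<And>k. k \<in> {1..n} \<Longrightarrow> normsq (\<kappa> k) \<le> 4 * Q / b k"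
  shows "(\<integral>\<^sup>+w. ennreal (max (normsq (\<lambda>x. 1 / real n * (\<Sum>k=1..n. \<kappa> k (w k - x) - conv (reflect (\<kappa> k)) f x)) - 288 * Q * s / (real n)\<^sup>2) 0)
      \<partial>(Pi\<^sub>M {1..n} (\<lambda>_. \<mu>)))
    \<le> ennreal (4 * (tail_rate Q B)\<^sup>2 * exp 2 / n * exp (- (6 * sqrt Q / tail_rate Q B) * sqrt (s / n)))"
proof -
  define r where "r = tail_rate Q B"
  define l where "l = 1 / (sqrt n * r)"
  define a where "a = 4 * sqrt (Q * s)"
  define d where "d k = 16 * Q / b k" for k
  have n0: "0 < real n" using n by simp
  have bpos: "0 < b k" if "k \<in> {1..n}" for k using b[OF that] n0 by (smt (verit) divide_pos_pos)
  have s0: "0 < s" unfolding s using n bpos by (intro sum_pos) auto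
  have sB: "0 \<le> sqrt (8 * B)" using B by simp
  have r0: "0 < r" unfolding r_def tail_rate_def using sB Q by (simp add: add_nonneg_pos)
  have rB: "8 * B \<le> r\<^sup>2" 
  proof -
    have "(sqrt (8 * B))\<^sup>2 \<le> r\<^sup>2" unfolding r_def tail_rate_def using sB Q by (intro power_mono) auto
    then show ?thesis using B by simp
  qed
  have rQ: "64 * Q \<le> r\<^sup>2"
  proof -
    have "(8 * sqrt Q)\<^sup>2 \<le> r\<^sup>2" unfolding r_def tail_rate_def using sB Q by (intro power_mono) auto
    then show ?thesis using Q by (simp add: power_mult_distrib)
  qed
  have l0: "0 < l" using r0 n0 by (simp add: l_def)
  have l2: "l\<^sup>2 = 1 / (n * r\<^sup>2)" using n0 by (simp add: l_def power_divide power_mult_distrib)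
  have a0: "0 < a" using Q s0 by (simp add: a_def)
  have a2: "a\<^sup>2 = 16 * Q * s" using Q s0 by (simp add: a_def power_mult_distrib)
  define Y where "Y w = normsq (\<lambda>x. \<Sum>k\<in>{1..n}. \<kappa> k (w k - x) - conv (reflect (\<kappa> k)) f x)" for w
  define T where "T = 4 * r\<^sup>2 * exp 2 / n * exp (- (6 * sqrt Q / r) * sqrt (s / n))"
  have [measurable]: "Y \<in> borel_measurable (Pi\<^sub>M {1..n} (\<lambda>_. \<mu>))"
    unfolding Y_def
  proof (rule normsq_sum_measurable)
    fix k assume "k \<in> {1..n}"
    then have [measurable]: "\<kappa> k \<in> borel_measurable borel" using \<kappa>(2) L2_measurable by auto
    note fm[measurable]
    show "(\<lambda>(y, x). \<kappa> k (y - x) - conv (reflect (\<kappa> k)) f x) \<in> borel_measurable (borel \<Otimes>\<^sub>M borel)"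
      by measurable
  qed (auto simp: \<mu>_def)
  have excess: "(\<integral>\<^sup>+w. ennreal (max (Y w - 18 * a\<^sup>2) 0) \<partial>(Pi\<^sub>M {1..n} (\<lambda>_. \<mu>)))
     \<le> ennreal (4 / l\<^sup>2 * exp (2 - 3 / 2 * l * a))"
    unfolding Y_def \<mu>_def
  proof (rule noise_excess[OF prob fm f0 fB B, where d = d])
    show "sum d {1..n} = a\<^sup>2" by (simp add: a2 d_def s sum_distrib_left)
    show "8 * l\<^sup>2 * B * card {1..n} \<le> 1" using rB r0 n0 by (simp add: l2)
    fix k assume k: "k \<in> {1..n}"
    show "4 * normsq (\<kappa> k) \<le> d k" using \<kappa>(4)[OF k] by (simp add: d_def)
    have "1 / b k \<le> n" using b[OF k] bpos[OF k] n0 by (simp add: field_simps)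
    then have "64 * Q * (1 / b k) \<le> r\<^sup>2 * n" using rQ Q bpos[OF k] by (intro mult_mono) auto
    then show "4 * l\<^sup>2 * d k \<le> 1" using r0 n0 bpos[OF k] by (simp add: l2 d_def field_simps)
  qed (use \<kappa> a0 l0 in auto)
  have T: "4 / l\<^sup>2 * exp (2 - 3 / 2 * l * a) = (real n)\<^sup>2 * T"
  proof -
    have "3 / 2 * l * a = (6 * sqrt Q / r) * sqrt (s / n)"
      by (simp add: l_def a_def real_sqrt_mult real_sqrt_divide)
    moreover have "4 / l\<^sup>2 = 4 * r\<^sup>2 * n" by (simp add: l2)
    ultimately show ?thesis
      using n0 by (simp add: T_def exp_diff exp_minus power2_eq_square field_simps)
  qed
  have scale: "max (normsq (\<lambda>x. 1 / real n * (\<Sum>k=1..n. \<kappa> k (w k - x) - conv (reflect (\<kappa> k)) f x)) - 288 * Q * s / (real n)\<^sup>2) 0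
    = 1 / (real n)\<^sup>2 * max (Y w - 18 * a\<^sup>2) 0" for w
    unfolding normsq_scale a2 Y_def using n0 by (simp add: max_def power_divide field_simps)
  have "(\<integral>\<^sup>+w. ennreal (max (normsq (\<lambda>x. 1 / real n * (\<Sum>k=1..n. \<kappa> k (w k - x) - conv (reflect (\<kappa> k)) f x)) - 288 * Q * s / (real n)\<^sup>2) 0)
      \<partial>(Pi\<^sub>M {1..n} (\<lambda>_. \<mu>)))
     = (\<integral>\<^sup>+w. ennreal (1 / (real n)\<^sup>2) * ennreal (max (Y w - 18 * a\<^sup>2) 0) \<partial>(Pi\<^sub>M {1..n} (\<lambda>_. \<mu>)))"
    by (intro nn_integral_cong) (simp only: scale, rule ennreal_mult, auto)
  also have "\<dots> = ennreal (1 / (real n)\<^sup>2) * (\<integral>\<^sup>+w. ennreal (max (Y w - 18 * a\<^sup>2) 0) \<partial>(Pi\<^sub>M {1..n} (\<lambda>_. \<mu>)))"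
    by (rule nn_integral_cmult) measurable
  also have "\<dots> \<le> ennreal (1 / (real n)\<^sup>2) * ennreal ((real n)\<^sup>2 * T)"
    using excess unfolding T by (rule mult_left_mono) simp
  also have "\<dots> = ennreal T"
    using n0 by (subst ennreal_mult[symmetric]) (auto simp: T_def)
  finally show ?thesis unfolding T_def r_def .
qed


lemma normsq_average_le:
  assumes "finite I" "\<And>k. k \<in> I \<Longrightarrow> L2 (g k)" "\<And>k. k \<in> I \<Longrightarrow> sqrt (normsq (g k)) \<le> b k"
  shows "normsq (\<lambda>x. c * (\<Sum>k\<in>I. g k x)) \<le> c\<^sup>2 * \<bar>\<Sum>k\<in>I. b k\<bar>\<^sup>2"
proof -
  have "sqrt (normsq (\<lambda>x. \<Sum>k\<in>I. g k x)) \<le> (\<Sum>k\<in>I. sqrt (normsq (g k)))"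
    using assms by (intro L2_triangle_sum)
  also have "\<dots> \<le> (\<Sum>k\<in>I. b k)" using assms by (intro sum_mono)
  finally have "(sqrt (normsq (\<lambda>x. \<Sum>k\<in>I. g k x)))\<^sup>2 \<le> \<bar>\<Sum>k\<in>I. b k\<bar>\<^sup>2"
    by (simp only: power2_abs, intro power_mono) auto
  then show ?thesis unfolding normsq_scale by (intro mult_left_mono) auto
qed

section \<open>Pathwise bound on the loss of the selected estimator\<close>

text \<open>
  The value \<open>conv (reflect (\<kappa> k)) f x\<close> is the expectation of \<open>\<kappa> k (X\<^sub>k - x)\<close> for \<open>X\<^sub>k\<close> with density \<open>f\<close>,
  so this is the noise of a kernel estimator.
\<close>
definition centred_average ::
    "nat \<Rightarrow> (real \<Rightarrow> real) \<Rightarrow> (nat \<Rightarrow> real) \<Rightarrow> (nat \<Rightarrow> real \<Rightarrow> real) \<Rightarrow> real \<Rightarrow> real" where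
  "centred_average n f xs \<kappa> x = 1 / real n * (\<Sum>k=1..n. \<kappa> k (xs k - x) - conv (reflect (\<kappa> k)) f x)"

text \<open>
  The difference between an estimator and its doubly smoothed version is itself a kernel estimator, with
  this signed kernel; one application of the concentration inequality therefore covers it.
\<close>
definition pair_kernel :: "(real \<Rightarrow> real) \<Rightarrow> real \<Rightarrow> real \<Rightarrow> real \<Rightarrow> real" where
  "pair_kernel K a a' x = dilate K a' x - conv (dilate K a') (dilate K a) x"

definition bias_term :: "(real \<Rightarrow> real) \<Rightarrow> (nat \<Rightarrow> real \<Rightarrow> real) \<Rightarrow> nat \<Rightarrow> (real \<Rightarrow> real) \<Rightarrow> real \<Rightarrow> real" where
  "bias_term K h n f \<gamma> =
     (1 / (real n)\<^sup>2) * \<bar>\<Sum>k=1..n. Lp_norm 2 (\<lambda>x. f x - conv (dilate K (h k \<gamma>)) f x)\<bar>\<^sup>2"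

lemma dilate_facts:
  assumes "kernel K" "0 < a"
  shows "integrable lborel (dilate K a)" "L2 (dilate K a)" "(LINT x|lborel. \<bar>dilate K a x\<bar>) = 1"
    "normsq (dilate K a) = normsq K / a"
  using kernelD[OF assms(1)] assms(2)
  by (auto simp: dilate_integrable L2_dilate dilate_abs_integral normsq_dilate)

lemma pair_kernel_facts:
  assumes K: "kernel K" and a: "0 < a" and a': "0 < a'"
  shows "integrable lborel (pair_kernel K a a')" "L2 (pair_kernel K a a')"
    "(LINT x|lborel. \<bar>pair_kernel K a a' x\<bar>) \<le> 2" "normsq (pair_kernel K a a') \<le> 4 * normsq K / a'"
proof -
  note D = dilate_facts[OF K a] and D' = dilate_facts[OF K a']
  have cL: "L2 (conv (dilate K a') (dilate K a))" "normsq (conv (dilate K a') (dilate K a)) \<le> normsq K / a'"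
    using Young_L2[OF D(1) D'(2)] D(3) D'(4) by (simp_all add: conv_commute[of "dilate K a'"])
  note c1 = Young_L1[OF D'(1) D(1)]
  show "integrable lborel (pair_kernel K a a')"
    unfolding pair_kernel_def[abs_def] using D'(1) c1(1) by simp
  show "L2 (pair_kernel K a a')"
    unfolding pair_kernel_def[abs_def] using D'(2) cL(1) by (rule L2_diff)
  have "(LINT x|lborel. \<bar>pair_kernel K a a' x\<bar>)
      \<le> (LINT x|lborel. \<bar>dilate K a' x\<bar> + \<bar>conv (dilate K a') (dilate K a) x\<bar>)"
    unfolding pair_kernel_def using D'(1) c1(1) by (intro integral_mono) auto
  also have "\<dots> = (LINT x|lborel. \<bar>dilate K a' x\<bar>) + (LINT x|lborel. \<bar>conv (dilate K a') (dilate K a) x\<bar>)"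
    using D'(1) c1(1) by (intro Bochner_Integration.integral_add) auto
  also have "\<dots> \<le> 2" using c1(2) D(3) D'(3) by simp
  finally show "(LINT x|lborel. \<bar>pair_kernel K a a' x\<bar>) \<le> 2" .
  have "normsq (pair_kernel K a a') \<le> 2 * normsq (dilate K a') + 2 * normsq (conv (dilate K a') (dilate K a))"
    unfolding pair_kernel_def[abs_def] using D'(2) cL(1) by (rule normsq_diff_le)
  then show "normsq (pair_kernel K a a') \<le> 4 * normsq K / a'" using cL(2) D'(4) by simp
qed

lemma centred_average_L2:
  assumes "L2 f" "\<And>k. k \<in> {1..n} \<Longrightarrow> L2 (\<kappa> k)" "\<And>k. k \<in> {1..n} \<Longrightarrow> integrable lborel (\<kappa> k)"
  shows "L2 (centred_average n f xs \<kappa>)"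
  unfolding centred_average_def[abs_def]
  using assms by (intro L2_scale L2_sum L2_diff L2_reflect_translate Young_L2(1) reflect_integrable) auto

context
  fixes K f :: "real \<Rightarrow> real" and h :: "nat \<Rightarrow> real \<Rightarrow> real" and n :: nat and B0 :: real
    and xs :: "nat \<Rightarrow> real" and G :: "real set"
  assumes K: "kernel K" and n: "1 \<le> n" and f: "L2 f" "\<And>x. \<bar>f x\<bar> \<le> B0"
    and h: "\<And>k \<gamma>. k \<in> {1..n} \<Longrightarrow> \<gamma> \<in> G \<Longrightarrow> 0 < h k \<gamma>"
begin

private lemma fm: "f \<in> borel_measurable borel"
  using f(1) by (rule L2_measurable)

lemma L2_fhat: "\<gamma> \<in> G \<Longrightarrow> L2 (fhat K h n xs \<gamma>)"
proof -
  assume "\<gamma> \<in> G"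
  then have "L2 (\<lambda>x. 1 / real n * (\<Sum>k=1..n. dilate K (h k \<gamma>) (xs k - x)))"
    by (intro L2_scale L2_sum L2_reflect_translate dilate_facts(2)[OF K] h)
  then show ?thesis by (simp add: fhat_def[abs_def] dilate_def)
qed

lemma L2_fhat2: "\<gamma> \<in> G \<Longrightarrow> \<gamma>' \<in> G \<Longrightarrow> L2 (fhat2 K h n xs \<gamma> \<gamma>')"
  unfolding fhat2_def[abs_def]
  by (intro L2_scale L2_sum L2_reflect_translate Young_L2(1) dilate_facts[OF K] h) auto

lemma fhat2_commute: "fhat2 K h n xs \<gamma> \<gamma>' = fhat2 K h n xs \<gamma>' \<gamma>"
  unfolding fhat2_def[abs_def] by (simp add: conv_commute[of "dilate K (h _ \<gamma>')"])

lemma fhat_error: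
  assumes \<gamma>: "\<gamma> \<in> G"
  shows "normsq (\<lambda>x. fhat K h n xs \<gamma> x - f x)
    \<le> 2 * normsq (centred_average n f xs (\<lambda>k. dilate K (h k \<gamma>))) + 2 * bias_term K h n f \<gamma>"
proof -
  define A where "A k = dilate K (h k \<gamma>)" for k
  have A: "integrable lborel (A k)" "L2 (A k)" if "k \<in> {1..n}" for k
    using dilate_facts[OF K h[OF that \<gamma>]] by (simp_all add: A_def)
  define b where "b x = 1 / real n * (\<Sum>k=1..n. conv (reflect (A k)) f x - f x)" for x
  have bL: "L2 (\<lambda>x. conv (reflect (A k)) f x - f x)" if "k \<in> {1..n}" for k
    using A[OF that] f by (intro L2_diff Young_L2(1) reflect_integrable)
  have split: "fhat K h n xs \<gamma> x - f x = centred_average n f xs A x + b x" for x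
  proof -
    have "1 / real n * (\<Sum>k=1..n. f x) = f x" using n by simp
    then show ?thesis
      by (simp add: fhat_def centred_average_def b_def A_def dilate_def sum_subtractf right_diff_distrib)
  qed
  have "normsq (\<lambda>x. fhat K h n xs \<gamma> x - f x) \<le> 2 * normsq (centred_average n f xs A) + 2 * normsq b"
    unfolding split
  proof (rule normsq_add_le)
    show "L2 (centred_average n f xs A)" using A f by (intro centred_average_L2)
    show "L2 b" unfolding b_def[abs_def] using bL by (intro L2_scale L2_sum)
  qed
  moreover have "normsq b \<le> (1 / real n)\<^sup>2 * \<bar>\<Sum>k=1..n. Lp_norm 2 (\<lambda>x. f x - conv (A k) f x)\<bar>\<^sup>2"
    unfolding b_def[abs_def]
  proof (rule normsq_average_le)
    fix k assume k: "k \<in> {1..n}"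
    show "sqrt (normsq (\<lambda>x. conv (reflect (A k)) f x - f x)) \<le> Lp_norm 2 (\<lambda>x. f x - conv (A k) f x)"
      using normsq_bias_reflect[OF A(1)[OF k] f] by (simp add: Lp_norm_2 normsq_minus_commute)
  qed (use bL in auto)
  ultimately show ?thesis by (simp add: bias_term_def A_def[abs_def] power_divide)
qed

text \<open>
  The mean of the difference is an average of \<open>A' \<star> (f - A \<star> f)\<close> with reflected kernels \<open>A'\<close> and \<open>A\<close>, of
  bandwidths \<open>h\<^sub>k(\<gamma>')\<close> and \<open>h\<^sub>k(\<gamma>)\<close>. Smoothing with \<open>A'\<close> does not increase the norm, so the bias that
  remains is that of \<open>\<gamma>\<close>, uniformly in \<open>\<gamma>'\<close>.
\<close>
lemma fhat_fhat2_diff: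
  assumes \<gamma>: "\<gamma> \<in> G" "\<gamma>' \<in> G"
  shows "normsq (\<lambda>x. fhat K h n xs \<gamma>' x - fhat2 K h n xs \<gamma> \<gamma>' x)
    \<le> 2 * normsq (centred_average n f xs (\<lambda>k. pair_kernel K (h k \<gamma>) (h k \<gamma>'))) + 2 * bias_term K h n f \<gamma>"
proof -
  define A where "A k = dilate K (h k \<gamma>)" for k
  define A' where "A' k = dilate K (h k \<gamma>')" for k
  define P where "P k = pair_kernel K (h k \<gamma>) (h k \<gamma>')" for k
  have A: "integrable lborel (A k)" "L2 (A k)" "(LINT x|lborel. \<bar>A k x\<bar>) = 1" if "k \<in> {1..n}" for k
    using dilate_facts[OF K h[OF that \<gamma>(1)]] by (simp_all add: A_def)
  have A': "integrable lborel (A' k)" "L2 (A' k)" "(LINT x|lborel. \<bar>A' k x\<bar>) = 1" if "k \<in> {1..n}" for k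
    using dilate_facts[OF K h[OF that \<gamma>(2)]] by (simp_all add: A'_def)
  have P: "integrable lborel (P k)" "L2 (P k)" if "k \<in> {1..n}" for k
    using pair_kernel_facts[OF K h[OF that \<gamma>(1)] h[OF that \<gamma>(2)]] by (simp_all add: P_def)
  define b where "b x = 1 / real n * (\<Sum>k=1..n. conv (reflect (P k)) f x)" for x
  have bL: "L2 (conv (reflect (P k)) f)" if "k \<in> {1..n}" for k
    using P[OF that] f by (intro Young_L2(1) reflect_integrable)
  have mean: "conv (reflect (P k)) f = conv (reflect (A' k)) (\<lambda>x. f x - conv (reflect (A k)) f x)" if k: "k \<in> {1..n}" for k
  proof
    fix x
    note i = reflect_integrable[OF A(1)[OF k]] and i' = reflect_integrable[OF A'(1)[OF k]]
    note c = reflect_integrable[OF Young_L1(1)[OF A'(1)[OF k] A(1)[OF k]]]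
    have "reflect (P k) = (\<lambda>x. reflect (A' k) x - reflect (conv (A' k) (A k)) x)"
      by (simp add: fun_eq_iff P_def pair_kernel_def reflect_def A_def A'_def)
    then have "conv (reflect (P k)) f x = conv (reflect (A' k)) f x - conv (reflect (conv (A' k) (A k))) f x"
      using conv_diff_left[OF i' c fm f(2)] by simp
    also have "conv (reflect (conv (A' k) (A k))) f = conv (reflect (A' k)) (conv (reflect (A k)) f)"
      unfolding reflect_conv using conv_conv_bounded[OF i' i fm f(2)] conv_conv_swap[OF i' i fm f(2)] by simp
    also have "conv (reflect (A' k)) f x - conv (reflect (A' k)) (conv (reflect (A k)) f) x
       = conv (reflect (A' k)) (\<lambda>x. f x - conv (reflect (A k)) f x) x"
      by (rule conv_diff_right[symmetric, OF i' fm f(2) L2_measurable[OF Young_L2(1)[OF i f(1)]] conv_bounded[OF i fm f(2)]])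
    finally show "conv (reflect (P k)) f x = conv (reflect (A' k)) (\<lambda>x. f x - conv (reflect (A k)) f x) x" .
  qed
  have split: "fhat K h n xs \<gamma>' x - fhat2 K h n xs \<gamma> \<gamma>' x = centred_average n f xs P x + b x" for x
    by (simp add: fhat_def fhat2_def centred_average_def b_def P_def pair_kernel_def sum_subtractf right_diff_distrib
        dilate_def)
  have "normsq (\<lambda>x. fhat K h n xs \<gamma>' x - fhat2 K h n xs \<gamma> \<gamma>' x) \<le> 2 * normsq (centred_average n f xs P) + 2 * normsq b"
    unfolding split
  proof (rule normsq_add_le)
    show "L2 (centred_average n f xs P)" using P f by (intro centred_average_L2)
    show "L2 b" unfolding b_def[abs_def] using bL by (intro L2_scale L2_sum)
  qed
  moreover have "normsq b \<le> (1 / real n)\<^sup>2 * \<bar>\<Sum>k=1..n. Lp_norm 2 (\<lambda>x. f x - conv (A k) f x)\<bar>\<^sup>2"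
    unfolding b_def[abs_def]
  proof (rule normsq_average_le)
    fix k assume k: "k \<in> {1..n}"
    have "normsq (conv (reflect (P k)) f) \<le> 1\<^sup>2 * normsq (\<lambda>x. f x - conv (reflect (A k)) f x)"
      using Young_L2(2)[OF reflect_integrable[OF A'(1)[OF k]] L2_diff[OF f(1) Young_L2(1)[OF reflect_integrable[OF A(1)[OF k]] f(1)]]]
      unfolding mean[OF k] reflect_abs_integral A'(3)[OF k] .
    then show "sqrt (normsq (conv (reflect (P k)) f)) \<le> Lp_norm 2 (\<lambda>x. f x - conv (A k) f x)"
      using normsq_bias_reflect[OF A(1)[OF k] f] by (simp add: Lp_norm_2)
  qed (use bL in auto)
  ultimately show ?thesis by (simp add: bias_term_def A_def[abs_def] P_def[abs_def] power_divide)
qed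

text \<open>
  Insert \<open>fhat2 \<gamma> g\<close> and \<open>fhat \<gamma>\<close> between the selected estimator and \<open>f\<close>. The first difference is controlled by
  \<open>A \<gamma> + V g\<close>, the second one, by symmetry of \<open>fhat2\<close>, by \<open>A g + V \<gamma>\<close>; minimality of \<open>g\<close> replaces their sum by
  \<open>2 (A \<gamma> + V \<gamma>)\<close>.
\<close>
lemma selection_loss:
  assumes G: "\<Gamma> n = G" "finite G" and \<gamma>: "\<gamma> \<in> G" and V: "\<And>\<gamma>'. \<gamma>' \<in> G \<Longrightarrow> 0 \<le> V_crit K h \<upsilon> n \<gamma>'"
    and g: "is_arg_min (\<lambda>\<gamma>. A_crit K h \<Gamma> \<upsilon> n xs \<gamma> + V_crit K h \<upsilon> n \<gamma>) (\<lambda>\<gamma>. \<gamma> \<in> \<Gamma> n) g"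
  shows "normsq (\<lambda>x. fhat K h n xs g x - f x)
    \<le> 18 * (V_crit K h \<upsilon> n \<gamma> + bias_term K h n f \<gamma>)
      + 12 * (\<Sum>\<gamma>'\<in>G. max (normsq (centred_average n f xs (\<lambda>k. pair_kernel K (h k \<gamma>) (h k \<gamma>'))) - V_crit K h \<upsilon> n \<gamma>' / 2) 0)
      + 6 * max (normsq (centred_average n f xs (\<lambda>k. dilate K (h k \<gamma>))) - V_crit K h \<upsilon> n \<gamma> / 2) 0"
proof -
  define A where "A = A_crit K h \<Gamma> \<upsilon> n xs"
  define V' where "V' = V_crit K h \<upsilon> n"
  define b where "b = bias_term K h n f"
  define N where "N \<gamma> \<gamma>' = normsq (centred_average n f xs (\<lambda>k. pair_kernel K (h k \<gamma>) (h k \<gamma>')))" for \<gamma> \<gamma>'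
  define D where "D \<gamma> \<gamma>' = normsq (\<lambda>x. fhat K h n xs \<gamma>' x - fhat2 K h n xs \<gamma> \<gamma>' x)" for \<gamma> \<gamma>'
  have gG: "g \<in> G" and gmin: "A g + V' g \<le> A \<gamma> + V' \<gamma>"
    using g \<gamma> unfolding is_arg_min_def A_def V'_def G(1) by (auto simp: not_less)
  have Aeq: "A \<gamma> = (SUP \<gamma>'\<in>G. max (D \<gamma> \<gamma>' - V' \<gamma>') 0)" for \<gamma>
    by (simp add: A_def A_crit_def Lp_norm_2_sq D_def V'_def G(1))
  have Aup: "D \<gamma> \<gamma>' \<le> A \<gamma> + V' \<gamma>'" if "\<gamma>' \<in> G" for \<gamma> \<gamma>'
  proof -
    have "max (D \<gamma> \<gamma>' - V' \<gamma>') 0 \<le> A \<gamma>" unfolding Aeq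
      using that G(2) by (intro cSUP_upper bdd_above_finite) auto
    then show ?thesis by linarith
  qed
  have b0: "0 \<le> b \<gamma>" by (simp add: b_def bias_term_def)
  have A_le: "A \<gamma> \<le> 2 * b \<gamma> + 2 * (\<Sum>\<gamma>'\<in>G. max (N \<gamma> \<gamma>' - V' \<gamma>' / 2) 0)"
    unfolding Aeq
  proof (rule cSUP_least)
    fix \<gamma>' assume \<gamma>': "\<gamma>' \<in> G"
    have "D \<gamma> \<gamma>' \<le> 2 * N \<gamma> \<gamma>' + 2 * b \<gamma>"
      using fhat_fhat2_diff[OF \<gamma> \<gamma>'] by (simp add: D_def N_def b_def)
    then have "max (D \<gamma> \<gamma>' - V' \<gamma>') 0 \<le> 2 * b \<gamma> + 2 * max (N \<gamma> \<gamma>' - V' \<gamma>' / 2) 0"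
      using b0 by (simp add: max_def)
    also have "max (N \<gamma> \<gamma>' - V' \<gamma>' / 2) 0 \<le> (\<Sum>\<gamma>'\<in>G. max (N \<gamma> \<gamma>' - V' \<gamma>' / 2) 0)"
      using G(2) \<gamma>' by (intro member_le_sum) auto
    finally show "max (D \<gamma> \<gamma>' - V' \<gamma>') 0 \<le> 2 * b \<gamma> + 2 * (\<Sum>\<gamma>'\<in>G. max (N \<gamma> \<gamma>' - V' \<gamma>' / 2) 0)" by simp
  qed (use \<gamma> in auto)
  have "normsq (\<lambda>x. fhat K h n xs g x - f x) \<le> 3 * (normsq (\<lambda>x. fhat K h n xs g x - fhat2 K h n xs \<gamma> g x)
      + normsq (\<lambda>x. fhat2 K h n xs \<gamma> g x - fhat K h n xs \<gamma> x) + normsq (\<lambda>x. fhat K h n xs \<gamma> x - f x))"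
    using gG \<gamma> by (intro normsq_diff3_le L2_fhat L2_fhat2 f)
  also have "normsq (\<lambda>x. fhat2 K h n xs \<gamma> g x - fhat K h n xs \<gamma> x) = D g \<gamma>"
    unfolding D_def fhat2_commute[of \<gamma> g] by (rule normsq_minus_commute)
  finally have "normsq (\<lambda>x. fhat K h n xs g x - f x) \<le> 3 * (D \<gamma> g + D g \<gamma> + normsq (\<lambda>x. fhat K h n xs \<gamma> x - f x))"
    by (simp add: D_def)
  moreover have "normsq (\<lambda>x. fhat K h n xs \<gamma> x - f x)
      \<le> 2 * normsq (centred_average n f xs (\<lambda>k. dilate K (h k \<gamma>))) + 2 * b \<gamma>"
    using fhat_error[OF \<gamma>] by (simp add: b_def)
  moreover have "0 \<le> V' \<gamma>" using V[OF \<gamma>] by (simp add: V'_def)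
  ultimately show ?thesis
    using Aup[OF gG, of \<gamma>] Aup[OF \<gamma>, of g] gmin A_le
    unfolding N_def[symmetric] V'_def[symmetric] b_def[symmetric] by (simp add: max_def)
qed

end


section \<open>Oracle inequality\<close>

lemma centred_average_measurable:
  assumes [measurable_cong]: "sets \<mu> = sets borel" and fm: "f \<in> borel_measurable borel"
    and \<kappa>: "\<And>k. k \<in> {1..n} \<Longrightarrow> \<kappa> k \<in> borel_measurable borel"
  shows "(\<lambda>w. normsq (centred_average n f w \<kappa>)) \<in> borel_measurable (Pi\<^sub>M {1..n} (\<lambda>_. \<mu>))"
proof -
  have "(\<lambda>w. normsq (\<lambda>x. \<Sum>k\<in>{1..n}. \<kappa> k (w k - x) - conv (reflect (\<kappa> k)) f x)) \<in> borel_measurable (Pi\<^sub>M {1..n} (\<lambda>_. \<mu>))"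
  proof (rule normsq_sum_measurable[OF _ assms(1)])
    fix k assume "k \<in> {1..n}"
    then have [measurable]: "\<kappa> k \<in> borel_measurable borel" using \<kappa> by auto
    note fm[measurable]
    show "(\<lambda>(y, x). \<kappa> k (y - x) - conv (reflect (\<kappa> k)) f x) \<in> borel_measurable (borel \<Otimes>\<^sub>M borel)"
      by measurable
  qed simp
  then show ?thesis unfolding centred_average_def[abs_def] normsq_scale by measurable
qed

text \<open>
  Expectations of functions of the sample are integrals over the product measure. The congruence
  assumption says that \<open>F\<close> only depends on the first \<open>n\<close> observations; the product space consists of
  functions that are undefined elsewhere.
\<close>
lemma sample_nn_integral:
  fixes F :: "(nat \<Rightarrow> real) \<Rightarrow> ennreal"
  assumes s: "sample_density M X n f" and n: "1 \<le> n"
    and F[measurable]: "F \<in> borel_measurable (Pi\<^sub>M {1..n} (\<lambda>_. density lborel (\<lambda>x. ennreal (f x))))"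
    and cong: "\<And>v w. (\<And>k. k \<in> {1..n} \<Longrightarrow> v k = w k) \<Longrightarrow> F v = F w"
  shows "(\<integral>\<^sup>+\<omega>. F (\<lambda>k. X k \<omega>) \<partial>M) = (\<integral>\<^sup>+w. F w \<partial>(Pi\<^sub>M {1..n} (\<lambda>_. density lborel (\<lambda>x. ennreal (f x)))))"
    and "(\<lambda>\<omega>. F (\<lambda>k. X k \<omega>)) \<in> borel_measurable M"
proof -
  interpret prob_space M using s by (simp add: sample_density_def)
  have ind: "indep_vars (\<lambda>_. borel) X {1..n}" using s by (simp add: sample_density_def)
  have dist: "distributed M lborel (X k) (\<lambda>x. ennreal (f x))" if "k \<in> {1..n}" for k
    using s that by (simp add: sample_density_def)
  have Xm: "X k \<in> borel_measurable M" if "k \<in> {1..n}" for k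
    using distributed_measurable[OF dist[OF that]] by simp
  have dX: "distr M borel (X k) = density lborel (\<lambda>x. ennreal (f x))" if "k \<in> {1..n}" for k
  proof -
    have "distr M borel (X k) = distr M lborel (X k)" by (intro distr_cong) auto
    then show ?thesis using distributed_distr_eq_density[OF dist[OF that]] by simp
  qed
  have "distr M (Pi\<^sub>M {1..n} (\<lambda>_. borel)) (\<lambda>\<omega>. \<lambda>k\<in>{1..n}. X k \<omega>) = Pi\<^sub>M {1..n} (\<lambda>k. distr M borel (X k))"
    using indep_vars_iff_distr_eq_PiM'[of "{1..n}" X "\<lambda>_. borel"] ind Xm n by simp
  also have "\<dots> = Pi\<^sub>M {1..n} (\<lambda>_. density lborel (\<lambda>x. ennreal (f x)))"
    by (intro PiM_cong refl dX)
  finally have D: "distr M (Pi\<^sub>M {1..n} (\<lambda>_. borel)) (\<lambda>\<omega>. \<lambda>k\<in>{1..n}. X k \<omega>)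
     = Pi\<^sub>M {1..n} (\<lambda>_. density lborel (\<lambda>x. ennreal (f x)))" .
  have m[measurable]: "(\<lambda>\<omega>. \<lambda>k\<in>{1..n}. X k \<omega>) \<in> M \<rightarrow>\<^sub>M Pi\<^sub>M {1..n} (\<lambda>_. borel)"
    using Xm by (intro measurable_restrict) auto
  have setsP: "sets (Pi\<^sub>M {1..n} (\<lambda>_. density lborel (\<lambda>x. ennreal (f x)))) = sets (Pi\<^sub>M {1..n} (\<lambda>_. borel))"
    by (intro sets_PiM_cong) auto
  have Fm: "F \<in> borel_measurable (Pi\<^sub>M {1..n} (\<lambda>_. borel))"
    using F measurable_cong_sets[OF setsP refl] by blast
  have eq: "F (\<lambda>k. X k \<omega>) = F (\<lambda>k\<in>{1..n}. X k \<omega>)" for \<omega>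
    by (rule cong) simp
  show "(\<lambda>\<omega>. F (\<lambda>k. X k \<omega>)) \<in> borel_measurable M"
    unfolding eq by (rule measurable_compose[OF m Fm])
  show "(\<integral>\<^sup>+\<omega>. F (\<lambda>k. X k \<omega>) \<partial>M) = (\<integral>\<^sup>+w. F w \<partial>(Pi\<^sub>M {1..n} (\<lambda>_. density lborel (\<lambda>x. ennreal (f x)))))"
    unfolding D[symmetric] eq by (subst nn_integral_distr[OF m]) (use Fm in simp_all)
qed

lemma sample_density_facts:
  assumes s: "sample_density M X n f" and n: "1 \<le> n" and fb: "bounded (range f)"
  shows "f \<in> borel_measurable borel" "\<And>x. 0 \<le> f x" "prob_space (density lborel (\<lambda>x. ennreal (f x)))"
    "L2 f" "\<exists>B. \<forall>x. \<bar>f x\<bar> \<le> B" "AE x in lborel. f x \<le> Linf_norm f" "0 \<le> Linf_norm f"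
proof -
  interpret prob_space M using s by (simp add: sample_density_def)
  show f0: "\<And>x. 0 \<le> f x" using s by (simp add: sample_density_def)
  have dist: "distributed M lborel (X 1) (\<lambda>x. ennreal (f x))"
    using s n by (simp add: sample_density_def)
  have "(\<lambda>x. ennreal (f x)) \<in> borel_measurable borel"
    using distributed_borel_measurable[OF dist] by simp
  then have "(\<lambda>x. enn2real (ennreal (f x))) \<in> borel_measurable borel" by simp
  then show fm[measurable]: "f \<in> borel_measurable borel" using f0 by simp
  have "prob_space (distr M lborel (X 1))"
    by (rule prob_space_distr[OF distributed_measurable[OF dist]])
  then show p: "prob_space (density lborel (\<lambda>x. ennreal (f x)))"
    using distributed_distr_eq_density[OF dist] by simp
  obtain B where B: "\<And>x. \<bar>f x\<bar> \<le> B" using fb by (auto simp: bounded_iff)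
  then show "\<exists>B. \<forall>x. \<bar>f x\<bar> \<le> B" by blast
  have "(\<integral>\<^sup>+x. ennreal (f x) \<partial>lborel) = 1"
    using prob_space.emeasure_space_1[OF p] by (simp add: emeasure_density)
  then have i: "integrable lborel f"
    using f0 by (intro integrableI_nonneg) auto
  have "integrable lborel (\<lambda>x. (f x)\<^sup>2)"
  proof (rule Bochner_Integration.integrable_bound[where f = "\<lambda>x. B * f x"])
    show "AE x in lborel. norm ((f x)\<^sup>2) \<le> norm (B * f x)"
      using B f0 order_trans[OF abs_ge_zero B]
      by (auto simp: power2_eq_square abs_mult intro!: mult_right_mono)
  qed (use i in auto)
  then show "L2 f" by (simp add: L2_def)
  define e where "e = esssup lborel (\<lambda>x. ereal \<bar>f x\<bar>)"
  have m: "(\<lambda>x. ereal \<bar>f x\<bar>) \<in> borel_measurable lborel" by simp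
  have "e \<le> ereal B" unfolding e_def using B by (intro esssup_I m) auto
  have "0 = esssup (lborel :: real measure) (\<lambda>x. 0::ereal)"
    by (rule esssup_const[symmetric]) simp
  also have "\<dots> \<le> e" unfolding e_def by (rule esssup_mono) auto
  finally have "0 \<le> e" .
  then have er: "e = ereal (Linf_norm f)" and "0 \<le> Linf_norm f"
    using \<open>e \<le> ereal B\<close> unfolding Linf_norm_def e_def[symmetric] by (cases e; simp)+
  then show "0 \<le> Linf_norm f" by simp
  show "AE x in lborel. f x \<le> Linf_norm f"
    using esssup_AE[of "\<lambda>x. ereal \<bar>f x\<bar>" lborel] f0 unfolding e_def[symmetric] er by simp
qed

text \<open>
  The number 72 is \<open>18 \<cdot> 4\<close>: every excess is counted at most 18 times, and each of them carries the factor
  \<open>4 * (tail_rate Q B)\<^sup>2 * exp 2\<close> of \<open>grid_noise_excess\<close>.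
\<close>
definition tail_const :: "(real \<Rightarrow> real) \<Rightarrow> (nat \<Rightarrow> real \<Rightarrow> real) \<Rightarrow> (nat \<Rightarrow> real set) \<Rightarrow> real \<Rightarrow> real" where
  "tail_const K h \<Gamma> B = 72 * (tail_rate (normsq K) B)\<^sup>2 * exp 2 *
     (SUP n\<in>{1..}. \<Sum>\<gamma>\<in>\<Gamma> n. exp (- (6 * sqrt (normsq K) / tail_rate (normsq K) B) / mean_bw h n \<gamma> powr (1 / 2)))"

text \<open>
  Integrate \<open>selection_loss\<close>. For \<open>\<upsilon> \<ge> 576\<close> half of the penalty is at least \<open>288 Q s / n\<^sup>2\<close>, so every
  excess has an expectation of order \<open>1/n\<close> with a factor whose sum over the grid is bounded uniformly in \<open>n\<close>.
\<close>
theorem oracle_inequality: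
  assumes K: "kernel K" and bw: "bandwidths h" and gr: "grids \<Gamma>" and gs: "grid_summability h \<Gamma>"
    and \<upsilon>: "576 \<le> \<upsilon>" and fb: "bounded (range f)" and n: "1 \<le> n" and A: "cond_A h \<Gamma> n"
    and s: "sample_density M X n f" and sel: "selected M X K h \<Gamma> \<upsilon> n g" and \<gamma>: "\<gamma> \<in> \<Gamma> n"
  shows "risk M X K h n g f
    \<le> ennreal (18 * (V_crit K h \<upsilon> n \<gamma> + bias_term K h n f \<gamma>) + tail_const K h \<Gamma> (Linf_norm f) / n)"
proof -
  interpret prob_space M using s by (simp add: sample_density_def)
  note F = sample_density_facts[OF s n fb]
  obtain B0 where B0: "\<And>x. \<bar>f x\<bar> \<le> B0" using F(5) by blast
  define \<mu> where "\<mu> = density lborel (\<lambda>x. ennreal (f x))"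
  have sets\<mu>: "sets \<mu> = sets borel" by (simp add: \<mu>_def)
  define Q where "Q = normsq K"
  have Q: "0 < Q" using kernelD(4)[OF K] by (simp add: Q_def)
  define B where "B = Linf_norm f"
  define G where "G = \<Gamma> n"
  have fG: "finite G" and Gsub: "G \<subseteq> {0..1}" using gr n by (auto simp: grids_def G_def)
  have \<gamma>G: "\<gamma> \<in> G" using \<gamma> by (simp add: G_def)
  have hpos: "0 < h k \<gamma>'" if "k \<in> {1..n}" "\<gamma>' \<in> G" for k \<gamma>'
    using bw that Gsub unfolding bandwidths_def by auto
  have hlow: "1 / real n \<le> h k \<gamma>'" if "k \<in> {1..n}" "\<gamma>' \<in> G" for k \<gamma>'
    using cond_A_bandwidth[OF A n] that Gsub by (auto simp: G_def)
  have spos: "0 < inv_sum h n \<gamma>'" if "\<gamma>' \<in> G" for \<gamma>'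
    unfolding inv_sum_def using n hpos that by (intro sum_pos) auto
  have n0: "0 < real n" using n by simp
  define E where "E \<gamma>' = exp (- (6 * sqrt Q / tail_rate Q B) / mean_bw h n \<gamma>' powr (1 / 2))" for \<gamma>'
  define C where "C = 4 * (tail_rate Q B)\<^sup>2 * exp 2"
  have C0: "0 \<le> C" by (simp add: C_def)
  have r0: "0 < tail_rate Q B"
    unfolding tail_rate_def using F(7) Q by (simp add: B_def add_nonneg_pos)
  have sumE: "(\<Sum>\<gamma>'\<in>G. E \<gamma>') \<le> (SUP n\<in>{1..}. \<Sum>\<gamma>\<in>\<Gamma> n. exp (- (6 * sqrt Q / tail_rate Q B) / mean_bw h n \<gamma> powr (1 / 2)))"
    unfolding E_def G_def
  proof (rule cSUP_upper)
    show "bdd_above ((\<lambda>n. \<Sum>\<gamma>\<in>\<Gamma> n. exp (- (6 * sqrt Q / tail_rate Q B) / mean_bw h n \<gamma> powr (1 / 2))) ` {1..})"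
    proof -
      have "0 < 6 * sqrt Q / tail_rate Q B" using Q r0 by simp
      then show ?thesis by (rule gs[unfolded grid_summability_def, rule_format, OF _ insertI1])
    qed
  qed (use n in simp)
  define N where "N \<kappa> w = normsq (centred_average n f w \<kappa>)" for \<kappa> w
  define Y where "Y \<kappa> \<gamma>' w = max (N \<kappa> w - V_crit K h \<upsilon> n \<gamma>' / 2) 0" for \<kappa> \<gamma>' w
  have Ycong: "Y \<kappa> \<gamma>' v = Y \<kappa> \<gamma>' w" if "\<And>k. k \<in> {1..n} \<Longrightarrow> v k = w k" for \<kappa> \<gamma>' v w
    using that by (simp add: Y_def N_def centred_average_def[abs_def])
  have V0: "0 \<le> V_crit K h \<upsilon> n \<gamma>'" if "\<gamma>' \<in> G" for \<gamma>'
    using spos[OF that] Q \<upsilon> n0 unfolding V_crit_eq[OF K n] Q_def[symmetric] by simp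
  have Vlow: "288 * Q * inv_sum h n \<gamma>' / (real n)\<^sup>2 \<le> V_crit K h \<upsilon> n \<gamma>' / 2" if "\<gamma>' \<in> G" for \<gamma>'
  proof -
    define t where "t = Q * inv_sum h n \<gamma>' / (real n)\<^sup>2"
    have "576 * t \<le> \<upsilon> * t"
      using \<upsilon> Q spos[OF that] by (intro mult_right_mono) (auto simp: t_def)
    moreover have "288 * Q * inv_sum h n \<gamma>' / (real n)\<^sup>2 = 288 * t"
      by (simp add: t_def)
    moreover have "V_crit K h \<upsilon> n \<gamma>' = \<upsilon> * t"
      unfolding V_crit_eq[OF K n] Q_def t_def by simp
    ultimately show ?thesis by linarith
  qed
  have EY: "(\<lambda>\<omega>. ennreal (Y \<kappa> \<gamma>' (\<lambda>k. X k \<omega>))) \<in> borel_measurable M"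
      "(\<integral>\<^sup>+\<omega>. ennreal (Y \<kappa> \<gamma>' (\<lambda>k. X k \<omega>)) \<partial>M) \<le> ennreal (C / n * E \<gamma>')"
    if \<gamma>': "\<gamma>' \<in> G" and \<kappa>: "\<And>k. k \<in> {1..n} \<Longrightarrow> integrable lborel (\<kappa> k)" "\<And>k. k \<in> {1..n} \<Longrightarrow> L2 (\<kappa> k)"
      "\<And>k. k \<in> {1..n} \<Longrightarrow> (LINT x|lborel. \<bar>\<kappa> k x\<bar>) \<le> 2" "\<And>k. k \<in> {1..n} \<Longrightarrow> normsq (\<kappa> k) \<le> 4 * Q / h k \<gamma>'" for \<kappa> \<gamma>'
  proof -
    have [measurable]: "N \<kappa> \<in> borel_measurable (Pi\<^sub>M {1..n} (\<lambda>_. \<mu>))"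
      unfolding N_def[abs_def] using \<kappa>(2) L2_measurable by (intro centred_average_measurable sets\<mu> F(1)) auto
    have Ym: "(\<lambda>w. ennreal (Y \<kappa> \<gamma>' w)) \<in> borel_measurable (Pi\<^sub>M {1..n} (\<lambda>_. \<mu>))"
      unfolding Y_def by measurable
    note S = sample_nn_integral[OF s n, of "\<lambda>w. ennreal (Y \<kappa> \<gamma>' w)", OF Ym[unfolded \<mu>_def] arg_cong[where f = ennreal, OF Ycong]]
    show "(\<lambda>\<omega>. ennreal (Y \<kappa> \<gamma>' (\<lambda>k. X k \<omega>))) \<in> borel_measurable M" by (rule S(2))
    have "(\<integral>\<^sup>+\<omega>. ennreal (Y \<kappa> \<gamma>' (\<lambda>k. X k \<omega>)) \<partial>M) = (\<integral>\<^sup>+w. ennreal (Y \<kappa> \<gamma>' w) \<partial>(Pi\<^sub>M {1..n} (\<lambda>_. \<mu>)))"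
      using S(1) by (simp add: \<mu>_def)
    also have "\<dots> \<le> (\<integral>\<^sup>+w. ennreal (max (N \<kappa> w - 288 * Q * inv_sum h n \<gamma>' / (real n)\<^sup>2) 0) \<partial>(Pi\<^sub>M {1..n} (\<lambda>_. \<mu>)))"
      using Vlow[OF \<gamma>'] unfolding Y_def by (intro nn_integral_mono ennreal_leI max.mono) auto
    also have "\<dots> \<le> ennreal (4 * (tail_rate Q B)\<^sup>2 * exp 2 / n * exp (- (6 * sqrt Q / tail_rate Q B) * sqrt (inv_sum h n \<gamma>' / n)))"
      unfolding N_def centred_average_def[abs_def] \<mu>_def
      by (rule grid_noise_excess[OF F(3,1,2), where b = "\<lambda>k. h k \<gamma>'"])
         (use F(6,7) n Q hlow \<gamma>' \<kappa> in \<open>auto simp: B_def inv_sum_def\<close>)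
    also have "\<dots> = ennreal (C / n * E \<gamma>')"
      unfolding E_def C_def using mean_bw_exp[OF n spos[OF \<gamma>'], of "6 * sqrt Q / tail_rate Q B"] by simp
    finally show "(\<integral>\<^sup>+\<omega>. ennreal (Y \<kappa> \<gamma>' (\<lambda>k. X k \<omega>)) \<partial>M) \<le> ennreal (C / n * E \<gamma>')" .
  qed
  define \<kappa>1 where "\<kappa>1 k = dilate K (h k \<gamma>)" for k
  define \<kappa>2 where "\<kappa>2 \<gamma>' k = pair_kernel K (h k \<gamma>) (h k \<gamma>')" for \<gamma>' k
  have Y1: "(\<lambda>\<omega>. ennreal (Y \<kappa>1 \<gamma> (\<lambda>k. X k \<omega>))) \<in> borel_measurable M"
      "(\<integral>\<^sup>+\<omega>. ennreal (Y \<kappa>1 \<gamma> (\<lambda>k. X k \<omega>)) \<partial>M) \<le> ennreal (C / n * E \<gamma>)"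
  proof -
    have "integrable lborel (\<kappa>1 k)" "L2 (\<kappa>1 k)" "(LINT x|lborel. \<bar>\<kappa>1 k x\<bar>) \<le> 2" "normsq (\<kappa>1 k) \<le> 4 * Q / h k \<gamma>"
      if "k \<in> {1..n}" for k
      using dilate_facts[OF K hpos[OF that \<gamma>G]] Q hpos[OF that \<gamma>G] by (auto simp: \<kappa>1_def Q_def divide_right_mono)
    from EY[OF \<gamma>G this] show "(\<lambda>\<omega>. ennreal (Y \<kappa>1 \<gamma> (\<lambda>k. X k \<omega>))) \<in> borel_measurable M"
      "(\<integral>\<^sup>+\<omega>. ennreal (Y \<kappa>1 \<gamma> (\<lambda>k. X k \<omega>)) \<partial>M) \<le> ennreal (C / n * E \<gamma>)" by auto
  qed
  have Y2: "(\<lambda>\<omega>. ennreal (Y (\<kappa>2 \<gamma>') \<gamma>' (\<lambda>k. X k \<omega>))) \<in> borel_measurable M"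
      "(\<integral>\<^sup>+\<omega>. ennreal (Y (\<kappa>2 \<gamma>') \<gamma>' (\<lambda>k. X k \<omega>)) \<partial>M) \<le> ennreal (C / n * E \<gamma>')" if \<gamma>': "\<gamma>' \<in> G" for \<gamma>'
  proof -
    have "integrable lborel (\<kappa>2 \<gamma>' k)" "L2 (\<kappa>2 \<gamma>' k)" "(LINT x|lborel. \<bar>\<kappa>2 \<gamma>' k x\<bar>) \<le> 2" "normsq (\<kappa>2 \<gamma>' k) \<le> 4 * Q / h k \<gamma>'"
      if "k \<in> {1..n}" for k
      using pair_kernel_facts[OF K hpos[OF that \<gamma>G] hpos[OF that \<gamma>']] by (auto simp: \<kappa>2_def Q_def)
    from EY[OF \<gamma>' this] show "(\<lambda>\<omega>. ennreal (Y (\<kappa>2 \<gamma>') \<gamma>' (\<lambda>k. X k \<omega>))) \<in> borel_measurable M"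
      "(\<integral>\<^sup>+\<omega>. ennreal (Y (\<kappa>2 \<gamma>') \<gamma>' (\<lambda>k. X k \<omega>)) \<partial>M) \<le> ennreal (C / n * E \<gamma>')" by auto
  qed
  note [measurable] = Y1(1) Y2(1)
  define W where "W = 18 * (V_crit K h \<upsilon> n \<gamma> + bias_term K h n f \<gamma>)"
  have W0: "0 \<le> W" using V0[OF \<gamma>G] by (simp add: W_def bias_term_def)
  have Y0: "0 \<le> Y \<kappa> \<gamma>' w" for \<kappa> \<gamma>' w by (simp add: Y_def)
  have E0: "0 \<le> E \<gamma>'" for \<gamma>' by (simp add: E_def)
  have "risk M X K h n g f \<le> (\<integral>\<^sup>+\<omega>. ennreal W + (12 * (\<Sum>\<gamma>'\<in>G. ennreal (Y (\<kappa>2 \<gamma>') \<gamma>' (\<lambda>k. X k \<omega>)))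
       + 6 * ennreal (Y \<kappa>1 \<gamma> (\<lambda>k. X k \<omega>))) \<partial>M)"
    unfolding risk_def
  proof (rule nn_integral_mono)
    fix \<omega> assume \<omega>: "\<omega> \<in> space M"
    have "normsq (\<lambda>x. fhat K h n (\<lambda>k. X k \<omega>) (g \<omega>) x - f x)
      \<le> W + (12 * (\<Sum>\<gamma>'\<in>G. Y (\<kappa>2 \<gamma>') \<gamma>' (\<lambda>k. X k \<omega>)) + 6 * Y \<kappa>1 \<gamma> (\<lambda>k. X k \<omega>))"
      using selection_loss[where h = h and \<Gamma> = \<Gamma> and n = n and \<upsilon> = \<upsilon> and xs = "\<lambda>k. X k \<omega>" and g = "g \<omega>",
          OF K n F(4) B0 hpos G_def[symmetric] fG \<gamma>G V0] sel \<omega>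
      unfolding selected_def W_def Y_def N_def \<kappa>1_def[abs_def] \<kappa>2_def[abs_def] by simp
    then have "ennreal ((Lp_norm 2 (\<lambda>x. fhat K h n (\<lambda>k. X k \<omega>) (g \<omega>) x - f x))\<^sup>2)
      \<le> ennreal (W + (12 * (\<Sum>\<gamma>'\<in>G. Y (\<kappa>2 \<gamma>') \<gamma>' (\<lambda>k. X k \<omega>)) + 6 * Y \<kappa>1 \<gamma> (\<lambda>k. X k \<omega>)))"
      unfolding Lp_norm_2_sq by (rule ennreal_leI)
    also have "\<dots> = ennreal W + (12 * (\<Sum>\<gamma>'\<in>G. ennreal (Y (\<kappa>2 \<gamma>') \<gamma>' (\<lambda>k. X k \<omega>))) + 6 * ennreal (Y \<kappa>1 \<gamma> (\<lambda>k. X k \<omega>)))"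
      using W0 Y0 by (simp add: ennreal_mult sum_nonneg)
    finally show "ennreal ((Lp_norm 2 (\<lambda>x. fhat K h n (\<lambda>k. X k \<omega>) (g \<omega>) x - f x))\<^sup>2)
       \<le> ennreal W + (12 * (\<Sum>\<gamma>'\<in>G. ennreal (Y (\<kappa>2 \<gamma>') \<gamma>' (\<lambda>k. X k \<omega>))) + 6 * ennreal (Y \<kappa>1 \<gamma> (\<lambda>k. X k \<omega>)))" .
  qed
  also have "\<dots> = ennreal W + (12 * (\<Sum>\<gamma>'\<in>G. (\<integral>\<^sup>+\<omega>. ennreal (Y (\<kappa>2 \<gamma>') \<gamma>' (\<lambda>k. X k \<omega>)) \<partial>M))
       + 6 * (\<integral>\<^sup>+\<omega>. ennreal (Y \<kappa>1 \<gamma> (\<lambda>k. X k \<omega>)) \<partial>M))"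
    by (simp add: nn_integral_add nn_integral_cmult nn_integral_sum emeasure_space_1)
  also have "\<dots> \<le> ennreal W + (12 * (\<Sum>\<gamma>'\<in>G. ennreal (C / n * E \<gamma>')) + 6 * ennreal (C / n * E \<gamma>))"
    by (intro add_mono mult_left_mono sum_mono Y1 Y2) auto
  also have "\<dots> = ennreal (W + (12 * (\<Sum>\<gamma>'\<in>G. C / n * E \<gamma>') + 6 * (C / n * E \<gamma>)))"
  proof -
    define T where "T \<gamma>' = C / n * E \<gamma>'" for \<gamma>'
    have "0 \<le> T \<gamma>'" for \<gamma>' using C0 E0 by (simp add: T_def)
    then have "ennreal W + (12 * (\<Sum>\<gamma>'\<in>G. ennreal (T \<gamma>')) + 6 * ennreal (T \<gamma>))
       = ennreal (W + (12 * (\<Sum>\<gamma>'\<in>G. T \<gamma>') + 6 * T \<gamma>))"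
      using W0 by (simp add: ennreal_mult sum_nonneg)
    then show ?thesis unfolding T_def .
  qed
  also have "\<dots> \<le> ennreal (W + 18 * C / n * (\<Sum>\<gamma>'\<in>G. E \<gamma>'))"
  proof (intro ennreal_leI add_left_mono)
    have "6 * (C / n * E \<gamma>) \<le> 6 * (C / n * (\<Sum>\<gamma>'\<in>G. E \<gamma>'))"
      using C0 E0 fG \<gamma>G by (intro mult_left_mono member_le_sum) auto
    moreover have "(\<Sum>\<gamma>'\<in>G. C / n * E \<gamma>') = C / n * (\<Sum>\<gamma>'\<in>G. E \<gamma>')"
      by (simp only: sum_distrib_left)
    moreover have "18 * C / n * (\<Sum>\<gamma>'\<in>G. E \<gamma>') = 18 * (C / n * (\<Sum>\<gamma>'\<in>G. E \<gamma>'))"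
      by simp
    ultimately show "12 * (\<Sum>\<gamma>'\<in>G. C / n * E \<gamma>') + 6 * (C / n * E \<gamma>) \<le> 18 * C / n * (\<Sum>\<gamma>'\<in>G. E \<gamma>')"
      by linarith
  qed
  also have "\<dots> \<le> ennreal (W + tail_const K h \<Gamma> (Linf_norm f) / n)"
  proof (intro ennreal_leI add_left_mono)
    have "18 * C / n * (\<Sum>\<gamma>'\<in>G. E \<gamma>') \<le> 18 * C / n * (SUP n\<in>{1..}. \<Sum>\<gamma>\<in>\<Gamma> n. exp (- (6 * sqrt Q / tail_rate Q B) / mean_bw h n \<gamma> powr (1 / 2)))"
      using sumE C0 by (intro mult_left_mono) auto
    then show "18 * C / n * (\<Sum>\<gamma>'\<in>G. E \<gamma>') \<le> tail_const K h \<Gamma> (Linf_norm f) / n"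
      by (simp add: tail_const_def C_def Q_def B_def mult_ac)
  qed
  finally show ?thesis by (simp add: W_def)
qed

lemma finite_INF_attained:
  fixes \<phi> :: "real \<Rightarrow> real"
  assumes "finite G" "G \<noteq> {}"
  obtains \<gamma> where "\<gamma> \<in> G" "(INF \<gamma>\<in>G. \<phi> \<gamma>) = \<phi> \<gamma>"
proof -
  have "(INF \<gamma>\<in>G. \<phi> \<gamma>) \<in> \<phi> ` G"
    using assms cInf_eq_Min[of "\<phi> ` G"] Min_in[of "\<phi> ` G"] by simp
  then show thesis using that by blast
qed

lemma nikolski_bias:
  assumes K: "kernel K" "moment_cond \<beta> K" and f: "f \<in> nikolski \<beta> L" "f \<in> borel_measurable borel" "\<And>x. \<bar>f x\<bar> \<le> B"
    and \<beta>: "0 < \<beta>" "0 < L" and h: "\<And>k. k \<in> {1..n} \<Longrightarrow> 0 < h k \<gamma>"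
  shows "bias_term K h n f \<gamma> \<le> ((LINT z|lborel. \<bar>z\<bar> powr \<beta> * \<bar>K z\<bar>) * L)\<^sup>2 * BB h \<beta> n \<gamma>"
proof -
  define m where "m = (LINT z|lborel. \<bar>z\<bar> powr \<beta> * \<bar>K z\<bar>)"
  have "(\<Sum>k=1..n. Lp_norm 2 (\<lambda>x. f x - conv (dilate K (h k \<gamma>)) f x)) \<le> (\<Sum>k=1..n. m * L * h k \<gamma> powr \<beta>)"
    unfolding Lp_norm_2 m_def by (intro sum_mono kernel_bias_bound[OF f(1) \<beta> refl f(2) K h f(3)])
  also have "\<dots> = m * L * (\<Sum>k=1..n. h k \<gamma> powr \<beta>)" by (simp add: sum_distrib_left)
  finally have "\<bar>\<Sum>k=1..n. Lp_norm 2 (\<lambda>x. f x - conv (dilate K (h k \<gamma>)) f x)\<bar> \<le> m * L * (\<Sum>k=1..n. h k \<gamma> powr \<beta>)"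
    by (subst abs_of_nonneg) (auto simp: Lp_norm_2 intro: sum_nonneg)
  then have "\<bar>\<Sum>k=1..n. Lp_norm 2 (\<lambda>x. f x - conv (dilate K (h k \<gamma>)) f x)\<bar>\<^sup>2 \<le> (m * L * (\<Sum>k=1..n. h k \<gamma> powr \<beta>))\<^sup>2"
    by (intro power_mono) auto
  then have "(1 / (real n)\<^sup>2) * \<bar>\<Sum>k=1..n. Lp_norm 2 (\<lambda>x. f x - conv (dilate K (h k \<gamma>)) f x)\<bar>\<^sup>2
     \<le> (1 / (real n)\<^sup>2) * (m * L * (\<Sum>k=1..n. h k \<gamma> powr \<beta>))\<^sup>2"
    by (intro mult_left_mono) auto
  then show ?thesis
    unfolding m_def[symmetric] by (simp add: bias_term_def BB_def power_mult_distrib mult_ac)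
qed

theorem proposition3p3:
  shows "\<exists>\<upsilon>0>0. \<forall>(K :: real \<Rightarrow> real) (h :: nat \<Rightarrow> real \<Rightarrow> real) (\<Gamma> :: nat \<Rightarrow> real set).
    kernel K \<and> bandwidths h \<and> grids \<Gamma> \<and> grid_summability h \<Gamma> \<longrightarrow>
      (\<exists>c1 :: real \<Rightarrow> real. \<forall>\<upsilon>\<ge>\<upsilon>0. \<forall>f :: real \<Rightarrow> real. bounded (range f) \<longrightarrow>
        (\<forall>n\<ge>1. \<forall>(M :: 'a measure) X g.
          cond_A h \<Gamma> n \<and> sample_density M X n f \<and> selected M X K h \<Gamma> \<upsilon> n g \<longrightarrow>
          risk M X K h n g f \<le> ennreal (18 * (INF \<gamma>\<in>\<Gamma> n. V_crit K h \<upsilon> n \<gamma>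
             + (1 / (real n)\<^sup>2) * \<bar>\<Sum>k=1..n. Lp_norm 2 (\<lambda>x. f x - conv (dilate K (h k \<gamma>)) f x)\<bar>\<^sup>2)
             + c1 (Linf_norm f) / real n)))
    \<and> (\<forall>\<upsilon>\<ge>\<upsilon>0. \<forall>(f :: real \<Rightarrow> real) \<beta> L.
        bounded (range f) \<and> \<beta> > 0 \<and> L > 0 \<and> moment_cond \<beta> K \<and> f \<in> nikolski \<beta> L \<longrightarrow>
        (\<exists>c>0. \<forall>n\<ge>1. \<forall>(M :: 'a measure) X g.
          cond_A h \<Gamma> n \<and> sample_density M X n f \<and> selected M X K h \<Gamma> \<upsilon> n g \<longrightarrow>
          risk M X K h n g f \<le> ennreal (c * ((INF \<gamma>\<in>\<Gamma> n. BB h \<beta> n \<gamma> + VV h n \<gamma>) + 1 / real n))))"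
proof (rule exI[of _ "576::real"], (intro conjI allI impI; (elim conjE)?))
  show "(0::real) < 576" by simp
  fix K :: "real \<Rightarrow> real" and h :: "nat \<Rightarrow> real \<Rightarrow> real" and \<Gamma> :: "nat \<Rightarrow> real set"
  assume H: "kernel K" "bandwidths h" "grids \<Gamma>" "grid_summability h \<Gamma>"
  have ne: "finite (\<Gamma> n)" "\<Gamma> n \<noteq> {}" if "cond_A h \<Gamma> n" for n
    using that by (auto simp: cond_A_def)
  show "\<exists>c1 :: real \<Rightarrow> real. \<forall>\<upsilon>\<ge>576. \<forall>f :: real \<Rightarrow> real. bounded (range f) \<longrightarrow>
        (\<forall>n\<ge>1. \<forall>(M :: 'a measure) X g.
          cond_A h \<Gamma> n \<and> sample_density M X n f \<and> selected M X K h \<Gamma> \<upsilon> n g \<longrightarrow>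
          risk M X K h n g f \<le> ennreal (18 * (INF \<gamma>\<in>\<Gamma> n. V_crit K h \<upsilon> n \<gamma>
             + (1 / (real n)\<^sup>2) * \<bar>\<Sum>k=1..n. Lp_norm 2 (\<lambda>x. f x - conv (dilate K (h k \<gamma>)) f x)\<bar>\<^sup>2)
             + c1 (Linf_norm f) / real n))"
  proof (intro exI[of _ "tail_const K h \<Gamma>"] allI impI; elim conjE)
    fix \<upsilon> :: real and f :: "real \<Rightarrow> real" and n g and M :: "'a measure" and X
    assume a: "576 \<le> \<upsilon>" "bounded (range f)" "1 \<le> n"
      "cond_A h \<Gamma> n" "sample_density M X n f" "selected M X K h \<Gamma> \<upsilon> n g"
    obtain \<gamma> where "\<gamma> \<in> \<Gamma> n" "(INF \<gamma>\<in>\<Gamma> n. V_crit K h \<upsilon> n \<gamma> + bias_term K h n f \<gamma>) = V_crit K h \<upsilon> n \<gamma> + bias_term K h n f \<gamma>"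
      using finite_INF_attained[OF ne[OF a(4)]] by blast
    then show "risk M X K h n g f \<le> ennreal (18 * (INF \<gamma>\<in>\<Gamma> n. V_crit K h \<upsilon> n \<gamma>
             + (1 / (real n)\<^sup>2) * \<bar>\<Sum>k=1..n. Lp_norm 2 (\<lambda>x. f x - conv (dilate K (h k \<gamma>)) f x)\<bar>\<^sup>2)
             + tail_const K h \<Gamma> (Linf_norm f) / real n)"
      using oracle_inequality[OF H a] unfolding bias_term_def[symmetric] by simp
  qed
  fix \<upsilon> \<beta> L :: real and f :: "real \<Rightarrow> real"
  assume b: "576 \<le> \<upsilon>" "bounded (range f)" "0 < \<beta>" "0 < L" "moment_cond \<beta> K" "f \<in> nikolski \<beta> L"
  define D where "D = ((LINT z|lborel. \<bar>z\<bar> powr \<beta> * \<bar>K z\<bar>) * L)\<^sup>2"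
  define c where "c = 18 * (\<upsilon> * normsq K + D) + \<bar>tail_const K h \<Gamma> (Linf_norm f)\<bar>"
  have D0: "0 \<le> D" by (simp add: D_def)
  have vK: "0 < \<upsilon> * normsq K" using b kernelD(4)[OF H(1)] by simp
  show "\<exists>c>0. \<forall>n\<ge>1. \<forall>(M :: 'a measure) X g.
          cond_A h \<Gamma> n \<and> sample_density M X n f \<and> selected M X K h \<Gamma> \<upsilon> n g \<longrightarrow>
          risk M X K h n g f \<le> ennreal (c * ((INF \<gamma>\<in>\<Gamma> n. BB h \<beta> n \<gamma> + VV h n \<gamma>) + 1 / real n))"
  proof (intro exI[of _ c] conjI allI impI; (elim conjE)?)
    show "0 < c" using D0 vK by (simp add: c_def add_pos_nonneg)
    fix n g and M :: "'a measure" and X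
    assume a: "1 \<le> n" "cond_A h \<Gamma> n" "sample_density M X n f" "selected M X K h \<Gamma> \<upsilon> n g"
    note F = sample_density_facts[OF a(3,1) b(2)]
    obtain B0 where B0: "\<And>x. \<bar>f x\<bar> \<le> B0" using F(5) by blast
    obtain \<gamma> where \<gamma>: "\<gamma> \<in> \<Gamma> n" "(INF \<gamma>\<in>\<Gamma> n. BB h \<beta> n \<gamma> + VV h n \<gamma>) = BB h \<beta> n \<gamma> + VV h n \<gamma>"
      using finite_INF_attained[OF ne[OF a(2)]] by blast
    have hpos: "0 < h k \<gamma>" if "k \<in> {1..n}" for k
    proof -
      have "\<gamma> \<in> {0..1}" using H(3)[unfolded grids_def] \<gamma>(1) a(1) by blast
      then show ?thesis using H(2) that by (auto simp: bandwidths_def)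
    qed
    have bias: "bias_term K h n f \<gamma> \<le> D * BB h \<beta> n \<gamma>"
      unfolding D_def by (rule nikolski_bias[OF H(1) b(5,6) F(1) B0 b(3,4)]) (rule hpos)
    have V: "V_crit K h \<upsilon> n \<gamma> = \<upsilon> * normsq K * VV h n \<gamma>"
      unfolding V_crit_eq[OF H(1) a(1)] by (simp add: VV_def inv_sum_def)
    have BB0: "0 \<le> BB h \<beta> n \<gamma>" by (simp add: BB_def)
    have VV0: "0 \<le> VV h n \<gamma>"
      unfolding VV_def using hpos by (intro mult_nonneg_nonneg sum_nonneg) (auto intro: less_imp_le)
    have "18 * (V_crit K h \<upsilon> n \<gamma> + bias_term K h n f \<gamma>) + tail_const K h \<Gamma> (Linf_norm f) / n
       \<le> c * (BB h \<beta> n \<gamma> + VV h n \<gamma>) + c * (1 / n)"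
    proof (intro add_mono)
      have "V_crit K h \<upsilon> n \<gamma> + bias_term K h n f \<gamma> \<le> \<upsilon> * normsq K * VV h n \<gamma> + D * BB h \<beta> n \<gamma>"
        using bias V by simp
      also have "\<dots> \<le> (\<upsilon> * normsq K + D) * (BB h \<beta> n \<gamma> + VV h n \<gamma>)"
        using mult_nonneg_nonneg[OF D0 VV0] mult_nonneg_nonneg[OF less_imp_le[OF vK] BB0]
        by (simp add: algebra_simps)
      finally have "V_crit K h \<upsilon> n \<gamma> + bias_term K h n f \<gamma> \<le> (\<upsilon> * normsq K + D) * (BB h \<beta> n \<gamma> + VV h n \<gamma>)" .
      then have "18 * (V_crit K h \<upsilon> n \<gamma> + bias_term K h n f \<gamma>) \<le> 18 * (\<upsilon> * normsq K + D) * (BB h \<beta> n \<gamma> + VV h n \<gamma>)"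
        unfolding mult.assoc[of 18] by (rule mult_left_mono) simp
      also have "\<dots> \<le> c * (BB h \<beta> n \<gamma> + VV h n \<gamma>)"
        using BB0 VV0 by (intro mult_right_mono) (auto simp: c_def)
      finally show "18 * (V_crit K h \<upsilon> n \<gamma> + bias_term K h n f \<gamma>) \<le> c * (BB h \<beta> n \<gamma> + VV h n \<gamma>)" .
      have "tail_const K h \<Gamma> (Linf_norm f) \<le> c" using D0 vK by (simp add: c_def)
      then show "tail_const K h \<Gamma> (Linf_norm f) / n \<le> c * (1 / n)" by (simp add: divide_right_mono)
    qed
    then have "ennreal (18 * (V_crit K h \<upsilon> n \<gamma> + bias_term K h n f \<gamma>) + tail_const K h \<Gamma> (Linf_norm f) / n)
       \<le> ennreal (c * ((INF \<gamma>\<in>\<Gamma> n. BB h \<beta> n \<gamma> + VV h n \<gamma>) + 1 / real n))"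
      unfolding \<gamma>(2) by (intro ennreal_leI) (simp add: distrib_left)
    with oracle_inequality[OF H b(1,2) a \<gamma>(1)]
    show "risk M X K h n g f \<le> ennreal (c * ((INF \<gamma>\<in>\<Gamma> n. BB h \<beta> n \<gamma> + VV h n \<gamma>) + 1 / real n))"
      by (rule order_trans)
  qed
qed

end
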